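(* Let $n \ge 3$. There exist an infinite-index maximal subgroup $M$ of $\mathrm{PSL}(n,\mathbb{Z})$ and an element $g \in \mathrm{PSL}(n,\mathbb{Z})$ such that $M \cap gMg^{-1}=\{\mathrm{id}\}$.
   Context: $\mathrm{PSL}(n,\mathbb{Z})$ is the quotient of $\mathrm{SL}(n,\mathbb{Z})$ by its center. A maximal subgroup of a group $G$ is a proper subgroup not contained in any other proper subgroup of $G$. *)

theory Defs
  imports "HOL-Algebra.Coset" "Jordan_Normal_Form.Determinant"
begin

definition SL_int :: "nat \<Rightarrow> int mat monoid" where
  "SL_int n = \<lparr>carrier = {A \<in> carrier_mat n n. det A = 1},
               monoid.mult = (*), one = 1\<^sub>m n\<rparr>"

definition center :: "('a, 'b) monoid_scheme \<Rightarrow> 'a set" where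
  "center G = {z \<in> carrier G. \<forall>x \<in> carrier G. z \<otimes>\<^bsub>G\<^esub> x = x \<otimes>\<^bsub>G\<^esub> z}"

definition PSL_int :: "nat \<Rightarrow> int mat set monoid" where
  "PSL_int n = SL_int n Mod center (SL_int n)"

definition maximal_subgroup :: "'a set \<Rightarrow> ('a, 'b) monoid_scheme \<Rightarrow> bool" where
  "maximal_subgroup M G \<longleftrightarrow>
     subgroup M G \<and> M \<noteq> carrier G \<and>
     (\<forall>H. subgroup H G \<and> H \<noteq> carrier G \<and> M \<subseteq> H \<longrightarrow> H = M)"

text \<open>The index of \<open>H\<close> in \<open>G\<close> is the cardinality of the set of right cosets, so infinite
  index has to be expressed by \<open>infinite\<close> rather than through \<open>card\<close>.\<close>

definition infinite_index :: "'a set \<Rightarrow> ('a, 'b) monoid_scheme \<Rightarrow> bool" where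
  "infinite_index H G \<longleftrightarrow> infinite (rcosets\<^bsub>G\<^esub> H)"

lemma group_SL_int: "group (SL_int n)"
proof (rule groupI)
  fix A assume "A \<in> carrier (SL_int n)"
  hence A: "A \<in> carrier_mat n n" and d: "det A = 1"
    by (auto simp: SL_int_def)
  have B: "adj_mat A \<in> carrier_mat n n" and BA: "adj_mat A * A = 1\<^sub>m n"
    using adj_mat[OF A] d by auto
  have "det (adj_mat A) * det A = 1"
    using det_mult[OF B A] BA by simp
  hence "det (adj_mat A) = 1" using d by simp
  thus "\<exists>B\<in>carrier (SL_int n). B \<otimes>\<^bsub>SL_int n\<^esub> A = \<one>\<^bsub>SL_int n\<^esub>"
    using B BA by (auto simp: SL_int_def)
next
  fix A B assume "A \<in> carrier (SL_int n)" "B \<in> carrier (SL_int n)"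
  thus "A \<otimes>\<^bsub>SL_int n\<^esub> B \<in> carrier (SL_int n)"
    by (simp add: SL_int_def det_mult[of A n B] mult_carrier_mat[of A n n B n])
next
  fix A B C
  assume "A \<in> carrier (SL_int n)" "B \<in> carrier (SL_int n)" "C \<in> carrier (SL_int n)"
  thus "A \<otimes>\<^bsub>SL_int n\<^esub> B \<otimes>\<^bsub>SL_int n\<^esub> C = A \<otimes>\<^bsub>SL_int n\<^esub> (B \<otimes>\<^bsub>SL_int n\<^esub> C)"
    by (simp add: SL_int_def assoc_mult_mat[of A n n B n C n])
qed (auto simp: SL_int_def)

lemma (in group) center_normal: "center G \<lhd> G"
proof -
  have cen: "z \<otimes> x = x \<otimes> z" if "z \<in> center G" "x \<in> carrier G" for z x
    using that unfolding center_def by blast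
  have sub: "center G \<subseteq> carrier G"
    unfolding center_def by blast
  have "subgroup (center G) G"
  proof (rule subgroupI)
    have "\<one> \<in> center G" by (simp add: center_def)
    thus "center G \<noteq> {}" by blast
  next
    fix a assume a: "a \<in> center G"
    hence ac: "a \<in> carrier G" using sub by blast
    have "inv a \<otimes> x = x \<otimes> inv a" if x: "x \<in> carrier G" for x
    proof -
      have "inv (inv x \<otimes> a) = inv (a \<otimes> inv x)"
        by (simp only: cen[OF a inv_closed[OF x]])
      thus ?thesis using ac x by (simp add: inv_mult_group)
    qed
    thus "inv a \<in> center G" using ac unfolding center_def by blast
  next
    fix a b assume ab: "a \<in> center G" "b \<in> center G"
    hence c: "a \<in> carrier G" "b \<in> carrier G" using sub by auto
    have "a \<otimes> b \<otimes> x = x \<otimes> (a \<otimes> b)" if x: "x \<in> carrier G" for x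
    proof -
      have "a \<otimes> b \<otimes> x = a \<otimes> (b \<otimes> x)" using c x by (rule m_assoc)
      also have "\<dots> = a \<otimes> (x \<otimes> b)" by (simp only: cen[OF ab(2) x])
      also have "\<dots> = (a \<otimes> x) \<otimes> b" using c x by (simp add: m_assoc)
      also have "\<dots> = (x \<otimes> a) \<otimes> b" by (simp only: cen[OF ab(1) x])
      finally show ?thesis using c x by (simp add: m_assoc)
    qed
    thus "a \<otimes> b \<in> center G" using c unfolding center_def by blast
  qed (rule sub)
  moreover have "x \<otimes> h \<otimes> inv x \<in> center G" if x: "x \<in> carrier G" and h: "h \<in> center G" for x h
  proof -
    have hc: "h \<in> carrier G" using h sub by blast
    have "x \<otimes> h \<otimes> inv x = h \<otimes> x \<otimes> inv x" by (simp only: cen[OF h x])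
    also have "\<dots> = h" using hc x by (simp add: m_assoc)
    finally show ?thesis using h by simp
  qed
  ultimately show ?thesis by (simp add: normal_inv_iff)
qed

lemma group_PSL_int: "group (PSL_int n)"
  unfolding PSL_int_def
  by (rule normal.factorgroup_is_group[OF group.center_normal[OF group_SL_int]])

end

theory Submission
  imports Defs "HOL-Analysis.Lebesgue_Measure" "HOL-Analysis.Infinite_Sum" "HOL-Algebra.Generated_Groups"
begin

text \<open>Write \<open>SL\<close> for the group \<open>SL(n,\<int>)\<close>, \<open>Z\<close> for its center, \<open>nm A\<close> for the sum of the absolute values of the
entries of \<open>A\<close>, \<open>n2 A\<close> for the same sum over the \<open>2 \<times> 2\<close> minors, and \<open>wd A = n2 A / (nm A)\<^sup>2\<close>. Up to constants
\<open>wd A\<close> is the ratio of the two largest singular values, so \<open>wd A\<close> is small when \<open>A\<close> is close to a matrix of rank one.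

It suffices to find a maximal subgroup \<open>M \<supseteq> Z\<close> of \<open>SL\<close> and a \<open>g\<close> with \<open>M \<inter> g M g\<^sup>-\<^sup>1 = Z\<close>; in the quotient by \<open>Z\<close> the map
\<open>x \<mapsto> (M x, M g\<^sup>-\<^sup>1 x)\<close> is then injective, so the index of \<open>M\<close> is infinite. The group \<open>M\<close> is the union of an increasing
sequence of finitely generated groups, the first of which is \<open>Z\<close>. Each step treats a pair \<open>(h,e)\<close> with \<open>h\<close> outside
the current group \<open>D\<close>, and adds elements that put \<open>e\<close> into every larger subgroup containing \<open>h\<close>. The basic
device is to add \<open>x\<close> and \<open>h x e\<close>. When all pairs have been treated, \<open>M\<close> is maximal. The difficulty is to keep
\<open>D \<inter> g D g\<^sup>-\<^sup>1 = Z\<close>, and this is done by an invariant, \<open>tame\<close>: \<open>wd\<close> is summable on \<open>D\<close>; the products \<open>a g\<^sup>\<plusminus>\<^sup>1 b\<close> with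
\<open>a\<close> and \<open>b\<close> in \<open>D\<close> have norm at least a constant times \<open>nm a * nm b\<close>; and some vector \<open>y\<close> and some covector \<open>z\<close> are
good for the set \<open>T = D \<union> D g D \<union> D g\<^sup>-\<^sup>1 D\<close>, that is, \<open>nm (\<tau> y)\<close> and \<open>nm (z \<tau>)\<close> are at least a constant times \<open>nm \<tau>\<close>
on \<open>T\<close>.

The heart of the proof is that a tame group leaves room for transvections in general position: given finitely many
matrices \<open>r\<close> and \<open>q\<close>, there are an integral vector \<open>v\<close> and covector \<open>f\<close> with \<open>f v = 0\<close> such that
\<open>\<bar>f r \<tau> q v\<bar> \<ge> c * nm \<tau>\<close> for all \<open>\<tau>\<close> in \<open>T\<close> for which \<open>r \<tau> q\<close> is not central (\<open>generic_transvection\<close>). Two ideas lead there.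

First, good vectors are dense (\<open>good_line\<close>, \<open>good_dense\<close>). Let \<open>y\<close> be good and \<open>x\<close> arbitrary. For \<open>\<tau>\<close> in \<open>T\<close> let \<open>t \<tau>\<close> be the
parameter at which the dominant coordinate of \<open>\<tau> y\<close> vanishes on \<open>\<tau> (x + t y)\<close>. Parameters at a positive distance from
all the \<open>t \<tau>\<close> give good vectors. If \<open>\<tau>\<close> and \<open>\<sigma>\<close> differ by left multiplication with a generator, then \<open>t \<tau>\<close> and \<open>t \<sigma>\<close> differ
by at most a constant times \<open>wd \<tau>\<close>. As \<open>wd\<close> is summable, all but finitely many jumps have small total length, so the
\<open>t \<tau>\<close> lie in finitely many intervals of small total length, and small rational parameters remain.

Second, for a matrix \<open>A\<close>, a good \<open>v\<close> and a good covector \<open>f\<close> the number \<open>\<bar>f A v\<bar> * nm A\<close> is at least \<open>nm (f A) * nm (A v)\<close> up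
to a multiple of \<open>n2 A\<close> (\<open>nm_rank_one\<close>). So \<open>\<bar>f \<tau> v\<bar>\<close> is large unless \<open>wd \<tau>\<close> is bounded below, which happens
for finitely many \<open>\<tau>\<close> only; these are dealt with by moving \<open>(v,f)\<close> along a polynomial curve of pairs with \<open>f v = 0\<close>
(\<open>generic_incident_pair\<close>).

With \<open>s = 1 + k v f\<close> and a suitable \<open>u\<close> put \<open>x = s u s u\<^sup>-\<^sup>1\<close>. For large \<open>k\<close> the matrices \<open>x\<close>, \<open>h x e\<close> and their inverses are, up
to a relative error of order \<open>1/k\<close>, multiples of matrices of rank one whose images and kernels are in general position
with respect to \<open>T\<close>. Ping-pong (locale \<open>pingpong\<close>) then shows that a word in these letters with spacers from \<open>T\<close> has norm
at least the product of the norms of its factors, up to a constant for each letter, and that \<open>wd\<close> is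
submultiplicative on such words with a small factor for each letter. Hence \<open>wd\<close> stays summable, transversality and good vectors persist, and all elements of the
new set \<open>T\<close> outside the old one have large norm, in particular differ from \<open>g\<close> and \<open>g\<^sup>2\<close> and from any
prescribed finite set (\<open>lword_big\<close>, \<open>tame_Dplus\<close>). Summability also provides the auxiliary elements such as \<open>u\<close>: for \<open>n \<ge> 3\<close> there are
infinitely many elements of \<open>SL\<close> on which \<open>wd\<close> is bounded below, and finitely many translates of \<open>T\<close> cannot contain
them all (\<open>escape\<close>).\<close>

section \<open>Norms of a matrix and of its second exterior power\<close>

text \<open>Sums of absolute values instead of a Euclidean norm keep all estimates polynomial identities followed by the triangle
inequality. The function \<open>n2\<close> counts every minor several times, which only affects constants.\<close>

definition nm :: "int mat \<Rightarrow> real" where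
  "nm A = (\<Sum>i<dim_row A. \<Sum>j<dim_col A. \<bar>real_of_int (A $$ (i,j))\<bar>)"

definition n2 :: "int mat \<Rightarrow> real" where
  "n2 A = (\<Sum>i<dim_row A. \<Sum>j<dim_row A. \<Sum>k<dim_col A. \<Sum>l<dim_col A.
     \<bar>real_of_int (A $$ (i,k) * A $$ (j,l) - A $$ (i,l) * A $$ (j,k))\<bar>)"

definition wd :: "int mat \<Rightarrow> real" where
  "wd A = n2 A / (nm A)\<^sup>2"

lemma index_mult_sum:
  "dim_col A = dim_row B \<Longrightarrow> i < dim_row A \<Longrightarrow> j < dim_col B \<Longrightarrow>
   (A * B :: int mat) $$ (i,j) = (\<Sum>k<dim_col A. A $$ (i,k) * B $$ (k,j))"
  by (simp add: scalar_prod_def atLeast0LessThan)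

lemma mat_assoc:
  "dim_col A = dim_row B \<Longrightarrow> dim_col B = dim_row C \<Longrightarrow> (A * B) * C = A * (B * (C :: int mat))"
  by (metis assoc_mult_mat carrier_matI)

lemma nm_nonneg [simp]: "0 \<le> nm A"
  unfolding nm_def by (intro sum_nonneg) auto

lemma n2_nonneg [simp]: "0 \<le> n2 A"
  unfolding n2_def by (intro sum_nonneg) auto

lemma wd_nonneg [simp]: "0 \<le> wd A"
  unfolding wd_def by simp

lemma entry_le_nm: "i < dim_row A \<Longrightarrow> j < dim_col A \<Longrightarrow> \<bar>real_of_int (A $$ (i,j))\<bar> \<le> nm A"
proof -
  assume i: "i < dim_row A" and j: "j < dim_col A"
  have "\<bar>real_of_int (A $$ (i,j))\<bar> \<le> (\<Sum>j<dim_col A. \<bar>real_of_int (A $$ (i,j))\<bar>)"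
    using j by (intro member_le_sum) auto
  also have "\<dots> \<le> nm A" unfolding nm_def using i
    by (intro member_le_sum[where f = "\<lambda>i. \<Sum>j<dim_col A. \<bar>real_of_int (A $$ (i,j))\<bar>"]) (auto intro: sum_nonneg)
  finally show ?thesis .
qed

lemma nm_ge_1: "i < dim_row A \<Longrightarrow> j < dim_col A \<Longrightarrow> A $$ (i,j) \<noteq> 0 \<Longrightarrow> 1 \<le> nm A"
  using entry_le_nm[of i A j] by linarith

lemma nm_le_entries:
  assumes "dim_row A = m" "dim_col A = r" "\<And>i j. i < m \<Longrightarrow> j < r \<Longrightarrow> \<bar>real_of_int (A $$ (i,j))\<bar> \<le> b"
  shows "nm A \<le> real m * real r * b"
proof -
  have "nm A \<le> (\<Sum>i<m. \<Sum>j<r. b)"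
    unfolding nm_def assms(1,2) by (intro sum_mono) (use assms(3) in auto)
  thus ?thesis by simp
qed

lemma nm_mult: 
  assumes "dim_col A = dim_row B"
  shows "nm (A * B) \<le> nm A * nm B"
proof -
  let ?a = "\<lambda>i k. \<bar>real_of_int (A $$ (i,k))\<bar>" and ?b = "\<lambda>k j. \<bar>real_of_int (B $$ (k,j))\<bar>"
  have "nm (A * B) = (\<Sum>i<dim_row A. \<Sum>j<dim_col B. \<bar>\<Sum>k<dim_col A. real_of_int (A $$ (i,k)) * real_of_int (B $$ (k,j))\<bar>)"
    unfolding nm_def by (intro sum.cong) (auto simp: index_mult_sum assms simp del: index_mult_mat(1))
  also have "\<dots> \<le> (\<Sum>i<dim_row A. \<Sum>j<dim_col B. \<Sum>k<dim_col A. ?a i k * ?b k j)"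
    by (intro sum_mono order_trans[OF sum_abs]) (simp add: abs_mult)
  also have "\<dots> = (\<Sum>i<dim_row A. \<Sum>k<dim_col A. ?a i k * (\<Sum>j<dim_col B. ?b k j))"
    by (subst sum.swap) (simp add: sum_distrib_left)
  also have "\<dots> \<le> (\<Sum>i<dim_row A. \<Sum>k<dim_col A. ?a i k * nm B)"
    unfolding nm_def using assms
    by (intro sum_mono mult_left_mono
         member_le_sum[where f = "\<lambda>k. \<Sum>j<dim_col B. ?b k j"]) (auto intro: sum_nonneg)
  also have "\<dots> = nm A * nm B"
    unfolding nm_def by (simp add: sum_distrib_right)
  finally show ?thesis .
qed

lemma nm_mult1: 
  assumes "dim_col A = 1" "dim_row B = 1"
  shows "nm (A * B) = nm A * nm B"
proof -
  have "nm (A * B) = (\<Sum>i<dim_row A. \<Sum>j<dim_col B. \<bar>real_of_int (A $$ (i,0))\<bar> * \<bar>real_of_int (B $$ (0,j))\<bar>)"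
    unfolding nm_def by (intro sum.cong) (auto simp: index_mult_sum assms abs_mult simp del: index_mult_mat(1))
  also have "\<dots> = nm A * nm B"
    unfolding nm_def by (simp add: assms sum_product)
  finally show ?thesis .
qed

lemma nm_add: 
  assumes "dim_row A = dim_row B" "dim_col A = dim_col B"
  shows "nm (A + B) \<le> nm A + nm B"
proof -
  have "nm (A + B) \<le> (\<Sum>i<dim_row B. \<Sum>j<dim_col B. \<bar>real_of_int (A $$ (i,j))\<bar> + \<bar>real_of_int (B $$ (i,j))\<bar>)"
    unfolding nm_def by (auto intro!: sum_mono)
  thus ?thesis unfolding nm_def assms by (simp add: sum.distrib)
qed

lemma nm_add_ge: 
  assumes "dim_row A = dim_row B" "dim_col A = dim_col B"
  shows "nm A - nm B \<le> nm (A + B)"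
proof -
  have "nm A \<le> (\<Sum>i<dim_row B. \<Sum>j<dim_col B. \<bar>real_of_int ((A+B) $$ (i,j))\<bar> + \<bar>real_of_int (B $$ (i,j))\<bar>)"
    unfolding nm_def using assms by (auto intro!: sum_mono)
  thus ?thesis unfolding nm_def assms using assms by (simp add: sum.distrib)
qed

lemma nm_smult: "nm (k \<cdot>\<^sub>m A) = \<bar>real_of_int k\<bar> * nm A"
  unfolding nm_def by (simp add: abs_mult sum_distrib_left)

lemma nm_transpose [simp]: "nm (transpose_mat A) = nm A"
  unfolding nm_def by (simp, subst sum.swap, simp)

lemma sum_swap22:
  fixes f :: "'a \<Rightarrow> 'b \<Rightarrow> 'c \<Rightarrow> 'd \<Rightarrow> 'e::comm_monoid_add"
  shows "(\<Sum>k\<in>C. \<Sum>l\<in>D. \<Sum>i\<in>A. \<Sum>j\<in>B. f k l i j) = (\<Sum>i\<in>A. \<Sum>j\<in>B. \<Sum>k\<in>C. \<Sum>l\<in>D. f k l i j)"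
proof -
  have sw: "(\<Sum>k\<in>C. \<Sum>l\<in>D. \<Sum>i\<in>I. h k l i) = (\<Sum>i\<in>I. \<Sum>k\<in>C. \<Sum>l\<in>D. h k l i)"
    for h :: "'a \<Rightarrow> 'b \<Rightarrow> 'x \<Rightarrow> 'e" and I
  proof -
    have "(\<Sum>l\<in>D. \<Sum>i\<in>I. h k l i) = (\<Sum>i\<in>I. \<Sum>l\<in>D. h k l i)" for k
      by (rule sum.swap)
    thus ?thesis by (simp only:) (rule sum.swap)
  qed
  show ?thesis by (simp only: sw)
qed

lemma n2_transpose [simp]: "n2 (transpose_mat A) = n2 A"
proof -
  let ?g = "\<lambda>i j k l. \<bar>real_of_int (A $$ (i,k) * A $$ (j,l) - A $$ (i,l) * A $$ (j,k))\<bar>"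
  have "n2 (transpose_mat A) = (\<Sum>k<dim_col A. \<Sum>l<dim_col A. \<Sum>i<dim_row A. \<Sum>j<dim_row A. ?g i j k l)"
    unfolding n2_def by (simp add: mult.commute)
  also have "\<dots> = (\<Sum>i<dim_row A. \<Sum>j<dim_row A. \<Sum>k<dim_col A. \<Sum>l<dim_col A. ?g i j k l)"
    by (rule sum_swap22)
  finally show ?thesis unfolding n2_def .
qed

lemma wd_transpose [simp]: "wd (transpose_mat A) = wd A"
  unfolding wd_def by simp

text \<open>By the Cauchy--Binet formula a minor of \<open>A * B\<close> is a sum of products of minors of the factors. Every unordered pair
of indices occurs twice in the sum below, which is why twice the minor appears in the proof.\<close>

lemma n2_mult:
  assumes "dim_col A = dim_row B"
  shows "n2 (A * B) \<le> n2 A * n2 B"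
proof -
  let ?m = "dim_row A" and ?c = "dim_col A" and ?r = "dim_col B"
  define M where "M = (\<lambda>i j k l. A $$ (i,k) * A $$ (j,l) - A $$ (i,l) * A $$ (j,k))"
  define N where "N = (\<lambda>i j k l. B $$ (i,k) * B $$ (j,l) - B $$ (i,l) * B $$ (j,k))"
  have *: "\<bar>real_of_int ((A*B) $$ (i,k) * (A*B) $$ (j,l) - (A*B) $$ (i,l) * (A*B) $$ (j,k))\<bar>
      \<le> (\<Sum>a<?c. \<Sum>b<?c. \<bar>real_of_int (M i j a b)\<bar> * \<bar>real_of_int (N a b k l)\<bar>)"
    if "i < ?m" "j < ?m" "k < ?r" "l < ?r" for i j k l
  proof -
    let ?d = "(A*B) $$ (i,k) * (A*B) $$ (j,l) - (A*B) $$ (i,l) * (A*B) $$ (j,k)"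
    have 1: "?d = (\<Sum>a<?c. \<Sum>b<?c. A $$ (i,a) * A $$ (j,b) * N a b k l)"
      using that assms unfolding N_def
      by (simp add: index_mult_sum sum_product sum_subtractf[symmetric] algebra_simps del: index_mult_mat(1))
    have "?d = (\<Sum>b<?c. \<Sum>a<?c. A $$ (i,a) * A $$ (j,b) * N a b k l)"
      unfolding 1 by (rule sum.swap)
    also have "\<dots> = (\<Sum>a<?c. \<Sum>b<?c. - (A $$ (i,b) * A $$ (j,a) * N a b k l))"
      unfolding N_def by (intro sum.cong refl) (simp add: algebra_simps)
    finally have "2 * ?d = (\<Sum>a<?c. \<Sum>b<?c. A $$ (i,a) * A $$ (j,b) * N a b k l)
        + (\<Sum>a<?c. \<Sum>b<?c. - (A $$ (i,b) * A $$ (j,a) * N a b k l))"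
      using 1 by simp
    also have "\<dots> = (\<Sum>a<?c. \<Sum>b<?c. M i j a b * N a b k l)"
      unfolding M_def sum.distrib[symmetric] by (intro sum.cong refl) (simp add: algebra_simps)
    finally have "2 * \<bar>real_of_int ?d\<bar> = \<bar>\<Sum>a<?c. \<Sum>b<?c. real_of_int (M i j a b) * real_of_int (N a b k l)\<bar>"
      by (metis (mono_tags, lifting) abs_mult abs_numeral of_int_mult of_int_numeral of_int_sum sum.cong)
    also have "\<dots> \<le> (\<Sum>a<?c. \<Sum>b<?c. \<bar>real_of_int (M i j a b)\<bar> * \<bar>real_of_int (N a b k l)\<bar>)"
      by (intro order_trans[OF sum_abs] sum_mono) (simp add: abs_mult)
    finally have "2 * \<bar>real_of_int ?d\<bar> \<le> (\<Sum>a<?c. \<Sum>b<?c. \<bar>real_of_int (M i j a b)\<bar> * \<bar>real_of_int (N a b k l)\<bar>)" .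
    moreover have "\<bar>real_of_int ?d\<bar> \<le> 2 * \<bar>real_of_int ?d\<bar>" by simp
    ultimately show ?thesis by (rule order_trans[rotated])
  qed
  have "n2 (A * B) \<le> (\<Sum>i<?m. \<Sum>j<?m. \<Sum>k<?r. \<Sum>l<?r. \<Sum>a<?c. \<Sum>b<?c. \<bar>real_of_int (M i j a b)\<bar> * \<bar>real_of_int (N a b k l)\<bar>)"
    unfolding n2_def index_mult_mat(2,3) by (intro sum_mono *) auto
  also have "\<dots> = (\<Sum>i<?m. \<Sum>j<?m. \<Sum>a<?c. \<Sum>b<?c. \<bar>real_of_int (M i j a b)\<bar> * (\<Sum>k<?r. \<Sum>l<?r. \<bar>real_of_int (N a b k l)\<bar>))"
    by (subst sum_swap22) (simp add: sum_distrib_left)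
  also have "\<dots> \<le> (\<Sum>i<?m. \<Sum>j<?m. \<Sum>a<?c. \<Sum>b<?c. \<bar>real_of_int (M i j a b)\<bar> * n2 B)"
  proof (intro sum_mono mult_left_mono)
    fix a b assume ab: "a \<in> {..<?c}" "b \<in> {..<?c}"
    have "(\<Sum>k<?r. \<Sum>l<?r. \<bar>real_of_int (N a b k l)\<bar>) \<le> (\<Sum>b<?c. \<Sum>k<?r. \<Sum>l<?r. \<bar>real_of_int (N a b k l)\<bar>)"
      using ab by (intro member_le_sum[where f = "\<lambda>b. \<Sum>k<?r. \<Sum>l<?r. \<bar>real_of_int (N a b k l)\<bar>"]) (auto intro!: sum_nonneg)
    also have "\<dots> \<le> (\<Sum>a<?c. \<Sum>b<?c. \<Sum>k<?r. \<Sum>l<?r. \<bar>real_of_int (N a b k l)\<bar>)"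
      using ab by (intro member_le_sum[where f = "\<lambda>a. \<Sum>b<?c. \<Sum>k<?r. \<Sum>l<?r. \<bar>real_of_int (N a b k l)\<bar>"]) (auto intro!: sum_nonneg)
    also have "\<dots> = n2 B" unfolding n2_def N_def assms by simp
    finally show "(\<Sum>k<?r. \<Sum>l<?r. \<bar>real_of_int (N a b k l)\<bar>) \<le> n2 B" .
  qed auto
  also have "\<dots> = n2 A * n2 B"
    unfolding n2_def M_def by (simp add: sum_distrib_right)
  finally show ?thesis .
qed

text \<open>The terms of second order in \<open>k\<close> cancel in each minor because \<open>p * f\<close> has rank one.\<close>

lemma n2_rank_one_perturb:
  assumes P: "dim_col p = 1" "dim_row f = 1" "dim_row p = dim_row E" "dim_col f = dim_col E"
  shows "n2 (k \<cdot>\<^sub>m (p * f) + E) \<le> 4 * \<bar>real_of_int k\<bar> * (nm p * nm f) * nm E + 2 * (nm E)\<^sup>2"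
proof -
  let ?m = "dim_row E" and ?r = "dim_col E"
  define a where "a = (\<lambda>i j. \<bar>real_of_int (k * (p $$ (i,0) * f $$ (0,j)))\<bar>)"
  define e where "e = (\<lambda>i j. \<bar>real_of_int (E $$ (i,j))\<bar>)"
  have ent: "(k \<cdot>\<^sub>m (p * f) + E) $$ (i,j) = k * (p $$ (i,0) * f $$ (0,j)) + E $$ (i,j)"
    if "i < ?m" "j < ?r" for i j
    using that assms by (simp add: index_mult_sum del: index_mult_mat(1))
  have *: "\<bar>real_of_int ((k \<cdot>\<^sub>m (p * f) + E) $$ (i,s) * (k \<cdot>\<^sub>m (p * f) + E) $$ (j,t)
          - (k \<cdot>\<^sub>m (p * f) + E) $$ (i,t) * (k \<cdot>\<^sub>m (p * f) + E) $$ (j,s))\<bar>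
      \<le> a i s * e j t + e i s * a j t + a i t * e j s + e i t * a j s + e i s * e j t + e i t * e j s"
    (is "\<bar>real_of_int ?d\<bar> \<le> _")
    if "i < ?m" "j < ?m" "s < ?r" "t < ?r" for i j s t
  proof -
    define x y z w where "x = k * (p $$ (i,0) * f $$ (0,s))" and "y = k * (p $$ (j,0) * f $$ (0,t))"
      and "z = k * (p $$ (i,0) * f $$ (0,t))" and "w = k * (p $$ (j,0) * f $$ (0,s))"
    have xy: "x * y = z * w" unfolding x_def y_def z_def w_def by (simp add: algebra_simps)
    have "?d = x * E $$ (j,t) + E $$ (i,s) * y - z * E $$ (j,s) - E $$ (i,t) * w + E $$ (i,s) * E $$ (j,t) - E $$ (i,t) * E $$ (j,s)"
      unfolding ent[OF that(1,3)] ent[OF that(2,4)] ent[OF that(1,4)] ent[OF that(2,3)]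
        x_def[symmetric] y_def[symmetric] z_def[symmetric] w_def[symmetric]
      using xy by (simp add: algebra_simps)
    hence "\<bar>real_of_int ?d\<bar> \<le> \<bar>real_of_int (x * E $$ (j,t))\<bar> + \<bar>real_of_int (E $$ (i,s) * y)\<bar> + \<bar>real_of_int (z * E $$ (j,s))\<bar>
       + \<bar>real_of_int (E $$ (i,t) * w)\<bar> + \<bar>real_of_int (E $$ (i,s) * E $$ (j,t))\<bar> + \<bar>real_of_int (E $$ (i,t) * E $$ (j,s))\<bar>"
      by linarith
    thus ?thesis unfolding a_def e_def x_def y_def z_def w_def by (simp add: abs_mult)
  qed
  have sa: "(\<Sum>i<?m. \<Sum>j<?r. a i j) = \<bar>real_of_int k\<bar> * (nm p * nm f)"
  proof -
    have "nm p = (\<Sum>i<?m. \<bar>real_of_int (p $$ (i,0))\<bar>)" "nm f = (\<Sum>j<?r. \<bar>real_of_int (f $$ (0,j))\<bar>)"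
      unfolding nm_def using assms by simp_all
    thus ?thesis unfolding a_def
      by (simp only: abs_mult of_int_mult sum_product) (simp only: sum_distrib_left)
  qed
  have se: "(\<Sum>i<?m. \<Sum>j<?r. e i j) = nm E"
    unfolding e_def nm_def by simp
  have pr: "(\<Sum>i<?m. \<Sum>j<?m. \<Sum>s<?r. \<Sum>t<?r. u i s * v j t) = (\<Sum>i<?m. \<Sum>j<?r. u i j) * (\<Sum>i<?m. \<Sum>j<?r. v i j)"
    for u v :: "nat \<Rightarrow> nat \<Rightarrow> real"
    by (simp add: sum_product)
  have pr': "(\<Sum>i<?m. \<Sum>j<?m. \<Sum>s<?r. \<Sum>t<?r. u i t * v j s) = (\<Sum>i<?m. \<Sum>j<?r. u i j) * (\<Sum>i<?m. \<Sum>j<?r. v i j)"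
    for u v :: "nat \<Rightarrow> nat \<Rightarrow> real"
    unfolding pr[symmetric] by (rule sum.cong[OF refl], rule sum.cong[OF refl], rule sum.swap)
  have "n2 (k \<cdot>\<^sub>m (p * f) + E) \<le> (\<Sum>i<?m. \<Sum>j<?m. \<Sum>s<?r. \<Sum>t<?r.
      a i s * e j t + e i s * a j t + a i t * e j s + e i t * a j s + e i s * e j t + e i t * e j s)"
    unfolding n2_def index_add_mat(2,3) by (intro sum_mono *) auto
  also have "\<dots> = 4 * (\<bar>real_of_int k\<bar> * (nm p * nm f)) * nm E + 2 * (nm E)\<^sup>2"
    by (simp only: sum.distrib pr pr' sa se) (simp add: power2_eq_square)
  finally show ?thesis by simp
qed

text \<open>If \<open>A\<close> had rank one, \<open>(f A)\<^sub>l (A v)\<^sub>i\<close> would equal \<open>(f A v) A\<^sub>i\<^sub>l\<close>; in general the difference is a combination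
of minors with coefficients \<open>f\<^sub>j v\<^sub>k\<close>. A lower bound for \<open>f A\<close> and \<open>A v\<close> therefore becomes one for
the number \<open>f A v\<close> when the minors are small.\<close>

lemma nm_rank_one:
  assumes d: "dim_row f = 1" "dim_col f = dim_row A" "dim_col A = dim_row v" "dim_col v = 1"
  shows "nm (f * A) * nm (A * v) \<le> nm (f * A * v) * nm A + nm f * nm v * n2 A"
proof -
  let ?m = "dim_row A" and ?r = "dim_col A"
  let ?R = "real_of_int"
  define F V where "F = (\<lambda>l. ?R ((f * A) $$ (0,l)))" and "V = (\<lambda>i. ?R ((A * v) $$ (i,0)))"
  define a where "a = (\<lambda>i j. ?R (A $$ (i,j)))"
  define s where "s = ?R ((f * A * v) $$ (0,0))"
  have F: "F l = (\<Sum>j<?m. ?R (f $$ (0,j)) * a j l)" if "l < ?r" for l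
    unfolding F_def a_def using that d by (simp add: index_mult_sum del: index_mult_mat(1))
  have V: "V i = (\<Sum>k<?r. a i k * ?R (v $$ (k,0)))" if "i < ?m" for i
    unfolding V_def a_def using that d by (simp add: index_mult_sum del: index_mult_mat(1))
  have s: "s = (\<Sum>j<?m. \<Sum>k<?r. ?R (f $$ (0,j)) * ?R (v $$ (k,0)) * a j k)"
  proof -
    have "s = (\<Sum>k<?r. F k * ?R (v $$ (k,0)))"
      unfolding s_def F_def using d by (subst index_mult_sum) (auto simp del: index_mult_mat(1))
    also have "\<dots> = (\<Sum>k<?r. \<Sum>j<?m. ?R (f $$ (0,j)) * ?R (v $$ (k,0)) * a j k)"
      by (intro sum.cong refl) (simp add: F sum_distrib_left sum_distrib_right mult_ac)
    finally show ?thesis by (subst sum.swap) 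
  qed
  have key: "\<bar>F l\<bar> * \<bar>V i\<bar> \<le> \<bar>s\<bar> * \<bar>a i l\<bar> + (\<Sum>j<?m. \<Sum>k<?r. \<bar>?R (f $$ (0,j))\<bar> * \<bar>?R (v $$ (k,0))\<bar> * \<bar>a i k * a j l - a i l * a j k\<bar>)"
    if "i < ?m" "l < ?r" for i l
  proof -
    have "F l * V i = s * a i l + (\<Sum>j<?m. \<Sum>k<?r. ?R (f $$ (0,j)) * ?R (v $$ (k,0)) * (a i k * a j l - a i l * a j k))"
    proof -
      have "F l * V i = (\<Sum>j<?m. \<Sum>k<?r. (?R (f $$ (0,j)) * a j l) * (a i k * ?R (v $$ (k,0))))"
        unfolding F[OF that(2)] V[OF that(1)] by (rule sum_product)
      also have "\<dots> = (\<Sum>j<?m. \<Sum>k<?r. ?R (f $$ (0,j)) * ?R (v $$ (k,0)) * a j k * a i l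
           + ?R (f $$ (0,j)) * ?R (v $$ (k,0)) * (a i k * a j l - a i l * a j k))"
        by (intro sum.cong refl) (simp add: algebra_simps)
      also have "\<dots> = s * a i l + (\<Sum>j<?m. \<Sum>k<?r. ?R (f $$ (0,j)) * ?R (v $$ (k,0)) * (a i k * a j l - a i l * a j k))"
        unfolding s by (simp only: sum.distrib sum_distrib_right)
      finally show ?thesis .
    qed
    hence "\<bar>F l * V i\<bar> \<le> \<bar>s * a i l\<bar> + \<bar>\<Sum>j<?m. \<Sum>k<?r. ?R (f $$ (0,j)) * ?R (v $$ (k,0)) * (a i k * a j l - a i l * a j k)\<bar>"
      by (simp only: abs_triangle_ineq)
    hence "\<bar>F l\<bar> * \<bar>V i\<bar> \<le> \<bar>s\<bar> * \<bar>a i l\<bar> + \<bar>\<Sum>j<?m. \<Sum>k<?r. ?R (f $$ (0,j)) * ?R (v $$ (k,0)) * (a i k * a j l - a i l * a j k)\<bar>"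
      by (simp only: abs_mult)
    also have "\<bar>\<Sum>j<?m. \<Sum>k<?r. ?R (f $$ (0,j)) * ?R (v $$ (k,0)) * (a i k * a j l - a i l * a j k)\<bar>
      \<le> (\<Sum>j<?m. \<Sum>k<?r. \<bar>?R (f $$ (0,j))\<bar> * \<bar>?R (v $$ (k,0))\<bar> * \<bar>a i k * a j l - a i l * a j k\<bar>)"
      by (intro order_trans[OF sum_abs] sum_mono) (simp add: abs_mult)
    finally show ?thesis by simp
  qed
  have nf: "\<bar>?R (f $$ (0,j))\<bar> \<le> nm f" if "j < ?m" for j using that d by (intro entry_le_nm) auto
  have nv: "\<bar>?R (v $$ (j,0))\<bar> \<le> nm v" if "j < ?r" for j using that d by (intro entry_le_nm) auto
  have "nm (f * A) * nm (A * v) = (\<Sum>i<?m. \<Sum>l<?r. \<bar>F l\<bar> * \<bar>V i\<bar>)"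
    unfolding nm_def F_def V_def using d by (simp add: sum_product mult.commute del: index_mult_mat(1))
  also have "\<dots> \<le> (\<Sum>i<?m. \<Sum>l<?r. \<bar>s\<bar> * \<bar>a i l\<bar> + (\<Sum>j<?m. \<Sum>k<?r. nm f * nm v * \<bar>a i k * a j l - a i l * a j k\<bar>))"
    by (intro sum_mono order_trans[OF key] add_left_mono mult_mono nf nv) auto
  also have "\<dots> = \<bar>s\<bar> * nm A + nm f * nm v * (\<Sum>i<?m. \<Sum>l<?r. \<Sum>j<?m. \<Sum>k<?r. \<bar>a i k * a j l - a i l * a j k\<bar>)"
    unfolding nm_def a_def sum.distrib by (simp add: sum_distrib_left)
  also have "(\<Sum>i<?m. \<Sum>l<?r. \<Sum>j<?m. \<Sum>k<?r. \<bar>a i k * a j l - a i l * a j k\<bar>) = n2 A"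
    unfolding n2_def a_def
    by (rule sum.cong[OF refl], rule trans[OF sum.swap], rule sum.cong[OF refl], rule trans[OF sum.swap]) simp
  also have "\<bar>s\<bar> = nm (f * A * v)"
    unfolding nm_def s_def using d by simp
  finally show ?thesis .
qed

lemma minor_le_n2:
  assumes d: "dim_col A = dim_row x" "dim_col A = dim_row y" "dim_col x = 1" "dim_col y = 1"
    and ij: "i < dim_row A" "j < dim_row A"
  shows "\<bar>real_of_int ((A * x) $$ (j,0) * (A * y) $$ (i,0) - (A * x) $$ (i,0) * (A * y) $$ (j,0))\<bar> \<le> nm x * nm y * n2 A"
proof -
  let ?r = "dim_col A" and ?R = real_of_int
  define a where "a = (\<lambda>i j. ?R (A $$ (i,j)))"
  let ?X = "\<lambda>k. ?R (x $$ (k,0))" and ?Y = "\<lambda>k. ?R (y $$ (k,0))"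
  have X: "?R ((A * x) $$ (i,0)) = (\<Sum>k<?r. a i k * ?X k)" if "i < dim_row A" for i
    unfolding a_def using that d by (simp add: index_mult_sum del: index_mult_mat(1))
  have Y: "?R ((A * y) $$ (i,0)) = (\<Sum>k<?r. a i k * ?Y k)" if "i < dim_row A" for i
    unfolding a_def using that d by (simp add: index_mult_sum del: index_mult_mat(1))
  have "?R ((A * x) $$ (j,0) * (A * y) $$ (i,0) - (A * x) $$ (i,0) * (A * y) $$ (j,0))
     = (\<Sum>k<?r. \<Sum>l<?r. ?X k * ?Y l * (a j k * a i l - a i k * a j l))"
  proof -
    have "?R ((A * x) $$ (j,0) * (A * y) $$ (i,0) - (A * x) $$ (i,0) * (A * y) $$ (j,0))
      = (\<Sum>k<?r. \<Sum>l<?r. (a j k * ?X k) * (a i l * ?Y l)) - (\<Sum>k<?r. \<Sum>l<?r. (a i k * ?X k) * (a j l * ?Y l))"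
      by (simp only: of_int_diff of_int_mult X[OF ij(1)] X[OF ij(2)] Y[OF ij(1)] Y[OF ij(2)] sum_product)
    also have "\<dots> = (\<Sum>k<?r. \<Sum>l<?r. (a j k * ?X k) * (a i l * ?Y l) - (a i k * ?X k) * (a j l * ?Y l))"
      by (simp only: sum_subtractf)
    finally show ?thesis by (simp add: algebra_simps)
  qed
  hence "\<bar>?R ((A * x) $$ (j,0) * (A * y) $$ (i,0) - (A * x) $$ (i,0) * (A * y) $$ (j,0))\<bar>
     \<le> (\<Sum>k<?r. \<Sum>l<?r. \<bar>?X k\<bar> * \<bar>?Y l\<bar> * \<bar>a j k * a i l - a i k * a j l\<bar>)"
    by (auto intro!: order_trans[OF sum_abs] sum_mono simp: abs_mult)
  also have "\<dots> \<le> (\<Sum>k<?r. \<Sum>l<?r. nm x * nm y * \<bar>a j k * a i l - a i k * a j l\<bar>)"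
    using d by (intro sum_mono mult_right_mono mult_mono entry_le_nm) auto
  also have "\<dots> = nm x * nm y * (\<Sum>k<?r. \<Sum>l<?r. \<bar>a j k * a i l - a i k * a j l\<bar>)"
    by (simp add: sum_distrib_left)
  also have "(\<Sum>k<?r. \<Sum>l<?r. \<bar>a j k * a i l - a i k * a j l\<bar>) \<le> n2 A"
  proof -
    let ?h = "\<lambda>j i. \<Sum>k<?r. \<Sum>l<?r. \<bar>a j k * a i l - a j l * a i k\<bar>"
    have "(\<Sum>k<?r. \<Sum>l<?r. \<bar>a j k * a i l - a i k * a j l\<bar>) = ?h j i" by (simp add: mult.commute)
    also have "\<dots> \<le> (\<Sum>i<dim_row A. ?h j i)"
      using ij by (intro member_le_sum[where f = "?h j"]) (auto intro!: sum_nonneg)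
    also have "\<dots> \<le> (\<Sum>j<dim_row A. \<Sum>i<dim_row A. ?h j i)"
      using ij by (intro member_le_sum[where f = "\<lambda>j. \<Sum>i<dim_row A. ?h j i"]) (auto intro!: sum_nonneg)
    also have "\<dots> = n2 A" unfolding n2_def a_def by simp
    finally show ?thesis .
  qed
  finally show ?thesis by (simp add: mult_left_mono)
qed

section \<open>Good vectors on a line\<close>

definition good :: "int mat set \<Rightarrow> int mat \<Rightarrow> bool" where
  "good T y \<longleftrightarrow> (\<exists>c>0. \<forall>\<tau>\<in>T. c * nm \<tau> \<le> nm (\<tau> * y))"

lemma large_entry:
  assumes "dim_row v = n" "dim_col v = 1" "n > 0"
  shows "\<exists>i<n. nm v / real n \<le> \<bar>real_of_int (v $$ (i,0))\<bar>"
proof (rule ccontr)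
  assume "\<not> ?thesis"
  hence *: "\<bar>real_of_int (v $$ (i,0))\<bar> < nm v / real n" if "i < n" for i using that by force
  have "nm v = (\<Sum>i<n. \<bar>real_of_int (v $$ (i,0))\<bar>)" unfolding nm_def assms by simp
  also have "\<dots> < (\<Sum>i<n. nm v / real n)" using * assms(3) by (intro sum_strict_mono) auto
  finally show False using assms(3) by simp
qed

lemma summable_tail:
  fixes w :: "'a \<Rightarrow> real"
  assumes "w summable_on T" "\<delta> > 0"
  shows "\<exists>F. finite F \<and> F \<subseteq> T \<and> infsum w (T - F) \<le> \<delta>"
proof -
  obtain F where F: "finite F" "F \<subseteq> T" "dist (sum w F) (infsum w T) \<le> \<delta>"
    using has_sum_finite_approximation[OF has_sum_infsum[OF assms(1)] assms(2)] by blast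
  have "infsum w (F \<union> (T - F)) = infsum w F + infsum w (T - F)"
    using F by (intro infsum_Un_disjoint summable_on_finite summable_on_subset_banach[OF assms(1)]) auto
  moreover have "F \<union> (T - F) = T" using F by auto
  ultimately have "infsum w T = sum w F + infsum w (T - F)" using F by simp
  thus ?thesis using F by (intro exI[of _ F]) (auto simp: dist_real_def)
qed

text \<open>Finitely many closed intervals of total length less than \<open>\<epsilon>\<close> do not cover \<open>{0<..<\<epsilon>}\<close>. The uncovered part
is open, so it contains a rational number at a positive distance from all the intervals.\<close>

lemma real_gap:
  fixes t r :: "'a \<Rightarrow> real"
  assumes fin: "finite F" and r: "\<And>f. f \<in> F \<Longrightarrow> 0 \<le> r f" and s: "2 * sum r F < \<epsilon>"
  shows "\<exists>(a::int) (b::int) d. b > 0 \<and> \<bar>real_of_int a\<bar> \<le> \<epsilon> * real_of_int b \<and> d > 0 \<and>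
    (\<forall>f\<in>F. r f + d \<le> \<bar>real_of_int a / real_of_int b - t f\<bar>)"
proof -
  define U where "U = (\<Union>f\<in>F. {t f - r f .. t f + r f})"
  have clU: "closed U" unfolding U_def using fin by (intro closed_UN) auto
  have "emeasure lborel U \<le> (\<Sum>f\<in>F. emeasure lborel {t f - r f .. t f + r f})"
    unfolding U_def by (intro emeasure_subadditive_finite fin) auto
  also have "\<dots> = (\<Sum>f\<in>F. ennreal (2 * r f))"
    using r by (intro sum.cong refl) (auto simp: emeasure_lborel_Icc_eq)
  also have "\<dots> = ennreal (2 * sum r F)" using r by (subst sum_ennreal) (auto simp: sum_distrib_left)
  also have "\<dots> < ennreal \<epsilon>" using s r sum_nonneg[of F r] by (intro ennreal_lessI) auto
  finally have lt: "emeasure lborel U < ennreal \<epsilon>" .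
  have e0: "0 < \<epsilon>" using s sum_nonneg[of F r] r by force
  have "\<not> {0<..<\<epsilon>} \<subseteq> U"
  proof
    assume "{0<..<\<epsilon>} \<subseteq> U"
    hence "emeasure lborel {0<..<\<epsilon>} \<le> emeasure lborel U"
      by (intro emeasure_mono) (use clU in auto)
    thus False using lt e0 by simp
  qed
  then obtain u where u: "u \<in> {0<..<\<epsilon>} - U" by blast
  have "open ({0<..<\<epsilon>} - U)" using clU by (intro open_Diff) auto
  then obtain \<rho> where \<rho>: "\<rho> > 0" "\<And>v. dist v u < \<rho> \<Longrightarrow> v \<in> {0<..<\<epsilon>} - U"
    using u unfolding open_dist by blast
  obtain q :: rat where q: "u < of_rat q" "of_rat q < u + \<rho>"
    using of_rat_dense[of u "u + \<rho>"] \<rho>(1) by auto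
  obtain a b where ab: "quotient_of q = (a, b)" by force
  have b: "b > 0" using quotient_of_denom_pos[OF ab] .
  have qe: "real_of_rat q = real_of_int a / real_of_int b"
    using quotient_of_div[OF ab] by (simp add: of_rat_divide)
  let ?q = "real_of_int a / real_of_int b"
  have q2: "?q \<in> {0<..<\<epsilon>} - U" using q qe by (intro \<rho>(2)) (simp add: dist_real_def)
  define d where "d = Min (insert 1 ((\<lambda>f. \<bar>?q - t f\<bar> - r f) ` F))"
  have gt: "0 < \<bar>?q - t f\<bar> - r f" if "f \<in> F" for f
  proof -
    have "?q \<notin> {t f - r f .. t f + r f}" using q2 that unfolding U_def by blast
    thus ?thesis by auto
  qed
  have d0: "d > 0" unfolding d_def using fin gt by (subst Min_gr_iff) auto
  have dle: "d \<le> \<bar>?q - t f\<bar> - r f" if "f \<in> F" for f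
    unfolding d_def using fin that by (intro Min_le) auto
  show ?thesis
  proof (rule exI[of _ a], rule exI[of _ b], rule exI[of _ d], intro conjI ballI)
    show "\<bar>real_of_int a\<bar> \<le> \<epsilon> * real_of_int b" using q2 b by (simp add: field_simps)
  qed (use b d0 dle in \<open>auto simp: algebra_simps\<close>)
qed

text \<open>Among the vectors \<open>x + t y\<close> those with \<open>t\<close> at a positive distance from all \<open>t \<tau>\<close> are good, where \<open>t \<tau>\<close> is the zero of
the coordinate that dominates \<open>\<tau> y\<close>. The assumption \<open>link\<close> connects each \<open>\<tau>\<close> to a shorter \<open>\<sigma> \<in> T\<close> by a bounded factor, and then
\<open>t \<tau>\<close> and \<open>t \<sigma>\<close> differ by at most \<open>K * wd \<tau>\<close>. Descending to elements of length at most \<open>N\<close>, for a large \<open>N\<close>, shows that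
the \<open>t \<tau>\<close> lie in finitely many intervals whose total length is controlled by a tail of the series of \<open>wd\<close>. The
conclusion clears denominators: the parameter is \<open>a / b\<close>.\<close>

lemma good_line:
  fixes T :: "int mat set" and l :: "int mat \<Rightarrow> nat"
  assumes TD: "\<And>\<tau>. \<tau> \<in> T \<Longrightarrow> dim_row \<tau> = n \<and> dim_col \<tau> = n \<and> 1 \<le> nm \<tau>"
    and sm: "wd summable_on T"
    and fin: "\<And>N. finite {\<tau>\<in>T. l \<tau> \<le> N}"
    and link: "\<And>\<tau>. \<tau> \<in> T \<Longrightarrow> 0 < l \<tau> \<Longrightarrow> \<exists>\<sigma>\<in>T. \<exists>a. l \<sigma> < l \<tau> \<and> \<tau> = a * \<sigma> \<and>
        dim_row a = n \<and> dim_col a = n \<and> nm a \<le> C \<and> n2 \<sigma> \<le> C * n2 \<tau>"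
    and y: "dim_row y = n" "dim_col y = 1" "good T y"
    and x: "dim_row x = n" "dim_col x = 1"
    and e: "\<epsilon> > 0" and n: "n > 0" and C0: "0 \<le> C"
  shows "\<exists>a b. b > 0 \<and> \<bar>real_of_int a\<bar> \<le> \<epsilon> * real_of_int b \<and> good T (b \<cdot>\<^sub>m x + a \<cdot>\<^sub>m y)"
proof -
  obtain c where c: "c > 0" "\<And>\<tau>. \<tau> \<in> T \<Longrightarrow> c * nm \<tau> \<le> nm (\<tau> * y)"
    using y(3) unfolding good_def by blast
  define c' where "c' = c / real n"
  have c': "c' > 0" unfolding c'_def using c n by simp
  have "\<exists>i<n. c' * nm \<tau> \<le> \<bar>real_of_int ((\<tau> * y) $$ (i,0))\<bar>" if "\<tau> \<in> T" for \<tau>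
  proof -
    have "dim_row (\<tau> * y) = n" "dim_col (\<tau> * y) = 1" using TD[OF that] y by auto
    from large_entry[OF this n] obtain i where "i < n" "nm (\<tau> * y) / real n \<le> \<bar>real_of_int ((\<tau> * y) $$ (i,0))\<bar>" by blast
    moreover have "c' * nm \<tau> \<le> nm (\<tau> * y) / real n" unfolding c'_def using c(2)[OF that] n by (simp add: field_simps)
    ultimately show ?thesis by force
  qed
  then obtain k where k: "\<And>\<tau>. \<tau> \<in> T \<Longrightarrow> k \<tau> < n \<and> c' * nm \<tau> \<le> \<bar>real_of_int ((\<tau> * y) $$ (k \<tau>,0))\<bar>" by metis
  define X Y where "X = (\<lambda>\<tau> i. real_of_int ((\<tau> * x) $$ (i,0)))" and "Y = (\<lambda>\<tau> i. real_of_int ((\<tau> * y) $$ (i,0)))"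
  \<comment> \<open>\<open>t \<tau>\<close> is the zero described above, and \<open>R \<tau> s\<close> is the norm of \<open>\<tau> (x + s y)\<close>\<close>
  define t where "t = (\<lambda>\<tau>. - X \<tau> (k \<tau>) / Y \<tau> (k \<tau>))"
  define R where "R = (\<lambda>\<tau> s. \<Sum>i<n. \<bar>X \<tau> i + s * Y \<tau> i\<bar>)"
  have nmpos: "0 < nm \<tau>" if "\<tau> \<in> T" for \<tau> using TD[OF that] by linarith
  have Yk: "c' * nm \<tau> \<le> \<bar>Y \<tau> (k \<tau>)\<bar>" "0 < \<bar>Y \<tau> (k \<tau>)\<bar>" if "\<tau> \<in> T" for \<tau>
    using k[OF that] mult_pos_pos[OF c' nmpos[OF that]] unfolding Y_def by auto
  have Ra: "c' * nm \<tau> * \<bar>s - t \<tau>\<bar> \<le> R \<tau> s" if "\<tau> \<in> T" for \<tau> s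
  proof -
    have "c' * nm \<tau> * \<bar>s - t \<tau>\<bar> \<le> \<bar>Y \<tau> (k \<tau>)\<bar> * \<bar>s - t \<tau>\<bar>" using Yk(1)[OF that] by (intro mult_right_mono) auto
    also have "\<dots> = \<bar>X \<tau> (k \<tau>) + s * Y \<tau> (k \<tau>)\<bar>"
      unfolding abs_mult[symmetric] t_def using Yk(2)[OF that] by (simp add: algebra_simps)
    also have "\<dots> \<le> R \<tau> s" unfolding R_def using k[OF that]
      by (intro member_le_sum[where f = "\<lambda>i. \<bar>X \<tau> i + s * Y \<tau> i\<bar>"]) auto
    finally show ?thesis .
  qed
  have Rb: "R \<tau> (t \<tau>) \<le> real n * (nm x * nm y * n2 \<tau>) / (c' * nm \<tau>)" if tau: "\<tau> \<in> T" for \<tau>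
  proof -
    have "\<bar>X \<tau> j + t \<tau> * Y \<tau> j\<bar> \<le> nm x * nm y * n2 \<tau> / (c' * nm \<tau>)" if j: "j < n" for j
    proof -
      have "X \<tau> j + t \<tau> * Y \<tau> j = (X \<tau> j * Y \<tau> (k \<tau>) - X \<tau> (k \<tau>) * Y \<tau> j) / Y \<tau> (k \<tau>)"
        unfolding t_def using Yk(2)[OF tau] by (simp add: field_simps)
      hence "\<bar>X \<tau> j + t \<tau> * Y \<tau> j\<bar> = \<bar>X \<tau> j * Y \<tau> (k \<tau>) - X \<tau> (k \<tau>) * Y \<tau> j\<bar> / \<bar>Y \<tau> (k \<tau>)\<bar>" by simp
      also have "\<dots> \<le> nm x * nm y * n2 \<tau> / \<bar>Y \<tau> (k \<tau>)\<bar>"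
      proof (intro divide_right_mono)
        show "\<bar>X \<tau> j * Y \<tau> (k \<tau>) - X \<tau> (k \<tau>) * Y \<tau> j\<bar> \<le> nm x * nm y * n2 \<tau>"
          using minor_le_n2[of \<tau> x y "k \<tau>" j] TD[OF \<open>\<tau> \<in> T\<close>] x y k[OF \<open>\<tau> \<in> T\<close>] j unfolding X_def Y_def by simp
      qed auto
      also have "\<dots> \<le> nm x * nm y * n2 \<tau> / (c' * nm \<tau>)"
        using Yk[OF \<open>\<tau> \<in> T\<close>] c' nmpos[OF \<open>\<tau> \<in> T\<close>] by (intro divide_left_mono) auto
      finally show ?thesis .
    qed
    hence "R \<tau> (t \<tau>) \<le> (\<Sum>j<n. nm x * nm y * n2 \<tau> / (c' * nm \<tau>))" unfolding R_def by (intro sum_mono) auto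
    thus ?thesis by simp
  qed
  have Rc: "R (a * \<sigma>) s \<le> nm a * R \<sigma> s" if s: "\<sigma> \<in> T" and a: "dim_row a = n" "dim_col a = n" for a \<sigma> s
  proof -
    have d: "dim_row \<sigma> = n" "dim_col \<sigma> = n" using TD[OF s] by auto
    have ent: "X (a * \<sigma>) i = (\<Sum>m<n. real_of_int (a $$ (i,m)) * X \<sigma> m)"
              "Y (a * \<sigma>) i = (\<Sum>m<n. real_of_int (a $$ (i,m)) * Y \<sigma> m)" if i: "i < n" for i
    proof -
      have "(a * \<sigma>) * x = a * (\<sigma> * x)" "(a * \<sigma>) * y = a * (\<sigma> * y)" using d a x y by (auto intro!: mat_assoc)
      thus "X (a * \<sigma>) i = (\<Sum>m<n. real_of_int (a $$ (i,m)) * X \<sigma> m)"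
         "Y (a * \<sigma>) i = (\<Sum>m<n. real_of_int (a $$ (i,m)) * Y \<sigma> m)"
        unfolding X_def Y_def using index_mult_sum[of a "\<sigma> * x" i 0] index_mult_sum[of a "\<sigma> * y" i 0] d a x y i
        by (simp_all del: index_mult_mat(1))
    qed
    have "R (a * \<sigma>) s \<le> (\<Sum>i<n. \<Sum>m<n. \<bar>real_of_int (a $$ (i,m))\<bar> * \<bar>X \<sigma> m + s * Y \<sigma> m\<bar>)"
      unfolding R_def
    proof (intro sum_mono)
      fix i assume "i \<in> {..<n}"
      hence i: "i < n" by simp
      have "X (a * \<sigma>) i + s * Y (a * \<sigma>) i = (\<Sum>m<n. real_of_int (a $$ (i,m)) * (X \<sigma> m + s * Y \<sigma> m))"
        unfolding ent[OF i] by (simp add: sum_distrib_left sum.distrib[symmetric] algebra_simps)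
      thus "\<bar>X (a * \<sigma>) i + s * Y (a * \<sigma>) i\<bar> \<le> (\<Sum>m<n. \<bar>real_of_int (a $$ (i,m))\<bar> * \<bar>X \<sigma> m + s * Y \<sigma> m\<bar>)"
        by (simp add: order_trans[OF sum_abs] abs_mult)
    qed
    also have "\<dots> \<le> (\<Sum>i<n. \<Sum>m<n. \<bar>real_of_int (a $$ (i,m))\<bar> * R \<sigma> s)"
      unfolding R_def by (intro sum_mono mult_left_mono member_le_sum[where f = "\<lambda>m. \<bar>X \<sigma> m + s * Y \<sigma> m\<bar>"]) auto
    also have "\<dots> = nm a * R \<sigma> s" unfolding nm_def a by (simp add: sum_distrib_right)
    finally show ?thesis .
  qed
  \<comment> \<open>Evaluating \<open>R \<tau>\<close> for \<open>\<tau> = a * \<sigma>\<close> at \<open>t \<sigma>\<close>: \<open>Rc\<close> and \<open>Rb\<close> make it small, \<open>Ra\<close> turns this into closeness of \<open>t \<sigma>\<close> to \<open>t \<tau>\<close>\<close>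
  define K where "K = C * C * C * real n * nm x * nm y / (c' * c')"
  have step: "\<bar>t \<sigma> - t \<tau>\<bar> \<le> K * wd \<tau>"
    if s: "\<sigma> \<in> T" "\<tau> \<in> T" "\<tau> = a * \<sigma>" "dim_row a = n" "dim_col a = n" "nm a \<le> C" "n2 \<sigma> \<le> C * n2 \<tau>" for \<sigma> \<tau> a
  proof -
    have "nm \<tau> \<le> nm a * nm \<sigma>" unfolding s(3) using nm_mult[of a \<sigma>] s TD[OF s(1)] by simp
    also have "\<dots> \<le> C * nm \<sigma>" using s by (intro mult_right_mono) auto
    finally have ns: "nm \<tau> \<le> C * nm \<sigma>" .
    have C: "0 \<le> C" using order_trans[OF nm_nonneg s(6)] .
    have ps: "0 < nm \<sigma>" "0 < nm \<tau>" using nmpos s by auto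
    have "c' * nm \<tau> * \<bar>t \<sigma> - t \<tau>\<bar> \<le> R \<tau> (t \<sigma>)" using Ra[OF s(2)] by simp
    also have "\<dots> \<le> nm a * R \<sigma> (t \<sigma>)" unfolding s(3) using Rc s by blast
    also have "\<dots> \<le> C * (real n * (nm x * nm y * n2 \<sigma>) / (c' * nm \<sigma>))"
      using s Rb[OF s(1)] C by (intro mult_mono) (auto simp: R_def intro: sum_nonneg)
    also have "\<dots> \<le> C * (real n * (nm x * nm y * (C * n2 \<tau>)) * (C / (c' * nm \<tau>)))"
    proof -
      have "1 / (c' * nm \<sigma>) \<le> C / (c' * nm \<tau>)" using ns ps c' by (simp add: field_simps)
      hence "real n * (nm x * nm y * n2 \<sigma>) * (1 / (c' * nm \<sigma>)) \<le> real n * (nm x * nm y * (C * n2 \<tau>)) * (C / (c' * nm \<tau>))"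
        using s(7) C c' ps by (intro mult_mono mult_left_mono) auto
      thus ?thesis using C by (intro mult_left_mono) auto
    qed
    finally have "c' * nm \<tau> * \<bar>t \<sigma> - t \<tau>\<bar> \<le> C * (real n * (nm x * nm y * (C * n2 \<tau>)) * (C / (c' * nm \<tau>)))" .
    hence "\<bar>t \<sigma> - t \<tau>\<bar> \<le> C * (real n * (nm x * nm y * (C * n2 \<tau>)) * (C / (c' * nm \<tau>))) / (c' * nm \<tau>)"
      using c' ps by (subst pos_le_divide_eq) (auto simp: mult.commute)
    also have "\<dots> = K * wd \<tau>" unfolding K_def wd_def using c' ps by (simp add: field_simps power2_eq_square)
    finally show ?thesis .
  qed
  have K0: "0 \<le> K" unfolding K_def using C0 c' by simp
  have "\<exists>\<sigma>. \<sigma> \<in> T \<and> l \<sigma> < l \<tau> \<and> \<bar>t \<sigma> - t \<tau>\<bar> \<le> K * wd \<tau>" if "\<tau> \<in> T" "0 < l \<tau>" for \<tau>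
    using link[OF that] step that(1) by metis
  then obtain pr where pr: "\<And>\<tau>. \<tau> \<in> T \<Longrightarrow> 0 < l \<tau> \<Longrightarrow> pr \<tau> \<in> T \<and> l (pr \<tau>) < l \<tau> \<and> \<bar>t (pr \<tau>) - t \<tau>\<bar> \<le> K * wd \<tau>"
    by metis
  define \<delta> where "\<delta> = \<epsilon> / (4 * (K + 1))"
  have \<delta>: "\<delta> > 0" unfolding \<delta>_def using e K0 by simp
  obtain F0 where F0: "finite F0" "F0 \<subseteq> T" "infsum wd (T - F0) \<le> \<delta>"
    using summable_tail[OF sm \<delta>] by blast
  obtain N where N: "\<And>\<tau>. \<tau> \<in> F0 \<Longrightarrow> l \<tau> \<le> N"
  proof
    show "l \<tau> \<le> Max (insert 0 (l ` F0))" if "\<tau> \<in> F0" for \<tau> using F0(1) that by (intro Max_ge) auto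
  qed
  \<comment> \<open>\<open>root \<tau>\<close> is the first element of length at most \<open>N\<close> met when descending from \<open>\<tau>\<close>. The fibres \<open>D f\<close> of \<open>root\<close>
     are disjoint and avoid \<open>F0\<close>, so the radii \<open>r f\<close> of the intervals around the \<open>t f\<close> have a small sum.\<close>
  define root where "root = (\<lambda>\<tau>. (pr ^^ (LEAST m. l ((pr ^^ m) \<tau>) \<le> N)) \<tau>)"
  have rootT: "l \<tau> \<le> N \<Longrightarrow> root \<tau> = \<tau>" for \<tau>
  proof -
    assume "l \<tau> \<le> N"
    hence "(LEAST m. l ((pr ^^ m) \<tau>) \<le> N) = 0" by (intro Least_eq_0) simp
    thus "root \<tau> = \<tau>" unfolding root_def by simp
  qed
  have ex: "\<tau> \<in> T \<Longrightarrow> \<exists>m. l ((pr ^^ m) \<tau>) \<le> N" for \<tau>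
  proof (induction "l \<tau>" arbitrary: \<tau> rule: less_induct)
    case less
    show ?case
    proof (cases "l \<tau> \<le> N")
      case True thus ?thesis by (intro exI[of _ 0]) simp
    next
      case False
      hence "0 < l \<tau>" by simp
      from pr[OF less.prems this] less.hyps obtain m where "l ((pr ^^ m) (pr \<tau>)) \<le> N" by blast
      thus ?thesis by (intro exI[of _ "Suc m"]) (simp add: funpow_swap1)
    qed
  qed
  have rootS: "root \<tau> = root (pr \<tau>)" if T: "\<tau> \<in> T" and g: "N < l \<tau>" for \<tau>
  proof -
    obtain m where m: "l ((pr ^^ m) \<tau>) \<le> N" using ex[OF T] by blast
    have "(LEAST m. l ((pr ^^ m) \<tau>) \<le> N) = Suc (LEAST m. l ((pr ^^ Suc m) \<tau>) \<le> N)"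
      using g by (intro Least_Suc[where P = "\<lambda>m. l ((pr ^^ m) \<tau>) \<le> N", OF m]) simp
    thus ?thesis unfolding root_def by (simp add: funpow_swap1)
  qed
  define D where "D = (\<lambda>f. {\<sigma>\<in>T. N < l \<sigma> \<and> root \<sigma> = f})"
  have chain: "\<tau> \<in> T \<Longrightarrow> root \<tau> \<in> T \<and> l (root \<tau>) \<le> N \<and>
     (\<exists>F. finite F \<and> F \<subseteq> D (root \<tau>) \<and> (\<forall>\<sigma>\<in>F. l \<sigma> \<le> l \<tau>) \<and> \<bar>t \<tau> - t (root \<tau>)\<bar> \<le> K * sum wd F)" for \<tau>
  proof (induction "l \<tau>" arbitrary: \<tau> rule: less_induct)
    case less
    show ?case
    proof (cases "l \<tau> \<le> N")
      case True
      thus ?thesis using less.prems rootT[OF True] by (auto intro!: exI[of _ "{}"])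
    next
      case False
      hence g: "N < l \<tau>" "0 < l \<tau>" by auto
      note p = pr[OF less.prems g(2)]
      note r = rootS[OF less.prems g(1)]
      from less.hyps[of "pr \<tau>"] p obtain F where F: "root (pr \<tau>) \<in> T" "l (root (pr \<tau>)) \<le> N"
        "finite F" "F \<subseteq> D (root (pr \<tau>))" "\<forall>\<sigma>\<in>F. l \<sigma> \<le> l (pr \<tau>)" "\<bar>t (pr \<tau>) - t (root (pr \<tau>))\<bar> \<le> K * sum wd F"
        by blast
      have ni: "\<tau> \<notin> F" using F(5) p by force
      have "\<bar>t \<tau> - t (root \<tau>)\<bar> \<le> K * wd \<tau> + K * sum wd F" using F(6) p unfolding r by linarith
      also have "\<dots> = K * sum wd (insert \<tau> F)" using ni F(3) by (simp add: algebra_simps)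
      finally show ?thesis using F p r less.prems g
        by (intro conjI exI[of _ "insert \<tau> F"]) (auto simp: D_def)
    qed
  qed
  define FR where "FR = {\<tau>\<in>T. l \<tau> \<le> N}"
  have finFR: "finite FR" unfolding FR_def by (rule fin)
  have DT: "D f \<subseteq> T - F0" for f using N unfolding D_def by force
  have smT: "wd summable_on A" if "A \<subseteq> T" for A using summable_on_subset_banach[OF sm that] .
  define r where "r = (\<lambda>f. K * infsum wd (D f))"
  have r0: "0 \<le> r f" for f unfolding r_def using K0 by (simp add: infsum_nonneg)
  have "(\<Sum>f\<in>FR. infsum wd (D f)) = infsum wd (\<Union>f\<in>FR. D f)"
    using DT by (intro sum_infsum finFR smT) (auto simp: D_def)
  also have "\<dots> \<le> infsum wd (T - F0)"
    using DT by (intro infsum_mono_neutral smT) auto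
  also have "\<dots> \<le> \<delta>" by (rule F0(3))
  finally have "sum r FR \<le> K * \<delta>" unfolding r_def sum_distrib_left[symmetric] using K0 by (intro mult_left_mono) auto
  also have "K * \<delta> < \<epsilon> / 2" unfolding \<delta>_def using K0 e by (simp add: field_simps add_pos_nonneg)
  finally have s2: "2 * sum r FR < \<epsilon>" by simp
  obtain a b d where ab: "b > (0::int)" "\<bar>real_of_int a\<bar> \<le> \<epsilon> * real_of_int b" "d > (0::real)"
     "\<And>f. f \<in> FR \<Longrightarrow> r f + d \<le> \<bar>real_of_int a / real_of_int b - t f\<bar>"
    using real_gap[OF finFR r0 s2, of t] by blast
  let ?q = "real_of_int a / real_of_int b"
  have gap: "d \<le> \<bar>?q - t \<tau>\<bar>" if T: "\<tau> \<in> T" for \<tau>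
  proof -
    from chain[OF T] obtain F where F: "root \<tau> \<in> FR" "finite F" "F \<subseteq> D (root \<tau>)" "\<bar>t \<tau> - t (root \<tau>)\<bar> \<le> K * sum wd F"
      unfolding FR_def by blast
    have "sum wd F \<le> infsum wd (D (root \<tau>))"
      using F DT by (intro finite_sum_le_infsum smT) auto
    hence "K * sum wd F \<le> r (root \<tau>)" unfolding r_def using K0 by (rule mult_left_mono)
    thus ?thesis using ab(4)[OF F(1)] F(4) by linarith
  qed
  have "good T (b \<cdot>\<^sub>m x + a \<cdot>\<^sub>m y)" unfolding good_def
  proof (intro exI[of _ "real_of_int b * (c' * d)"] conjI ballI)
    show "real_of_int b * (c' * d) > 0" using ab c' by simp
  next
    fix \<tau> assume T: "\<tau> \<in> T"
    have dm: "dim_row \<tau> = n" "dim_col \<tau> = n" using TD[OF T] by auto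
    have ent: "real_of_int ((\<tau> * (b \<cdot>\<^sub>m x + a \<cdot>\<^sub>m y)) $$ (i,0)) = real_of_int b * (X \<tau> i + ?q * Y \<tau> i)" if "i < n" for i
    proof -
      have "(\<tau> * (b \<cdot>\<^sub>m x + a \<cdot>\<^sub>m y)) $$ (i,0) = b * (\<tau> * x) $$ (i,0) + a * (\<tau> * y) $$ (i,0)"
        using that dm x y by (simp add: index_mult_sum sum_distrib_left sum.distrib[symmetric] algebra_simps del: index_mult_mat(1))
      thus ?thesis unfolding X_def Y_def using ab(1) by (simp add: field_simps)
    qed
    have "real_of_int b * (c' * d) * nm \<tau> = real_of_int b * (c' * nm \<tau> * d)" by simp
    also have "\<dots> \<le> real_of_int b * (c' * nm \<tau> * \<bar>?q - t \<tau>\<bar>)"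
      using ab(1) c' gap[OF T] nmpos[OF T] by (intro mult_left_mono) auto
    also have "\<dots> \<le> real_of_int b * R \<tau> ?q"
      using ab(1) Ra[OF T] by (intro mult_left_mono) auto
    also have "\<dots> = nm (\<tau> * (b \<cdot>\<^sub>m x + a \<cdot>\<^sub>m y))"
    proof -
      have "nm (\<tau> * (b \<cdot>\<^sub>m x + a \<cdot>\<^sub>m y)) = (\<Sum>i<n. \<bar>real_of_int ((\<tau> * (b \<cdot>\<^sub>m x + a \<cdot>\<^sub>m y)) $$ (i,0))\<bar>)"
        unfolding nm_def using dm x y by simp
      also have "\<dots> = (\<Sum>i<n. real_of_int b * \<bar>X \<tau> i + ?q * Y \<tau> i\<bar>)"
      proof (intro sum.cong refl)
        fix i assume "i \<in> {..<n}"
        hence i: "i < n" by simp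
        show "\<bar>real_of_int ((\<tau> * (b \<cdot>\<^sub>m x + a \<cdot>\<^sub>m y)) $$ (i,0))\<bar> = real_of_int b * \<bar>X \<tau> i + ?q * Y \<tau> i\<bar>"
          unfolding ent[OF i] abs_mult using ab(1) by simp
      qed
      finally show ?thesis unfolding R_def by (simp add: sum_distrib_left)
    qed
    finally show "real_of_int b * (c' * d) * nm \<tau> \<le> nm (\<tau> * (b \<cdot>\<^sub>m x + a \<cdot>\<^sub>m y))" .
  qed
  thus ?thesis using ab by blast
qed

section \<open>Incident pairs in general position\<close>

definition cogood :: "int mat set \<Rightarrow> int mat \<Rightarrow> bool" where
  "cogood T f \<longleftrightarrow> (\<exists>c>0. \<forall>\<tau>\<in>T. c * nm \<tau> \<le> nm (f * \<tau>))"

definition bil :: "nat \<Rightarrow> int mat \<Rightarrow> int mat \<Rightarrow> int mat \<Rightarrow> int" where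
  "bil n f A v = (\<Sum>i<n. \<Sum>j<n. f $$ (0,i) * A $$ (i,j) * v $$ (j,0))"

definition dotm :: "nat \<Rightarrow> int mat \<Rightarrow> int mat \<Rightarrow> int" where
  "dotm n f v = (\<Sum>i<n. f $$ (0,i) * v $$ (i,0))"

abbreviation is_col :: "nat \<Rightarrow> int mat \<Rightarrow> bool" where "is_col n v \<equiv> dim_row v = n \<and> dim_col v = 1"
abbreviation is_row :: "nat \<Rightarrow> int mat \<Rightarrow> bool" where "is_row n f \<equiv> dim_row f = 1 \<and> dim_col f = n"
abbreviation is_sq :: "nat \<Rightarrow> int mat \<Rightarrow> bool" where "is_sq n A \<equiv> dim_row A = n \<and> dim_col A = n"

lemma bil_entry:
  assumes "is_row n f" "is_sq n A" "is_col n v"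
  shows "(f * A * v) $$ (0,0) = bil n f A v"
proof -
  have "(f * A * v) $$ (0,0) = (\<Sum>j<n. (\<Sum>i<n. f $$ (0,i) * A $$ (i,j)) * v $$ (j,0))"
    using assms by (simp add: index_mult_sum del: index_mult_mat(1))
  also have "\<dots> = (\<Sum>j<n. \<Sum>i<n. f $$ (0,i) * A $$ (i,j) * v $$ (j,0))"
    by (simp add: sum_distrib_right)
  also have "\<dots> = bil n f A v" unfolding bil_def by (rule sum.swap)
  finally show ?thesis .
qed

lemma nm_bil:
  assumes "is_row n f" "is_sq n A" "is_col n v"
  shows "nm (f * A * v) = \<bar>real_of_int (bil n f A v)\<bar>"
  unfolding bil_entry[OF assms, symmetric] nm_def using assms by simp

lemma dotm_entry:
  assumes "is_row n f" "is_col n v"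
  shows "(f * v) $$ (0,0) = dotm n f v"
  unfolding dotm_def using assms by (simp add: index_mult_sum del: index_mult_mat(1))

lemma nm_dotm:
  assumes "is_row n f" "is_col n v"
  shows "nm (f * v) = \<bar>real_of_int (dotm n f v)\<bar>"
  unfolding dotm_entry[OF assms, symmetric] nm_def using assms by simp

lemma bil_le:
  assumes "is_row n f" "is_sq n A" "is_col n v"
  shows "\<bar>real_of_int (bil n f A v)\<bar> \<le> nm f * nm v * nm A"
proof -
  have "nm (f * A * v) \<le> nm (f * A) * nm v" using assms by (intro nm_mult) auto
  also have "\<dots> \<le> nm f * nm A * nm v" using assms by (intro mult_right_mono nm_mult) auto
  finally show ?thesis unfolding nm_bil[OF assms] by (simp add: mult_ac)
qed

lemma dotm_le:
  assumes "is_row n f" "is_col n v"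
  shows "\<bar>real_of_int (dotm n f v)\<bar> \<le> nm f * nm v"
  using nm_mult[of f v] assms unfolding nm_dotm[OF assms, symmetric] by simp

lemma dotm_self_ge:
  assumes "is_col n v" "n > 0"
  shows "(nm v)\<^sup>2 \<le> (real n)\<^sup>2 * real_of_int (dotm n (transpose_mat v) v)"
proof -
  obtain i where i: "i < n" "nm v / real n \<le> \<bar>real_of_int (v $$ (i,0))\<bar>"
    using large_entry[of v n] assms by blast
  have "(nm v / real n)\<^sup>2 \<le> (\<bar>real_of_int (v $$ (i,0))\<bar>)\<^sup>2"
    using i by (intro power_mono) auto
  also have "\<dots> = real_of_int (v $$ (i,0) * v $$ (i,0))" by (simp add: power2_eq_square)
  also have "\<dots> \<le> real_of_int (dotm n (transpose_mat v) v)"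
  proof -
    have "v $$ (i,0) * v $$ (i,0) \<le> (\<Sum>i<n. v $$ (i,0) * v $$ (i,0))"
      using i by (intro member_le_sum[where f = "\<lambda>i. v $$ (i,0) * v $$ (i,0)"]) auto
    also have "\<dots> = dotm n (transpose_mat v) v" unfolding dotm_def using assms by simp
    finally show ?thesis by (simp only: of_int_le_iff)
  qed
  finally show ?thesis using assms by (simp add: field_simps)
qed

lemma lincomb_mult:
  assumes "dim_row A = dim_row B" "dim_col A = dim_row M" "dim_col B = dim_row M"
  shows "(k \<cdot>\<^sub>m A + l \<cdot>\<^sub>m B) * M = k \<cdot>\<^sub>m (A * M) + l \<cdot>\<^sub>m (B * M :: int mat)"
  using assms
  by (intro eq_matI) (auto simp: index_mult_sum sum_distrib_left sum.distrib[symmetric] algebra_simps simp del: index_mult_mat(1))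

text \<open>Up to the factor \<open>\<parallel>v\<parallel>\<^sup>2\<close>, which keeps it integral, the orthogonal projection of \<open>f\<close> to the covectors that vanish on \<open>v\<close>.\<close>

definition annih :: "nat \<Rightarrow> int mat \<Rightarrow> int mat \<Rightarrow> int mat" where
  "annih n f v = dotm n (transpose_mat v) v \<cdot>\<^sub>m f + (- dotm n f v) \<cdot>\<^sub>m transpose_mat v"

lemma annih_dim [simp]: "dim_row (annih n f v) = dim_col v" "dim_col (annih n f v) = dim_row v"
  unfolding annih_def by auto

lemma dotm_annih:
  assumes "is_row n f" "is_col n v"
  shows "dotm n (annih n f v) v = 0"
proof -
  have "dotm n (annih n f v) v = (\<Sum>i<n. dotm n (transpose_mat v) v * (f $$ (0,i) * v $$ (i,0)) - dotm n f v * (transpose_mat v $$ (0,i) * v $$ (i,0)))"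
    unfolding dotm_def[of n "annih n f v"] unfolding annih_def using assms by (intro sum.cong) (auto simp: algebra_simps)
  also have "\<dots> = dotm n (transpose_mat v) v * dotm n f v - dotm n f v * dotm n (transpose_mat v) v"
    unfolding sum_subtractf sum_distrib_left[symmetric] dotm_def ..
  finally show ?thesis by simp
qed

lemma bil_annih:
  assumes "is_row n f" "is_col n v"
  shows "bil n (annih n f v) A w = dotm n (transpose_mat v) v * bil n f A w - dotm n f v * bil n (transpose_mat v) A w"
proof -
  have "bil n (annih n f v) A w = (\<Sum>i<n. \<Sum>j<n. dotm n (transpose_mat v) v * (f $$ (0,i) * A $$ (i,j) * w $$ (j,0)) - dotm n f v * (transpose_mat v $$ (0,i) * A $$ (i,j) * w $$ (j,0)))"
    unfolding bil_def annih_def using assms by (intro sum.cong refl) (auto simp: algebra_simps)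
  also have "\<dots> = dotm n (transpose_mat v) v * bil n f A w - dotm n f v * bil n (transpose_mat v) A w"
    unfolding sum_subtractf sum_distrib_left[symmetric] bil_def ..
  finally show ?thesis .
qed

definition lin :: "nat \<Rightarrow> int mat \<Rightarrow> int mat \<Rightarrow> int mat" where
  "lin m v w = int m \<cdot>\<^sub>m v + w"

lemma lin_dim [simp]: "dim_row (lin m v w) = dim_row w" "dim_col (lin m v w) = dim_col w"
  unfolding lin_def by auto

lemma bil_lin:
  assumes "is_row n f" "is_row n f'" "is_col n v" "is_col n v'"
  shows "bil n (lin m f f') A (lin m v v') = (int m)^2 * bil n f A v + int m * (bil n f A v' + bil n f' A v) + bil n f' A v'"
proof -
  have "bil n (lin m f f') A (lin m v v') = (\<Sum>i<n. \<Sum>j<n. (int m)^2 * (f $$ (0,i) * A $$ (i,j) * v $$ (j,0))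
      + int m * (f $$ (0,i) * A $$ (i,j) * v' $$ (j,0) + f' $$ (0,i) * A $$ (i,j) * v $$ (j,0)) + f' $$ (0,i) * A $$ (i,j) * v' $$ (j,0))"
    unfolding bil_def lin_def using assms by (intro sum.cong refl) (auto simp: algebra_simps power2_eq_square)
  thus ?thesis unfolding sum.distrib sum_distrib_left[symmetric] bil_def .
qed

lemma dotm_lin:
  assumes "is_row n f" "is_row n f'" "is_col n v" "is_col n v'"
  shows "dotm n (lin m f f') (lin m v v') = (int m)^2 * dotm n f v + int m * (dotm n f v' + dotm n f' v) + dotm n f' v'"
proof -
  have "dotm n (lin m f f') (lin m v v') = (\<Sum>i<n. (int m)^2 * (f $$ (0,i) * v $$ (i,0))
      + int m * (f $$ (0,i) * v' $$ (i,0) + f' $$ (0,i) * v $$ (i,0)) + f' $$ (0,i) * v' $$ (i,0))"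
    unfolding dotm_def lin_def using assms by (intro sum.cong refl) (auto simp: algebra_simps power2_eq_square)
  thus ?thesis unfolding sum.distrib sum_distrib_left[symmetric] dotm_def .
qed

lemma transpose_lin: "is_col n v \<Longrightarrow> is_col n v' \<Longrightarrow> transpose_mat (lin m v v') = lin m (transpose_mat v) (transpose_mat v')"
  unfolding lin_def by (intro eq_matI) auto

text \<open>For incident pairs \<open>(v,f)\<close> and \<open>(v',f')\<close> the pairs \<open>(m v + v', f\<^sub>m)\<close>, with \<open>f\<^sub>m\<close> the projection of
\<open>m f + f'\<close> to the annihilator of \<open>m v + v'\<close>, form a curve of incident pairs from a multiple of \<open>(v',f')\<close> at \<open>m = 0\<close> to
\<open>(v,f)\<close> at infinity. The list consists of the coefficients, from the lowest degree on, of the quartic polynomial to which \<open>A\<close>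
restricts. The absolute term depends on \<open>(v',f')\<close> only and the leading one on \<open>(v,f)\<close> only.\<close>

definition curve_poly :: "nat \<Rightarrow> int mat \<Rightarrow> int mat \<Rightarrow> int mat \<Rightarrow> int mat \<Rightarrow> int mat \<Rightarrow> int list" where
  "curve_poly n v f v' f' A =
    (let a0 = dotm n (transpose_mat v') v'; a1 = dotm n (transpose_mat v) v' + dotm n (transpose_mat v') v;
         a2 = dotm n (transpose_mat v) v;
         b0 = bil n f' A v'; b1 = bil n f A v' + bil n f' A v; b2 = bil n f A v;
         e0 = dotm n f' v'; e1 = dotm n f v' + dotm n f' v;
         d0 = bil n (transpose_mat v') A v'; d1 = bil n (transpose_mat v) A v' + bil n (transpose_mat v') A v;
         d2 = bil n (transpose_mat v) A v
     in [a0*b0 - e0*d0, a0*b1 + a1*b0 - e0*d1 - e1*d0, a0*b2 + a1*b1 + a2*b0 - e0*d2 - e1*d1,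
         a1*b2 + a2*b1 - e1*d2, a2*b2])"

lemma bil_curve:
  assumes "is_row n f" "is_row n f'" "is_col n v" "is_col n v'" "dotm n f v = 0"
  shows "bil n (annih n (lin m f f') (lin m v v')) A (lin m v v') = poly (Poly (curve_poly n v f v' f' A)) (int m)"
proof -
  have "bil n (annih n (lin m f f') (lin m v v')) A (lin m v v') =
     dotm n (transpose_mat (lin m v v')) (lin m v v') * bil n (lin m f f') A (lin m v v')
     - dotm n (lin m f f') (lin m v v') * bil n (transpose_mat (lin m v v')) A (lin m v v')"
    using assms by (intro bil_annih) auto
  also have "\<dots> = poly (Poly (curve_poly n v f v' f' A)) (int m)"
    using assms unfolding transpose_lin[OF assms(3,4)]
    by (simp add: bil_lin dotm_lin curve_poly_def Let_def) (simp add: algebra_simps power2_eq_square)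
  finally show ?thesis .
qed

lemma dotm_self_pos:
  assumes "is_col n v" "bil n f A v \<noteq> 0"
  shows "dotm n (transpose_mat v) v > 0"
proof -
  have "\<exists>j<n. v $$ (j,0) \<noteq> 0" using assms(2) unfolding bil_def by (auto intro: ccontr)
  then obtain j where j: "j < n" "v $$ (j,0) \<noteq> 0" by blast
  have "dotm n (transpose_mat v) v = (\<Sum>i<n. (v $$ (i,0))\<^sup>2)" unfolding dotm_def using assms by (simp add: power2_eq_square)
  also have "\<dots> > 0" using j by (intro sum_pos2[of _ j]) auto
  finally show ?thesis .
qed

lemma finite_curve_zeros:
  assumes "is_row n f" "is_row n f'" "is_col n v" "is_col n v'" "dotm n f v = 0" "dotm n f' v' = 0"
    and "bil n f A v \<noteq> 0 \<or> bil n f' A v' \<noteq> 0"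
  shows "finite {m. bil n (annih n (lin m f f') (lin m v v')) A (lin m v v') = 0}"
proof -
  let ?p = "Poly (curve_poly n v f v' f' A)"
  have "?p \<noteq> 0"
  proof
    assume p: "?p = 0"
    have "coeff ?p 0 = dotm n (transpose_mat v') v' * bil n f' A v'" "coeff ?p 4 = dotm n (transpose_mat v) v * bil n f A v"
      unfolding curve_poly_def Let_def coeff_Poly_eq using assms by (simp_all add: nth_default_def)
    thus False using p assms(7) dotm_self_pos[OF assms(3)] dotm_self_pos[OF assms(4)] by (metis coeff_0 less_irrefl mult_eq_0_iff)
  qed
  hence "finite (int -` {x. poly ?p x = 0})" by (intro finite_vimageI poly_roots_finite) auto
  thus ?thesis unfolding bil_curve[OF assms(1-5)] by (simp add: vimage_def)
qed

text \<open>If one incident pair does not annihilate any matrix of \<open>F\<close>, and another one does not annihilate \<open>A\<close>, then the curve joining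
them meets the zeros of each matrix in \<open>insert A F\<close> in finitely many points.\<close>

lemma incident_avoid_finite:
  assumes "finite F" and "n > 0"
    and "\<And>A. A \<in> F \<Longrightarrow> \<exists>v f. is_col n v \<and> is_row n f \<and> dotm n f v = 0 \<and> bil n f A v \<noteq> 0"
  shows "\<exists>v f. is_col n v \<and> is_row n f \<and> dotm n f v = 0 \<and> (\<forall>A\<in>F. bil n f A v \<noteq> 0)"
  using assms
proof (induction F rule: finite_induct)
  case empty
  show ?case by (rule exI[of _ "0\<^sub>m n 1"], rule exI[of _ "0\<^sub>m 1 n"]) (auto simp: dotm_def)
next
  case (insert A F)
  from insert obtain v f where vf: "is_col n v" "is_row n f" "dotm n f v = 0" "\<forall>A\<in>F. bil n f A v \<noteq> 0" by blast
  from insert.prems obtain v' f' where vf': "is_col n v'" "is_row n f'" "dotm n f' v' = 0" "bil n f' A v' \<noteq> 0" by blast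
  let ?v = "\<lambda>m. lin m v v'" and ?f = "\<lambda>m. annih n (lin m f f') (lin m v v')"
  have "finite (\<Union>B\<in>insert A F. {m. bil n (?f m) B (?v m) = 0})"
    using insert.hyps vf vf' by (intro finite_UN_I finite_curve_zeros) auto
  then obtain m where m: "m \<notin> (\<Union>B\<in>insert A F. {m. bil n (?f m) B (?v m) = 0})"
    using ex_new_if_finite[OF infinite_UNIV_nat] by blast
  show ?case
  proof (rule exI[of _ "?v m"], rule exI[of _ "?f m"], intro conjI)
    show "dotm n (?f m) (?v m) = 0" using vf vf' by (intro dotm_annih) auto
  qed (use m vf vf' in auto)
qed

text \<open>Start from a non-zero \<open>v0\<close> annihilated by the given covector \<open>f1\<close> and move it slightly to a good vector \<open>v\<close>. Then \<open>f1 v\<close> is small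
compared with \<open>nm v\<close>, so projecting \<open>f1\<close> to the annihilator of \<open>v\<close> changes it little, and the property of being good
survives.\<close>

lemma incident_good:
  assumes n: "n \<ge> 2"
    and S: "\<And>\<sigma>. \<sigma> \<in> S \<Longrightarrow> is_sq n \<sigma>"
    and dense: "\<And>x \<epsilon>. is_col n x \<Longrightarrow> \<epsilon> > 0 \<Longrightarrow>
       \<exists>b u. b > 0 \<and> is_col n u \<and> nm u \<le> \<epsilon> * real_of_int b \<and> good S (b \<cdot>\<^sub>m x + u)"
    and f1: "is_row n f1" "cogood S f1"
  shows "\<exists>v f. is_col n v \<and> is_row n f \<and> dotm n f v = 0 \<and> good S v \<and> cogood S f \<and> v \<noteq> 0\<^sub>m n 1"
proof -
  obtain c where c: "c > 0" "\<And>\<sigma>. \<sigma> \<in> S \<Longrightarrow> c * nm \<sigma> \<le> nm (f1 * \<sigma>)" using f1 unfolding cogood_def by blast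
  define v0 :: "int mat" where "v0 = Matrix.mat n 1 (\<lambda>(i,j). if f1 $$ (0,0) = 0 \<and> f1 $$ (0,1) = 0 then (if i = 0 then 1 else 0)
     else if i = 0 then f1 $$ (0,1) else if i = 1 then - f1 $$ (0,0) else 0)"
  have v0: "is_col n v0" unfolding v0_def by simp
  have v0nz: "1 \<le> nm v0"
  proof (cases "f1 $$ (0,0) = 0 \<and> f1 $$ (0,1) = 0")
    case True thus ?thesis using n by (intro nm_ge_1[of 0 v0 0]) (auto simp: v0_def)
  next
    case False
    have e: "v0 $$ (0,0) = f1 $$ (0,1)" "v0 $$ (1,0) = - f1 $$ (0,0)" unfolding v0_def using n False by auto
    show ?thesis
    proof (cases "f1 $$ (0,1) = 0")
      case True thus ?thesis using n False e v0 by (intro nm_ge_1[of 1 v0 0]) auto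
    next
      case f: False thus ?thesis using n e v0 by (intro nm_ge_1[of 0 v0 0]) auto
    qed
  qed
  have dv0: "dotm n f1 v0 = 0"
  proof -
    have "dotm n f1 v0 = (\<Sum>i\<in>{0,1}. f1 $$ (0,i) * v0 $$ (i,0))"
      unfolding dotm_def using n by (intro sum.mono_neutral_right) (auto simp: v0_def)
    thus ?thesis using n by (auto simp: v0_def)
  qed
  \<comment> \<open>the bound \<open>1/2\<close> keeps \<open>v\<close> away from zero, the other one makes the change of \<open>f1\<close> at most half of what \<open>c\<close> allows\<close>
  define \<epsilon> where "\<epsilon> = min (1/2) (c / (4 * (real n)\<^sup>2 * (nm f1 + 1)))"
  have e: "\<epsilon> > 0" "\<epsilon> \<le> 1/2" unfolding \<epsilon>_def using c n by (auto intro!: divide_pos_pos mult_pos_pos add_nonneg_pos)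
  have e2: "2 * \<epsilon> * nm f1 * (real n)\<^sup>2 \<le> c / 2"
  proof -
    have "\<epsilon> * (4 * (real n)\<^sup>2 * (nm f1 + 1)) \<le> c / (4 * (real n)\<^sup>2 * (nm f1 + 1)) * (4 * (real n)\<^sup>2 * (nm f1 + 1))"
      unfolding \<epsilon>_def by (intro mult_right_mono) auto
    also have "\<dots> = c"
    proof -
      have "0 < 4 * (real n)\<^sup>2 * (nm f1 + 1)" using n by (intro mult_pos_pos add_nonneg_pos) auto
      moreover have "x / D * D = x" if "0 < D" for x D :: real using that by simp
      ultimately show ?thesis by blast
    qed
    finally have "4 * \<epsilon> * (real n)\<^sup>2 * (nm f1 + 1) \<le> c" by (simp add: mult_ac)
    moreover have "4 * \<epsilon> * (real n)\<^sup>2 * nm f1 \<le> 4 * \<epsilon> * (real n)\<^sup>2 * (nm f1 + 1)" using e by (intro mult_left_mono) auto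
    ultimately show ?thesis by (simp add: mult_ac)
  qed
  obtain b u where bu: "b > 0" "is_col n u" "nm u \<le> \<epsilon> * real_of_int b" "good S (b \<cdot>\<^sub>m v0 + u)"
    using dense[OF v0 e(1)] by blast
  define v where "v = b \<cdot>\<^sub>m v0 + u"
  have v: "is_col n v" unfolding v_def using v0 bu by simp
  have nv: "real_of_int b / 2 \<le> nm v"
  proof -
    have "nm (b \<cdot>\<^sub>m v0) - nm u \<le> nm v" unfolding v_def using v0 bu by (intro nm_add_ge) auto
    moreover have "real_of_int b \<le> nm (b \<cdot>\<^sub>m v0)" using v0nz bu by (simp add: nm_smult mult_le_cancel_left1)
    moreover have "\<epsilon> * real_of_int b \<le> 1/2 * real_of_int b" using e bu by (intro mult_right_mono) auto
    ultimately show ?thesis using bu(3) by linarith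
  qed
  have nv0: "nm v > 0" using nv bu by (smt (verit) divide_pos_pos of_int_0_less_iff)
  have dv: "dotm n f1 v = dotm n f1 u"
  proof -
    have "dotm n f1 v = (\<Sum>i<n. b * (f1 $$ (0,i) * v0 $$ (i,0)) + f1 $$ (0,i) * u $$ (i,0))"
      unfolding dotm_def v_def using v0 bu by (intro sum.cong refl) (auto simp: algebra_simps)
    also have "\<dots> = b * dotm n f1 v0 + dotm n f1 u" unfolding sum.distrib sum_distrib_left[symmetric] dotm_def ..
    finally show ?thesis using dv0 by simp
  qed
  let ?q = "real_of_int (dotm n (transpose_mat v) v)"
  have q: "(nm v)\<^sup>2 \<le> (real n)\<^sup>2 * ?q" using v n by (intro dotm_self_ge) auto
  have q0: "?q > 0"
  proof -
    have "0 < (nm v)\<^sup>2" using nv0 by simp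
    hence "0 < (real n)\<^sup>2 * ?q" using q by linarith
    thus ?thesis by (simp add: zero_less_mult_iff)
  qed
  have small: "\<bar>real_of_int (dotm n f1 v)\<bar> * nm v \<le> ?q * c / 2"
  proof -
    have "\<bar>real_of_int (dotm n f1 v)\<bar> \<le> nm f1 * nm u" unfolding dv using f1 bu by (intro dotm_le) auto
    also have "\<dots> \<le> nm f1 * (\<epsilon> * (2 * nm v))"
      using bu(3) nv e by (intro mult_left_mono order_trans[OF bu(3)]) auto
    finally have "\<bar>real_of_int (dotm n f1 v)\<bar> * nm v \<le> nm f1 * (\<epsilon> * (2 * nm v)) * nm v" using nv0 by (intro mult_right_mono) auto
    also have "\<dots> = 2 * \<epsilon> * nm f1 * (nm v)\<^sup>2" by (simp add: power2_eq_square)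
    also have "\<dots> \<le> 2 * \<epsilon> * nm f1 * ((real n)\<^sup>2 * ?q)" using q e by (intro mult_left_mono) auto
    also have "\<dots> = (2 * \<epsilon> * nm f1 * (real n)\<^sup>2) * ?q" by simp
    also have "\<dots> \<le> c / 2 * ?q" using e2 q0 by (intro mult_right_mono) auto
    finally show ?thesis by (simp add: mult_ac)
  qed
  define f where "f = annih n f1 v"
  have f: "is_row n f" unfolding f_def using v by simp
  have "cogood S f" unfolding cogood_def
  proof (intro exI[of _ "?q * c / 2"] conjI ballI)
    show "?q * c / 2 > 0" using q0 c by simp
  next
    fix \<sigma> assume s: "\<sigma> \<in> S"
    note d = S[OF s]
    have eq: "f * \<sigma> = dotm n (transpose_mat v) v \<cdot>\<^sub>m (f1 * \<sigma>) + (- dotm n f1 v) \<cdot>\<^sub>m (transpose_mat v * \<sigma>)"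
      unfolding f_def annih_def using d f1 v
      by (intro lincomb_mult) auto
    have "nm (dotm n (transpose_mat v) v \<cdot>\<^sub>m (f1 * \<sigma>)) - nm ((- dotm n f1 v) \<cdot>\<^sub>m (transpose_mat v * \<sigma>)) \<le> nm (f * \<sigma>)"
      unfolding eq using d f1 v by (intro nm_add_ge) auto
    moreover have "?q * (c * nm \<sigma>) \<le> nm (dotm n (transpose_mat v) v \<cdot>\<^sub>m (f1 * \<sigma>))"
      unfolding nm_smult using q0 c(1) c(2)[OF s] by (intro mult_mono mult_nonneg_nonneg) auto
    moreover have "nm ((- dotm n f1 v) \<cdot>\<^sub>m (transpose_mat v * \<sigma>)) \<le> ?q * c / 2 * nm \<sigma>"
    proof -
      have "nm (transpose_mat v * \<sigma>) \<le> nm v * nm \<sigma>" using nm_mult[of "transpose_mat v" \<sigma>] d v by simp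
      hence "nm ((- dotm n f1 v) \<cdot>\<^sub>m (transpose_mat v * \<sigma>)) \<le> \<bar>real_of_int (dotm n f1 v)\<bar> * (nm v * nm \<sigma>)"
        unfolding nm_smult by (simp add: mult_left_mono)
      also have "\<dots> = (\<bar>real_of_int (dotm n f1 v)\<bar> * nm v) * nm \<sigma>" by simp
      also have "\<dots> \<le> ?q * c / 2 * nm \<sigma>" using small by (intro mult_right_mono) auto
      finally show ?thesis .
    qed
    ultimately show "?q * c / 2 * nm \<sigma> \<le> nm (f * \<sigma>)" by simp
  qed
  moreover have "v \<noteq> 0\<^sub>m n 1" using nv0 by (auto simp: nm_def)
  moreover have "dotm n f v = 0" unfolding f_def using f1 v by (intro dotm_annih) auto
  ultimately show ?thesis using v f bu(4) unfolding v_def[symmetric] by blast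
qed

lemma rank_one_lower:
  assumes d: "is_row n f" "is_sq n \<sigma>" "is_col n v" and pos: "0 < nm \<sigma>" and c: "0 < c"
    and g: "c * nm \<sigma> \<le> nm (\<sigma> * v)" "c * nm \<sigma> \<le> nm (f * \<sigma>)"
    and w: "nm f * nm v * wd \<sigma> \<le> c\<^sup>2 / 2"
  shows "c\<^sup>2 / 2 * nm \<sigma> \<le> nm (f * \<sigma> * v)"
proof -
  have "(c * nm \<sigma>) * (c * nm \<sigma>) \<le> nm (f * \<sigma>) * nm (\<sigma> * v)"
    using g c pos by (intro mult_mono) auto
  also have "\<dots> \<le> nm (f * \<sigma> * v) * nm \<sigma> + nm f * nm v * n2 \<sigma>"
    using d by (intro nm_rank_one) auto
  also have "nm f * nm v * n2 \<sigma> = (nm f * nm v * wd \<sigma>) * (nm \<sigma>)\<^sup>2"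
    unfolding wd_def using pos by simp
  also have "\<dots> \<le> c\<^sup>2 / 2 * (nm \<sigma>)\<^sup>2" using w by (intro mult_right_mono) auto
  finally have "nm \<sigma> * (c\<^sup>2 / 2 * nm \<sigma>) \<le> nm \<sigma> * nm (f * \<sigma> * v)" by (simp add: power2_eq_square algebra_simps)
  thus ?thesis using pos by simp
qed

lemma poly_quartic:
  "poly (Poly [c0, c1, c2, c3, c4]) (x :: int) = c0 + x * c1 + x^2 * c2 + x^3 * c3 + x^4 * c4"
proof -
  have "poly (Poly [c0, c1, c2, c3, c4]) x = c0 + x * (c1 + x * (c2 + x * (c3 + x * c4)))"
    by (simp only: Poly.simps poly_pCons poly_0 mult_zero_right add_0_right)
  also have "\<dots> = c0 + x * c1 + x^2 * c2 + x^3 * c3 + x^4 * c4"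
    by (simp add: power2_eq_square power3_eq_cube power4_eq_xxxx distrib_left mult.assoc add.assoc)
  finally show ?thesis .
qed

lemma quartic_lower:
  fixes M :: real
  assumes "M \<ge> 1"
  shows "\<bar>X\<bar> - \<bar>c0 + M * c1 + M^2 * c2 + M^3 * c3 + X\<bar> \<le> M^3 * (\<bar>c0\<bar> + \<bar>c1\<bar> + \<bar>c2\<bar> + \<bar>c3\<bar>)"
proof -
  define Y where "Y = c0 + M * c1 + M^2 * c2 + M^3 * c3"
  have a: "\<bar>c0\<bar> \<le> M^3 * \<bar>c0\<bar>" using mult_right_mono[OF one_le_power[OF assms, of 3], of "\<bar>c0\<bar>"] by simp
  have b: "\<bar>M * c1\<bar> \<le> M^3 * \<bar>c1\<bar>"
    unfolding abs_mult using power_increasing[of 1 3 M] assms by (intro mult_right_mono) auto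
  have c: "\<bar>M^2 * c2\<bar> \<le> M^3 * \<bar>c2\<bar>"
    unfolding abs_mult using power_increasing[of 2 3 M] assms by (intro mult_right_mono) auto
  have d: "\<bar>M^3 * c3\<bar> \<le> M^3 * \<bar>c3\<bar>" unfolding abs_mult using assms by simp
  have "\<bar>X\<bar> - \<bar>Y + X\<bar> \<le> \<bar>Y\<bar>" by linarith
  also have "\<bar>Y\<bar> \<le> \<bar>c0\<bar> + \<bar>M * c1\<bar> + \<bar>M^2 * c2\<bar> + \<bar>M^3 * c3\<bar>"
    unfolding Y_def by (intro order_trans[OF abs_triangle_ineq] add_mono order_refl)
  also have "\<dots> \<le> M^3 * \<bar>c0\<bar> + M^3 * \<bar>c1\<bar> + M^3 * \<bar>c2\<bar> + M^3 * \<bar>c3\<bar>"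
    by (intro add_mono a b c d)
  finally show ?thesis unfolding Y_def by (simp only: distrib_left)
qed

text \<open>A good incident pair \<open>(v,f)\<close> works for all matrices of \<open>S'\<close> outside the finite set \<open>F\<close> of those with large \<open>wd\<close>. For the
matrices in \<open>F\<close>, being integral, it is enough that \<open>f \<sigma> v \<noteq> 0\<close>. Far out on the curve from a pair that does not annihilate any
matrix of \<open>F\<close> to \<open>(v,f)\<close> both requirements are met: the leading term of the quartic dominates its lower coefficients uniformly
outside \<open>F\<close>, and each matrix of \<open>F\<close> excludes finitely many points.\<close>

lemma generic_incident_pair:
  assumes n: "n \<ge> 2"
    and S: "\<And>\<sigma>. \<sigma> \<in> S \<Longrightarrow> is_sq n \<sigma> \<and> 1 \<le> nm \<sigma>"
    and thin: "\<And>w. w > 0 \<Longrightarrow> finite {\<sigma>\<in>S. w \<le> wd \<sigma>}"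
    and dense: "\<And>x \<epsilon>. is_col n x \<Longrightarrow> \<epsilon> > 0 \<Longrightarrow>
       \<exists>b u. b > 0 \<and> is_col n u \<and> nm u \<le> \<epsilon> * real_of_int b \<and> good S (b \<cdot>\<^sub>m x + u)"
    and f1: "is_row n f1" "cogood S f1"
    and nz: "\<And>A. A \<in> S' \<Longrightarrow> \<exists>v f. is_col n v \<and> is_row n f \<and> dotm n f v = 0 \<and> bil n f A v \<noteq> 0"
    and S': "S' \<subseteq> S"
  shows "\<exists>v f. is_col n v \<and> is_row n f \<and> dotm n f v = 0 \<and> (\<exists>c>0. \<forall>\<sigma>\<in>S'. c * nm \<sigma> \<le> nm (f * \<sigma> * v))"
proof -
  have "\<exists>v f. is_col n v \<and> is_row n f \<and> dotm n f v = 0 \<and> good S v \<and> cogood S f \<and> v \<noteq> 0\<^sub>m n 1"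
    by (rule incident_good[OF n _ dense f1]) (use S in auto)
  then obtain v f where vf: "is_col n v" "is_row n f" "dotm n f v = 0" "good S v" "cogood S f" "v \<noteq> 0\<^sub>m n 1"
    by blast
  obtain c1 where c1: "c1 > 0" "\<And>\<sigma>. \<sigma> \<in> S \<Longrightarrow> c1 * nm \<sigma> \<le> nm (\<sigma> * v)" using vf unfolding good_def by blast
  obtain c2 where c2: "c2 > 0" "\<And>\<sigma>. \<sigma> \<in> S \<Longrightarrow> c2 * nm \<sigma> \<le> nm (f * \<sigma>)" using vf unfolding cogood_def by blast
  define c where "c = min c1 c2"
  have c: "c > 0" using c1 c2 unfolding c_def by auto
  have cg: "c * nm \<sigma> \<le> nm (\<sigma> * v)" "c * nm \<sigma> \<le> nm (f * \<sigma>)" if "\<sigma> \<in> S" for \<sigma>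
  proof -
    have "c * nm \<sigma> \<le> c1 * nm \<sigma>" "c * nm \<sigma> \<le> c2 * nm \<sigma>" unfolding c_def by (auto intro: mult_right_mono)
    thus "c * nm \<sigma> \<le> nm (\<sigma> * v)" "c * nm \<sigma> \<le> nm (f * \<sigma>)" using c1(2)[OF that] c2(2)[OF that] by auto
  qed
  define w0 where "w0 = c\<^sup>2 / (2 * (nm f * nm v + 1))"
  have k1: "0 < nm f * nm v + 1" by (simp add: add_nonneg_pos)
  have w0: "w0 > 0" unfolding w0_def using c k1 by simp
  define F where "F = {\<sigma>\<in>S'. w0 \<le> wd \<sigma>}"
  have finF: "finite F" unfolding F_def using thin[OF w0] by (rule finite_subset[rotated]) (use S' in auto)
  have far: "c\<^sup>2 / 2 * nm \<sigma> \<le> \<bar>real_of_int (bil n f \<sigma> v)\<bar>" if "\<sigma> \<in> S' - F" for \<sigma>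
  proof -
    have s: "\<sigma> \<in> S" "wd \<sigma> < w0" using that S' unfolding F_def by auto
    have "nm f * nm v * wd \<sigma> \<le> (nm f * nm v + 1) * w0" using s w0 by (intro mult_mono) auto
    also have "\<dots> = c\<^sup>2 / 2" unfolding w0_def using k1 by (simp add: field_simps)
    finally have "c\<^sup>2 / 2 * nm \<sigma> \<le> nm (f * \<sigma> * v)"
      using vf S[OF s(1)] c cg[OF s(1)] by (intro rank_one_lower[where n = n]) auto
    thus ?thesis using nm_bil[where n = n and f = f and A = \<sigma> and v = v] vf S[OF s(1)] by simp
  qed
  obtain v' f' where vf': "is_col n v'" "is_row n f'" "dotm n f' v' = 0" "\<forall>A\<in>F. bil n f' A v' \<noteq> 0"
    using incident_avoid_finite[OF finF, where n = n] n nz unfolding F_def by auto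
  let ?v = "\<lambda>m. lin m v v'" and ?f = "\<lambda>m. annih n (lin m f f') (lin m v v')"
  define q where "q = real_of_int (dotm n (transpose_mat v) v)"
  have q: "q \<ge> 1"
  proof -
    have "0 < nm v"
    proof (rule ccontr)
      assume "\<not> 0 < nm v"
      hence "nm v = 0" using nm_nonneg[of v] by linarith
      have "v $$ (i,0) = 0" if "i < n" for i
        using entry_le_nm[of i v 0] that vf(1) \<open>nm v = 0\<close> by simp
      hence "v = 0\<^sub>m n 1" using vf(1) by (intro eq_matI) auto
      thus False using vf(6) by simp
    qed
    hence "0 < (nm v)\<^sup>2" by simp
    also have "\<dots> \<le> (real n)\<^sup>2 * q" unfolding q_def using vf n by (intro dotm_self_ge) auto
    finally have "0 < q" by (simp add: zero_less_mult_iff)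
    hence "1 \<le> dotm n (transpose_mat v) v" unfolding q_def by simp
    thus ?thesis unfolding q_def by (simp only: of_int_1_le_iff)
  qed
  define a where "a = nm v + nm v' + nm f + nm f'"
  have a0: "0 \<le> a" unfolding a_def by simp
  have bb: "\<bar>real_of_int (bil n g A u)\<bar> \<le> a * a * nm A" if "is_row n g" "is_sq n A" "is_col n u" "nm g \<le> a" "nm u \<le> a" for g A u
    using bil_le[OF that(1-3)] by (rule order_trans) (intro mult_mono that a0 mult_nonneg_nonneg nm_nonneg order_refl)
  have dd: "\<bar>real_of_int (dotm n g u)\<bar> \<le> a * a" if "is_row n g" "is_col n u" "nm g \<le> a" "nm u \<le> a" for g u
    using dotm_le[OF that(1-2)] by (rule order_trans) (intro mult_mono that a0 nm_nonneg)
  have na: "nm v \<le> a" "nm v' \<le> a" "nm f \<le> a" "nm f' \<le> a" unfolding a_def by auto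
  \<comment> \<open>the four lower coefficients contain 14 products of a value of \<open>dotm\<close> and a value of \<open>bil\<close>, each bounded by \<open>4 * a ^ 4 * nm A\<close>\<close>
  define K where "K = 56 * (a * a * (a * a))"
  have K0: "0 \<le> K" unfolding K_def using a0 by simp
  have coefs: "\<exists>c0 c1 c2 c3. curve_poly n v f v' f' A = [c0, c1, c2, c3, dotm n (transpose_mat v) v * bil n f A v]
      \<and> \<bar>real_of_int c0\<bar> + \<bar>real_of_int c1\<bar> + \<bar>real_of_int c2\<bar> + \<bar>real_of_int c3\<bar> \<le> K * nm A" if A: "is_sq n A" for A
  proof -
    define a0 a1 a2 where "a0 = dotm n (transpose_mat v') v'" and "a1 = dotm n (transpose_mat v) v' + dotm n (transpose_mat v') v"
      and "a2 = dotm n (transpose_mat v) v"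
    define b0 b1 b2 where "b0 = bil n f' A v'" and "b1 = bil n f A v' + bil n f' A v" and "b2 = bil n f A v"
    define e0 e1 where "e0 = dotm n f' v'" and "e1 = dotm n f v' + dotm n f' v"
    define d0 d1 d2 where "d0 = bil n (transpose_mat v') A v'" and "d1 = bil n (transpose_mat v) A v' + bil n (transpose_mat v') A v"
      and "d2 = bil n (transpose_mat v) A v"
    let ?a = "2 * (a * a)" and ?b = "2 * (a * a * nm A)"
    have two: "\<bar>real_of_int (x + y)\<bar> \<le> 2 * t" if "\<bar>real_of_int x\<bar> \<le> t" "\<bar>real_of_int y\<bar> \<le> t" for x y t
      using that by linarith
    have one: "\<bar>real_of_int x\<bar> \<le> 2 * t" if "\<bar>real_of_int x\<bar> \<le> t" for x t
      using that by linarith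
    have A1: "\<bar>real_of_int a0\<bar> \<le> ?a" "\<bar>real_of_int a1\<bar> \<le> ?a" "\<bar>real_of_int a2\<bar> \<le> ?a"
        "\<bar>real_of_int e0\<bar> \<le> ?a" "\<bar>real_of_int e1\<bar> \<le> ?a"
      unfolding a0_def a1_def a2_def e0_def e1_def using vf vf' na by (intro one two dd; simp)+
    have B1: "\<bar>real_of_int b0\<bar> \<le> ?b" "\<bar>real_of_int b1\<bar> \<le> ?b" "\<bar>real_of_int b2\<bar> \<le> ?b"
        "\<bar>real_of_int d0\<bar> \<le> ?b" "\<bar>real_of_int d1\<bar> \<le> ?b" "\<bar>real_of_int d2\<bar> \<le> ?b"
      unfolding b0_def b1_def b2_def d0_def d1_def d2_def using vf vf' na A by (intro one two bb; simp)+
    have pr: "\<bar>real_of_int (x * y)\<bar> \<le> ?a * ?b" if "\<bar>real_of_int x\<bar> \<le> ?a" "\<bar>real_of_int y\<bar> \<le> ?b" for x y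
      unfolding of_int_mult abs_mult using that a0 by (intro mult_mono) auto
    have ab: "?a * ?b = 4 * (a * a * (a * a)) * nm A" by simp
    define t where "t = ?a * ?b"
    note pr' = pr[folded t_def]
    have c0: "\<bar>real_of_int (a0*b0 - e0*d0)\<bar> \<le> 2 * t"
      using pr'[OF A1(1) B1(1)] pr'[OF A1(4) B1(4)] by linarith
    have c1: "\<bar>real_of_int (a0*b1 + a1*b0 - e0*d1 - e1*d0)\<bar> \<le> 4 * t"
      using pr'[OF A1(1) B1(2)] pr'[OF A1(2) B1(1)] pr'[OF A1(4) B1(5)] pr'[OF A1(5) B1(4)] by linarith
    have c2: "\<bar>real_of_int (a0*b2 + a1*b1 + a2*b0 - e0*d2 - e1*d1)\<bar> \<le> 5 * t"
      using pr'[OF A1(1) B1(3)] pr'[OF A1(2) B1(2)] pr'[OF A1(3) B1(1)] pr'[OF A1(4) B1(6)] pr'[OF A1(5) B1(5)] by linarith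
    have c3: "\<bar>real_of_int (a1*b2 + a2*b1 - e1*d2)\<bar> \<le> 3 * t"
      using pr'[OF A1(2) B1(3)] pr'[OF A1(3) B1(2)] pr'[OF A1(5) B1(6)] by linarith
    have "14 * t = K * nm A" unfolding t_def ab K_def by simp
    hence "\<bar>real_of_int (a0*b0 - e0*d0)\<bar> + \<bar>real_of_int (a0*b1 + a1*b0 - e0*d1 - e1*d0)\<bar>
        + \<bar>real_of_int (a0*b2 + a1*b1 + a2*b0 - e0*d2 - e1*d1)\<bar> + \<bar>real_of_int (a1*b2 + a2*b1 - e1*d2)\<bar> \<le> K * nm A"
      using c0 c1 c2 c3 by linarith
    moreover have "curve_poly n v f v' f' A = [a0*b0 - e0*d0, a0*b1 + a1*b0 - e0*d1 - e1*d0, a0*b2 + a1*b1 + a2*b0 - e0*d2 - e1*d1,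
         a1*b2 + a2*b1 - e1*d2, a2*b2]"
      unfolding curve_poly_def Let_def a0_def a1_def a2_def b0_def b1_def b2_def d0_def d1_def d2_def e0_def e1_def ..
    ultimately show ?thesis unfolding a2_def b2_def by blast
  qed
  define U I where "U = (\<Union>B\<in>F. {m. bil n (?f m) B (?v m) = 0})" and "I = {m::nat. 2 * (K + 1) / c\<^sup>2 + 1 \<le> real m}"
  have "finite U"
    unfolding U_def using finF vf vf' by (intro finite_UN_I finite_curve_zeros) auto
  moreover have "infinite I"
  proof -
    obtain m0 :: nat where m0: "2 * (K + 1) / c\<^sup>2 + 1 \<le> real m0" using real_arch_simple by blast
    have "{m0..} \<subseteq> I" unfolding I_def using m0 by force
    thus ?thesis using infinite_Ici[of m0] infinite_super by blast
  qed
  ultimately have "infinite (I - U)" by (rule Diff_infinite_finite)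
  then obtain m where "m \<in> I - U" using infinite_imp_nonempty by blast
  hence mI: "m \<in> I" and mU: "m \<notin> U" by auto
  have m: "2 * (K + 1) / c\<^sup>2 + 1 \<le> real m" using mI unfolding I_def by simp
  have "0 \<le> 2 * (K + 1) / c\<^sup>2" using K0 c by (intro divide_nonneg_pos) auto
  hence m1: "real m \<ge> 1" using m by linarith
  have mK: "K + 1 \<le> real m * (c\<^sup>2 / 2)"
  proof -
    have "2 * (K + 1) / c\<^sup>2 \<le> real m" using m by simp
    thus ?thesis using c by (simp add: field_simps)
  qed
  have away: "nm \<sigma> \<le> \<bar>real_of_int (bil n (?f m) \<sigma> (?v m))\<bar>" if s: "\<sigma> \<in> S' - F" for \<sigma>
  proof -
    have A: "is_sq n \<sigma>" using S S' s by auto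
    obtain c0 c1 c2 c3 where cs: "curve_poly n v f v' f' \<sigma> = [c0, c1, c2, c3, dotm n (transpose_mat v) v * bil n f \<sigma> v]"
      "\<bar>real_of_int c0\<bar> + \<bar>real_of_int c1\<bar> + \<bar>real_of_int c2\<bar> + \<bar>real_of_int c3\<bar> \<le> K * nm \<sigma>"
      using coefs[OF A] by blast
    let ?B = "real_of_int (bil n f \<sigma> v)"
    have "bil n (?f m) \<sigma> (?v m) = poly (Poly [c0, c1, c2, c3, dotm n (transpose_mat v) v * bil n f \<sigma> v]) (int m)"
      unfolding cs(1)[symmetric] using vf vf' by (intro bil_curve) auto
    hence "real_of_int (bil n (?f m) \<sigma> (?v m)) = real_of_int c0 + real m * real_of_int c1 + (real m)^2 * real_of_int c2
        + (real m)^3 * real_of_int c3 + (real m)^4 * (q * ?B)"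
      unfolding q_def poly_quartic by simp
    hence "\<bar>(real m)^4 * (q * ?B)\<bar> - \<bar>real_of_int (bil n (?f m) \<sigma> (?v m))\<bar> \<le>
       (real m)^3 * (\<bar>real_of_int c0\<bar> + \<bar>real_of_int c1\<bar> + \<bar>real_of_int c2\<bar> + \<bar>real_of_int c3\<bar>)"
      using quartic_lower[OF m1] by simp
    also have "\<dots> \<le> (real m)^3 * (K * nm \<sigma>)" using cs(2) by (intro mult_left_mono) auto
    finally have 1: "\<bar>(real m)^4 * (q * ?B)\<bar> - \<bar>real_of_int (bil n (?f m) \<sigma> (?v m))\<bar> \<le> (real m)^3 * (K * nm \<sigma>)" .
    have "(real m)^3 * ((K + 1) * nm \<sigma>) \<le> (real m)^3 * ((real m * (c\<^sup>2 / 2)) * nm \<sigma>)"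
      using mK by (intro mult_left_mono mult_right_mono) auto
    also have "\<dots> = (real m)^4 * (1 * (c\<^sup>2 / 2 * nm \<sigma>))" by (simp add: power4_eq_xxxx power3_eq_cube)
    also have "\<dots> \<le> (real m)^4 * (q * \<bar>?B\<bar>)" using q far[OF s] by (intro mult_left_mono mult_mono) auto
    also have "\<dots> = \<bar>(real m)^4 * (q * ?B)\<bar>" using q by (simp add: abs_mult)
    finally have "(real m)^3 * (K * nm \<sigma>) + (real m)^3 * nm \<sigma> \<le> \<bar>(real m)^4 * (q * ?B)\<bar>" by (simp add: algebra_simps)
    hence "(real m)^3 * nm \<sigma> \<le> \<bar>real_of_int (bil n (?f m) \<sigma> (?v m))\<bar>" using 1 by linarith
    moreover have "1 * nm \<sigma> \<le> (real m)^3 * nm \<sigma>" using m1 by (intro mult_right_mono one_le_power) auto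
    ultimately show ?thesis by linarith
  qed
  define cc where "cc = 1 / (1 + sum nm F)"
  have sF: "0 \<le> sum nm F" by (intro sum_nonneg) auto
  have cc: "0 < cc" "cc \<le> 1" unfolding cc_def using sF by auto
  have "\<forall>\<sigma>\<in>S'. cc * nm \<sigma> \<le> nm (?f m * \<sigma> * ?v m)"
  proof
    fix \<sigma> assume s: "\<sigma> \<in> S'"
    have A: "is_sq n \<sigma>" using S S' s by auto
    have eq: "nm (?f m * \<sigma> * ?v m) = \<bar>real_of_int (bil n (?f m) \<sigma> (?v m))\<bar>"
      using vf vf' A by (intro nm_bil) auto
    show "cc * nm \<sigma> \<le> nm (?f m * \<sigma> * ?v m)"
    proof (cases "\<sigma> \<in> F")
      case True
      have "nm \<sigma> \<le> sum nm F" using True finF by (intro member_le_sum) auto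
      hence "cc * nm \<sigma> \<le> 1" unfolding cc_def using sF by (simp add: field_simps)
      moreover have "bil n (?f m) \<sigma> (?v m) \<noteq> 0" using mU True unfolding U_def by blast
      hence "1 \<le> \<bar>bil n (?f m) \<sigma> (?v m)\<bar>" by linarith
      hence "1 \<le> \<bar>real_of_int (bil n (?f m) \<sigma> (?v m))\<bar>" by (simp only: of_int_abs[symmetric] of_int_1_le_iff)
      ultimately show ?thesis unfolding eq by (rule order_trans)
    next
      case False
      have "cc * nm \<sigma> \<le> 1 * nm \<sigma>" using cc by (intro mult_right_mono) auto
      thus ?thesis using away[of \<sigma>] False s unfolding eq by simp
    qed
  qed
  moreover have "dotm n (?f m) (?v m) = 0" using vf vf' by (intro dotm_annih) auto
  moreover have "is_col n (?v m)" "is_row n (?f m)" using vf vf' by auto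
  ultimately show ?thesis using cc(1) by blast
qed

section \<open>Special linear groups over the integers\<close>

abbreviation SL :: "nat \<Rightarrow> int mat set" where "SL n \<equiv> carrier (SL_int n)"
abbreviation iv :: "nat \<Rightarrow> int mat \<Rightarrow> int mat" where "iv n A \<equiv> inv\<^bsub>SL_int n\<^esub> A"
abbreviation ZZ :: "nat \<Rightarrow> int mat set" where "ZZ n \<equiv> center (SL_int n)"

lemma SL_iff: "A \<in> SL n \<longleftrightarrow> is_sq n A \<and> Determinant.det A = 1"
  unfolding SL_int_def partial_object.simps mem_Collect_eq carrier_mat_def ..

lemma SL_dim [simp]: "A \<in> SL n \<Longrightarrow> dim_row A = n" "A \<in> SL n \<Longrightarrow> dim_col A = n"
  by (simp_all only: SL_iff)

lemma SL_mult_eq [simp]: "A \<otimes>\<^bsub>SL_int n\<^esub> B = A * B" by (simp add: SL_int_def)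
lemma SL_one_eq [simp]: "\<one>\<^bsub>SL_int n\<^esub> = 1\<^sub>m n" by (simp add: SL_int_def)

lemma SL_mult [simp, intro]: "A \<in> SL n \<Longrightarrow> B \<in> SL n \<Longrightarrow> A * B \<in> SL n"
  using monoid.m_closed[OF group.is_monoid[OF group_SL_int], of A n B] by simp
lemma SL_one [simp, intro]: "1\<^sub>m n \<in> SL n"
  using monoid.one_closed[OF group.is_monoid[OF group_SL_int], of n] by simp
lemma SL_iv [simp, intro]: "A \<in> SL n \<Longrightarrow> iv n A \<in> SL n"
  using group.inv_closed[OF group_SL_int] .
lemma iv_dim [simp]: "A \<in> SL n \<Longrightarrow> dim_row (iv n A) = n" "A \<in> SL n \<Longrightarrow> dim_col (iv n A) = n"
  using SL_dim[OF SL_iv] by auto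
lemma iv_l [simp]: "A \<in> SL n \<Longrightarrow> iv n A * A = 1\<^sub>m n"
  using group.l_inv[OF group_SL_int, of A n] by simp
lemma iv_r [simp]: "A \<in> SL n \<Longrightarrow> A * iv n A = 1\<^sub>m n"
  using group.r_inv[OF group_SL_int, of A n] by simp
lemma iv_iv [simp]: "A \<in> SL n \<Longrightarrow> iv n (iv n A) = A"
  using group.inv_inv[OF group_SL_int] .
lemma iv_mult: "A \<in> SL n \<Longrightarrow> B \<in> SL n \<Longrightarrow> iv n (A * B) = iv n B * iv n A"
  using group.inv_mult_group[OF group_SL_int, of A n B] by simp
lemma SL_1l [simp]: "A \<in> SL n \<Longrightarrow> 1\<^sub>m n * A = A"
  using monoid.l_one[OF group.is_monoid[OF group_SL_int], of A n] by simp
lemma SL_1r [simp]: "A \<in> SL n \<Longrightarrow> A * 1\<^sub>m n = A"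
  using monoid.r_one[OF group.is_monoid[OF group_SL_int], of A n] by simp
lemma SL_assoc: "A \<in> SL n \<Longrightarrow> B \<in> SL n \<Longrightarrow> C \<in> SL n \<Longrightarrow> A * B * C = A * (B * C)"
  by (intro mat_assoc) simp_all
lemma iv_l' [simp]: "A \<in> SL n \<Longrightarrow> B \<in> SL n \<Longrightarrow> iv n A * (A * B) = B"
  by (metis SL_assoc SL_iv SL_1l iv_l)
lemma iv_unique: "A \<in> SL n \<Longrightarrow> B \<in> SL n \<Longrightarrow> A * B = 1\<^sub>m n \<Longrightarrow> iv n A = B"
  by (metis SL_1r SL_iv iv_l')
lemma iv_r' [simp]: "A \<in> SL n \<Longrightarrow> B \<in> SL n \<Longrightarrow> A * (iv n A * B) = B"
  by (metis SL_assoc SL_iv SL_1l iv_r)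

lemma SL_nm_ge_1: "A \<in> SL n \<Longrightarrow> n > 0 \<Longrightarrow> 1 \<le> nm A"
proof (rule ccontr)
  assume A: "A \<in> SL n" and n: "n > 0" and "\<not> 1 \<le> nm A"
  hence "A $$ (i,j) = 0" if "i < n" "j < n" for i j using that nm_ge_1[of i A j] by auto
  hence "A = 0\<^sub>m n n" using A by (intro eq_matI) auto
  moreover have "1\<^sub>m n = iv n A * A" using A by simp
  ultimately have "(1\<^sub>m n :: int mat) $$ (0,0) = (iv n A * 0\<^sub>m n n) $$ (0,0)" by simp
  also have "\<dots> = 0" using A n by (simp add: index_mult_sum del: index_mult_mat(1))
  finally show False using n by simp
qed

lemma nm_cancel_l: "r \<in> SL n \<Longrightarrow> dim_row M = n \<Longrightarrow> nm M \<le> nm (iv n r) * nm (r * M)"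
proof -
  assume r: "r \<in> SL n" and M: "dim_row M = n"
  have "iv n r * (r * M) = M" using mat_assoc[of "iv n r" r M] r M by simp
  thus ?thesis using nm_mult[of "iv n r" "r * M"] r M by simp
qed

lemma nm_cancel_r: "r \<in> SL n \<Longrightarrow> dim_col M = n \<Longrightarrow> nm M \<le> nm (M * r) * nm (iv n r)"
proof -
  assume r: "r \<in> SL n" and M: "dim_col M = n"
  have "(M * r) * iv n r = M" using mat_assoc[of M r "iv n r"] r M by simp
  thus ?thesis using nm_mult[of "M * r" "iv n r"] r M by simp
qed

lemma scalar_central:
  assumes "A \<in> SL n" "\<And>i j. i < n \<Longrightarrow> j < n \<Longrightarrow> i \<noteq> j \<Longrightarrow> A $$ (i,j) = 0"
    "\<And>i j. i < n \<Longrightarrow> j < n \<Longrightarrow> A $$ (i,i) = A $$ (j,j)"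
  shows "A \<in> ZZ n"
proof -
  define c where "c = A $$ (0,0)"
  have Ac: "A $$ (i,j) = (if i = j then c else 0)" if "i < n" "j < n" for i j
    using that assms(2)[OF that] assms(3)[of i 0] unfolding c_def by auto
  have "A * B = B * A" if B: "B \<in> SL n" for B
  proof (intro eq_matI)
    fix i j assume "i < dim_row (B * A)" "j < dim_col (B * A)"
    hence ij: "i < n" "j < n" using assms(1) B by auto
    have "(A * B) $$ (i,j) = (\<Sum>k<n. (if i = k then c else 0) * B $$ (k,j))"
      using assms(1) B ij Ac by (simp add: index_mult_sum del: index_mult_mat(1))
    also have "\<dots> = c * B $$ (i,j)" using ij by (simp add: if_distrib[of "\<lambda>x. x * _"] cong: if_cong)
    also have "\<dots> = (\<Sum>k<n. B $$ (i,k) * (if k = j then c else 0))" using ij by (simp add: if_distrib[of "\<lambda>x. _ * x"] cong: if_cong)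
    also have "\<dots> = (B * A) $$ (i,j)" using assms(1) B ij Ac by (simp add: index_mult_sum del: index_mult_mat(1))
    finally show "(A * B) $$ (i,j) = (B * A) $$ (i,j)" .
  qed (use assms(1) B in auto)
  thus ?thesis using assms(1) unfolding center_def by simp
qed

text \<open>A matrix that annihilates all incident pairs is scalar: the pairs of distinct basis vectors show that it is diagonal, and the
pairs \<open>(e\<^sub>i - e\<^sub>j, e\<^sub>i + e\<^sub>j)\<close> that its diagonal is constant.\<close>

lemma nonscalar_incident:
  assumes A: "A \<in> SL n" "A \<notin> ZZ n"
  shows "\<exists>v f. is_col n v \<and> is_row n f \<and> dotm n f v = 0 \<and> bil n f A v \<noteq> 0"
proof (rule ccontr)
  assume "\<not> ?thesis"
  hence no: "bil n f A v = 0" if "is_col n v" "is_row n f" "dotm n f v = 0" for v f using that by blast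
  define R where "R = (\<lambda>f :: nat \<Rightarrow> int. Matrix.mat 1 n (\<lambda>(_,k). f k))"
  define V where "V = (\<lambda>f :: nat \<Rightarrow> int. Matrix.mat n 1 (\<lambda>(k,_::nat). f k))"
  have RV: "is_row n (R f)" "is_col n (V g)" "dotm n (R f) (V g) = (\<Sum>i<n. f i * g i)"
     "bil n (R f) A (V g) = (\<Sum>i<n. \<Sum>j<n. f i * A $$ (i,j) * g j)" for f g
    unfolding R_def V_def dotm_def bil_def by (auto intro!: sum.cong)
  have no': "(\<Sum>i<n. \<Sum>j<n. f i * A $$ (i,j) * g j) = 0" if "(\<Sum>i<n. f i * g i) = 0" for f g
    using no[of "V g" "R f"] RV that by metis
  let ?d = "\<lambda>i k :: nat. if k = i then 1 else 0 :: int"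
  have ev: "(\<Sum>i<n. \<Sum>j<n. ?d a i * A $$ (i,j) * g j) = (\<Sum>j<n. A $$ (a,j) * g j)" if "a < n" for a g
  proof -
    have "(\<Sum>i<n. \<Sum>j<n. ?d a i * A $$ (i,j) * g j) = (\<Sum>i<n. if i = a then (\<Sum>j<n. A $$ (i,j) * g j) else 0)"
      by (intro sum.cong refl) auto
    thus ?thesis using that by simp
  qed
  have ev2: "(\<Sum>j<n. x j * ?d b j) = x b" if "b < n" for b and x :: "nat \<Rightarrow> int"
    using that by (simp add: if_distrib[of "\<lambda>y. _ * y"] cong: if_cong)
  have off: "A $$ (i,j) = 0" if ij: "i < n" "j < n" "i \<noteq> j" for i j
  proof -
    have "(\<Sum>k<n. ?d i k * ?d j k) = 0" using ij by (intro sum.neutral) auto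
    from no'[OF this] show ?thesis using ev[OF ij(1), of "?d j"] ev2[OF ij(2), of "\<lambda>k. A $$ (i,k)"] by simp
  qed
  moreover have "A $$ (i,i) = A $$ (j,j)" if ij: "i < n" "j < n" for i j
  proof (cases "i = j")
    case False
    let ?f = "\<lambda>k. ?d i k + ?d j k" and ?g = "\<lambda>k. ?d i k - ?d j k"
    have "(\<Sum>k<n. ?f k * ?g k) = (\<Sum>k<n. ?d i k - ?d j k)" using False by (intro sum.cong) auto
    also have "\<dots> = 0" using ij by (simp add: sum_subtractf)
    finally have z: "(\<Sum>k<n. \<Sum>l<n. ?f k * A $$ (k,l) * ?g l) = 0" by (rule no')
    have "(\<Sum>k<n. \<Sum>l<n. ?f k * A $$ (k,l) * ?g l) = (\<Sum>k<n. \<Sum>l<n. ?d i k * A $$ (k,l) * ?g l) + (\<Sum>k<n. \<Sum>l<n. ?d j k * A $$ (k,l) * ?g l)"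
      by (simp only: sum.distrib[symmetric] distrib_right)
    also have "\<dots> = (\<Sum>l<n. A $$ (i,l) * ?g l) + (\<Sum>l<n. A $$ (j,l) * ?g l)" by (simp only: ev ij)
    also have "\<dots> = (A $$ (i,i) - A $$ (i,j)) + (A $$ (j,i) - A $$ (j,j))"
      by (simp only: right_diff_distrib sum_subtractf ev2 ij)
    finally show ?thesis using z off ij False by simp
  qed simp
  ultimately show False using scalar_central A by blast
qed

section \<open>Chains of left multiplications\<close>

text \<open>The intermediate products have to stay in \<open>T\<close>, which is not a group in the applications, because \<open>good_line\<close> compares
every element with a shorter one from \<open>T\<close>.\<close>

inductive_set reach :: "nat \<Rightarrow> int mat set \<Rightarrow> int mat set \<Rightarrow> int mat set" for n L T where
  reach_one: "1\<^sub>m n \<in> reach n L T"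
| reach_mult: "a \<in> L \<Longrightarrow> \<sigma> \<in> reach n L T \<Longrightarrow> a * \<sigma> \<in> T \<Longrightarrow> a * \<sigma> \<in> reach n L T"

fun rball :: "nat \<Rightarrow> int mat set \<Rightarrow> int mat set \<Rightarrow> nat \<Rightarrow> int mat set" where
  "rball n L T 0 = {1\<^sub>m n}"
| "rball n L T (Suc k) = rball n L T k \<union> ((\<lambda>(a,s). a * s) ` (L \<times> rball n L T k) \<inter> T)"

lemma finite_rball: "finite L \<Longrightarrow> finite (rball n L T k)"
  by (induction k) auto

lemma rball_mono: "k \<le> m \<Longrightarrow> rball n L T k \<subseteq> rball n L T m"
  by (induction m) (auto simp: le_Suc_eq)

lemma rball_sub: "1\<^sub>m n \<in> T \<Longrightarrow> rball n L T k \<subseteq> T"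
  by (induction k) auto

lemma reach_rball: "\<tau> \<in> reach n L T \<Longrightarrow> \<exists>k. \<tau> \<in> rball n L T k"
proof (induction rule: reach.induct)
  case reach_one show ?case by (intro exI[of _ 0]) simp
next
  case (reach_mult a \<sigma>)
  then obtain k where "\<sigma> \<in> rball n L T k" by blast
  thus ?case using reach_mult by (intro exI[of _ "Suc k"]) auto
qed

text \<open>The length of a shortest chain is a length function as required in \<open>good_line\<close>.\<close>

lemma reach_length:
  assumes L: "finite L" and T: "1\<^sub>m n \<in> T" "T \<subseteq> reach n L T"
  shows "\<exists>l. (\<forall>N. finite {\<tau>\<in>T. l \<tau> \<le> (N::nat)}) \<and>
    (\<forall>\<tau>\<in>T. 0 < l \<tau> \<longrightarrow> (\<exists>\<sigma>\<in>T. \<exists>a\<in>L. l \<sigma> < l \<tau> \<and> \<tau> = a * \<sigma>))"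
proof -
  define l where "l = (\<lambda>\<tau>. LEAST k. \<tau> \<in> rball n L T k)"
  have lin: "\<tau> \<in> rball n L T (l \<tau>)" if "\<tau> \<in> T" for \<tau>
  proof -
    have "\<tau> \<in> reach n L T" using T(2) that by blast
    from reach_rball[OF this] obtain k where "\<tau> \<in> rball n L T k" by blast
    thus ?thesis unfolding l_def by (rule LeastI)
  qed
  have "finite {\<tau>\<in>T. l \<tau> \<le> N}" for N
  proof (rule finite_subset)
    show "{\<tau>\<in>T. l \<tau> \<le> N} \<subseteq> rball n L T N" using lin rball_mono by blast
  qed (rule finite_rball[OF L])
  moreover have "\<exists>\<sigma>\<in>T. \<exists>a\<in>L. l \<sigma> < l \<tau> \<and> \<tau> = a * \<sigma>" if t: "\<tau> \<in> T" "0 < l \<tau>" for \<tau>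
  proof -
    obtain k where k: "l \<tau> = Suc k" using t(2) by (cases "l \<tau>") auto
    have "\<tau> \<notin> rball n L T k"
    proof
      assume "\<tau> \<in> rball n L T k"
      hence "l \<tau> \<le> k" unfolding l_def by (rule Least_le)
      thus False using k by simp
    qed
    then obtain a \<sigma> where as: "a \<in> L" "\<sigma> \<in> rball n L T k" "\<tau> = a * \<sigma>" using lin[OF t(1)] unfolding k by auto
    moreover have "l \<sigma> \<le> k" unfolding l_def by (rule Least_le) (rule as(2))
    ultimately show ?thesis using rball_sub[OF T(1)] k by force
  qed
  ultimately show ?thesis by blast
qed

lemma finite_large_summands:
  fixes w :: "'a \<Rightarrow> real"
  assumes "w summable_on T" "\<epsilon> > 0" "\<And>x. x \<in> T \<Longrightarrow> 0 \<le> w x"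
  shows "finite {x\<in>T. \<epsilon> \<le> w x}"
proof -
  obtain F where F: "finite F" "F \<subseteq> T" "infsum w (T - F) \<le> \<epsilon> / 2"
    using summable_tail[OF assms(1), of "\<epsilon> / 2"] assms(2) by auto
  have "{x\<in>T. \<epsilon> \<le> w x} \<subseteq> F"
  proof
    fix x assume x: "x \<in> {x\<in>T. \<epsilon> \<le> w x}"
    show "x \<in> F"
    proof (rule ccontr)
      assume "x \<notin> F"
      have "w summable_on (T - F)" using summable_on_subset_banach[OF assms(1)] by blast
      hence "sum w {x} \<le> infsum w (T - F)" using x \<open>x \<notin> F\<close> assms(3) by (intro finite_sum_le_infsum) auto
      thus False using x F(3) assms(2) by simp
    qed
  qed
  thus ?thesis using F(1) finite_subset by blast
qed

section \<open>Thin sets and the density of good vectors\<close>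

text \<open>The hypotheses of \<open>good_line\<close> on \<open>T\<close>, stated without reference to a group so that they also apply to the transposed
matrices and hence to covectors.\<close>

definition thin :: "nat \<Rightarrow> int mat set \<Rightarrow> bool" where
  "thin n T \<longleftrightarrow> (\<forall>\<tau>\<in>T. is_sq n \<tau> \<and> 1 \<le> nm \<tau>) \<and> wd summable_on T \<and>
    (\<exists>l C. 0 \<le> C \<and> (\<forall>N. finite {\<tau>\<in>T. l \<tau> \<le> (N::nat)}) \<and>
      (\<forall>\<tau>\<in>T. 0 < l \<tau> \<longrightarrow> (\<exists>\<sigma>\<in>T. \<exists>a. l \<sigma> < l \<tau> \<and> \<tau> = a * \<sigma> \<and>
        dim_row a = n \<and> dim_col a = n \<and> nm a \<le> C \<and> n2 \<sigma> \<le> C * n2 \<tau>)))"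

lemma thin_line:
  assumes T: "thin n T" and n: "n > 0" and y: "is_col n y" "good T y" and x: "is_col n x" and e: "\<epsilon> > 0"
  shows "\<exists>a b. b > 0 \<and> \<bar>real_of_int a\<bar> \<le> \<epsilon> * real_of_int b \<and> good T (b \<cdot>\<^sub>m x + a \<cdot>\<^sub>m y)"
proof -
  from T obtain l C where l: "0 \<le> C" "\<forall>N. finite {\<tau>\<in>T. l \<tau> \<le> (N::nat)}"
      "\<forall>\<tau>\<in>T. 0 < l \<tau> \<longrightarrow> (\<exists>\<sigma>\<in>T. \<exists>a. l \<sigma> < l \<tau> \<and> \<tau> = a * \<sigma> \<and>
        dim_row a = n \<and> dim_col a = n \<and> nm a \<le> C \<and> n2 \<sigma> \<le> C * n2 \<tau>)"
    unfolding thin_def by blast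
  show ?thesis
  proof (rule good_line[where n = n and l = l and C = C])
    show "dim_row \<tau> = n \<and> dim_col \<tau> = n \<and> 1 \<le> nm \<tau>" if "\<tau> \<in> T" for \<tau> using T that unfolding thin_def by blast
    show "wd summable_on T" using T unfolding thin_def by blast
    show "\<exists>\<sigma>\<in>T. \<exists>a. l \<sigma> < l \<tau> \<and> \<tau> = a * \<sigma> \<and> dim_row a = n \<and> dim_col a = n \<and> nm a \<le> C \<and> n2 \<sigma> \<le> C * n2 \<tau>"
      if "\<tau> \<in> T" "0 < l \<tau>" for \<tau> using l(3) that by blast
  qed (use l n y x e in auto)
qed

lemma mult_scaled_add:
  assumes "dim_col A = dim_col B" "dim_col M = dim_row A" "dim_col M = dim_row B"
  shows "M * (k \<cdot>\<^sub>m A + B) = k \<cdot>\<^sub>m (M * A) + (M * B :: int mat)"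
  using assms
  by (intro eq_matI) (auto simp: index_mult_sum sum_distrib_left sum.distrib[symmetric] algebra_simps simp del: index_mult_mat(1))

lemma good_open:
  assumes S: "\<And>\<sigma>. \<sigma> \<in> S \<Longrightarrow> is_sq n \<sigma>" and z: "is_col n z" "good S z"
  shows "\<exists>\<delta>>0. \<forall>b u. b > 0 \<and> is_col n u \<and> nm u \<le> \<delta> * real_of_int b \<longrightarrow> good S (b \<cdot>\<^sub>m z + u)"
proof -
  obtain c where c: "c > 0" "\<And>\<sigma>. \<sigma> \<in> S \<Longrightarrow> c * nm \<sigma> \<le> nm (\<sigma> * z)" using z unfolding good_def by blast
  show ?thesis
  proof (intro exI[of _ "c / 2"] conjI allI impI)
    show "c / 2 > 0" using c by simp
  next
    fix b u assume u: "b > 0 \<and> is_col n u \<and> nm u \<le> c / 2 * real_of_int b"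
    show "good S (b \<cdot>\<^sub>m z + u)" unfolding good_def
    proof (intro exI[of _ "real_of_int b * (c / 2)"] conjI ballI)
      show "real_of_int b * (c / 2) > 0" using c u by simp
    next
      fix \<sigma> assume s: "\<sigma> \<in> S"
      have eq: "\<sigma> * (b \<cdot>\<^sub>m z + u) = b \<cdot>\<^sub>m (\<sigma> * z) + \<sigma> * u" using S[OF s] z u by (intro mult_scaled_add) auto
      have "nm (b \<cdot>\<^sub>m (\<sigma> * z)) - nm (\<sigma> * u) \<le> nm (\<sigma> * (b \<cdot>\<^sub>m z + u))"
        unfolding eq using S[OF s] z u by (intro nm_add_ge) auto
      moreover have "real_of_int b * (c * nm \<sigma>) \<le> nm (b \<cdot>\<^sub>m (\<sigma> * z))"
        unfolding nm_smult using u c(1) c(2)[OF s] by (intro mult_mono mult_nonneg_nonneg) auto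
      moreover have "nm (\<sigma> * u) \<le> nm \<sigma> * (c / 2 * real_of_int b)"
      proof -
        have "nm (\<sigma> * u) \<le> nm \<sigma> * nm u" using S[OF s] u by (intro nm_mult) auto
        also have "\<dots> \<le> nm \<sigma> * (c / 2 * real_of_int b)" using u by (intro mult_left_mono) auto
        finally show ?thesis .
      qed
      ultimately have "real_of_int b * (c * nm \<sigma>) - nm \<sigma> * (c / 2 * real_of_int b) \<le> nm (\<sigma> * (b \<cdot>\<^sub>m z + u))" by linarith
      thus "real_of_int b * (c / 2) * nm \<sigma> \<le> nm (\<sigma> * (b \<cdot>\<^sub>m z + u))" by (simp add: algebra_simps)
    qed
  qed
qed

definition rtrans :: "int mat set \<Rightarrow> int mat set \<Rightarrow> int mat set" where
  "rtrans T B = {\<tau> * q |\<tau> q. \<tau> \<in> T \<and> q \<in> B}"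

text \<open>A vector \<open>w\<close> is good for \<open>T q\<close> exactly if \<open>q w\<close> is good for \<open>T\<close>. The translates are treated one after the other: goodness for the
previous ones is preserved by small changes (\<open>good_open\<close>), and \<open>good_line\<close> offers arbitrarily small changes that make the
vector good for the next one.\<close>

lemma good_dense:
  assumes T: "thin n T" and n: "n > 0" and y: "is_col n y" "good T y"
    and B: "finite B" "\<And>q. q \<in> B \<Longrightarrow> is_sq n q \<and> (\<exists>q'. is_sq n q' \<and> q * q' = 1\<^sub>m n)"
    and x: "is_col n x" and e: "\<epsilon> > 0"
  shows "\<exists>b u. b > 0 \<and> is_col n u \<and> nm u \<le> \<epsilon> * real_of_int b \<and> good (rtrans T B) (b \<cdot>\<^sub>m x + u)"
  using B e
proof (induction B arbitrary: \<epsilon> rule: finite_induct)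
  case empty
  have "good (rtrans T {}) z" for z unfolding good_def rtrans_def by (auto intro: exI[of _ 1])
  thus ?case using empty by (intro exI[of _ 1] exI[of _ "0\<^sub>m n 1"]) (auto simp: nm_def)
next
  case (insert q B)
  have TD: "is_sq n \<tau>" "1 \<le> nm \<tau>" if "\<tau> \<in> T" for \<tau> using T that unfolding thin_def by auto
  have BD: "is_sq n r" if "r \<in> insert q B" for r using insert.prems that by blast
  have rd: "is_sq n \<sigma>" if "\<sigma> \<in> rtrans T B" for \<sigma> using that TD BD unfolding rtrans_def by auto
  obtain q' where q': "is_sq n q'" "q * q' = 1\<^sub>m n" using insert.prems by blast
  have "0 < \<epsilon> / 2" using insert.prems by simp
  then obtain b u where bu: "b > 0" "is_col n u" "nm u \<le> \<epsilon> / 2 * real_of_int b" "good (rtrans T B) (b \<cdot>\<^sub>m x + u)"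
    using insert.IH insert.prems by blast
  define z where "z = b \<cdot>\<^sub>m x + u"
  have z: "is_col n z" unfolding z_def using x bu by auto
  obtain \<delta> where \<delta>: "\<delta> > 0" "\<And>b u. b > 0 \<Longrightarrow> is_col n u \<Longrightarrow> nm u \<le> \<delta> * real_of_int b \<Longrightarrow> good (rtrans T B) (b \<cdot>\<^sub>m z + u)"
    using good_open[of "rtrans T B" n z] rd z bu(4) unfolding z_def by blast
  define M where "M = nm (q' * y) + 1"
  have M: "M > 0" unfolding M_def by (simp add: add_nonneg_pos)
  define \<epsilon>' where "\<epsilon>' = min \<delta> (\<epsilon> / 2) / M"
  have e': "\<epsilon>' > 0" unfolding \<epsilon>'_def using \<delta> insert.prems M by auto
  have "is_col n (q * z)" using z BD[of q] by auto
  then obtain a d where ad: "d > 0" "\<bar>real_of_int a\<bar> \<le> \<epsilon>' * real_of_int d" "good T (d \<cdot>\<^sub>m (q * z) + a \<cdot>\<^sub>m y)"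
    using thin_line[OF T n y _ e'] by blast
  define w where "w = a \<cdot>\<^sub>m (q' * y)"
  have w: "is_col n w" unfolding w_def using q' y by auto
  have nw: "nm w \<le> min \<delta> (\<epsilon> / 2) * real_of_int d"
  proof -
    have "nm w \<le> \<bar>real_of_int a\<bar> * M" unfolding w_def nm_smult M_def by (intro mult_left_mono) auto
    also have "\<dots> \<le> \<epsilon>' * real_of_int d * M" using ad M by (intro mult_right_mono) auto
    also have "\<dots> = min \<delta> (\<epsilon> / 2) * real_of_int d" unfolding \<epsilon>'_def using M by simp
    finally show ?thesis .
  qed
  have mn: "min \<delta> (\<epsilon> / 2) * real_of_int d \<le> \<delta> * real_of_int d" "min \<delta> (\<epsilon> / 2) * real_of_int d \<le> \<epsilon> / 2 * real_of_int d"
    using ad(1) by (auto intro!: mult_right_mono)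
  have g1: "good (rtrans T B) (d \<cdot>\<^sub>m z + w)" using \<delta>(2)[OF ad(1) w] nw mn by simp
  have g2: "good T (q * (d \<cdot>\<^sub>m z + w))"
  proof -
    have "q * w = a \<cdot>\<^sub>m (q * (q' * y))" unfolding w_def using BD[of q] q' y mult_scaled_add[of "q' * y" "0\<^sub>m n 1" q a]
      by (intro eq_matI) (auto simp: index_mult_sum sum_distrib_left mult_ac simp del: index_mult_mat(1))
    also have "q * (q' * y) = y" using mat_assoc[of q q' y] q' BD[of q] y by simp
    finally have "q * (d \<cdot>\<^sub>m z + w) = d \<cdot>\<^sub>m (q * z) + a \<cdot>\<^sub>m y"
      using mult_scaled_add[of z w q d] z w BD[of q] by simp
    thus ?thesis using ad(3) by simp
  qed
  have zz: "d \<cdot>\<^sub>m z + w = (d * b) \<cdot>\<^sub>m x + (d \<cdot>\<^sub>m u + w)"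
    unfolding z_def using x bu w by (intro eq_matI) (auto simp: algebra_simps)
  obtain c1 where c1: "c1 > 0" "\<And>\<sigma>. \<sigma> \<in> rtrans T B \<Longrightarrow> c1 * nm \<sigma> \<le> nm (\<sigma> * (d \<cdot>\<^sub>m z + w))" using g1 unfolding good_def by blast
  obtain c2 where c2: "c2 > 0" "\<And>\<tau>. \<tau> \<in> T \<Longrightarrow> c2 * nm \<tau> \<le> nm (\<tau> * (q * (d \<cdot>\<^sub>m z + w)))" using g2 unfolding good_def by blast
  define N where "N = nm q + 1"
  have N: "N > 0" unfolding N_def by (simp add: add_nonneg_pos)
  have "good (rtrans T (insert q B)) (d \<cdot>\<^sub>m z + w)" unfolding good_def
  proof (intro exI[of _ "min c1 (c2 / N)"] conjI ballI)
    show "min c1 (c2 / N) > 0" using c1 c2 N by simp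
  next
    fix \<sigma> assume "\<sigma> \<in> rtrans T (insert q B)"
    then obtain \<tau> r where tr: "\<tau> \<in> T" "r \<in> insert q B" "\<sigma> = \<tau> * r" unfolding rtrans_def by blast
    show "min c1 (c2 / N) * nm \<sigma> \<le> nm (\<sigma> * (d \<cdot>\<^sub>m z + w))"
    proof (cases "r = q")
      case False
      hence "\<sigma> \<in> rtrans T B" using tr unfolding rtrans_def by blast
      hence "c1 * nm \<sigma> \<le> nm (\<sigma> * (d \<cdot>\<^sub>m z + w))" by (rule c1)
      moreover have "min c1 (c2 / N) * nm \<sigma> \<le> c1 * nm \<sigma>" by (intro mult_right_mono) auto
      ultimately show ?thesis by linarith
    next
      case True
      have a: "\<sigma> * (d \<cdot>\<^sub>m z + w) = \<tau> * (q * (d \<cdot>\<^sub>m z + w))"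
        unfolding tr True using TD[OF tr(1)] BD[of q] z w by (intro mat_assoc) auto
      have "nm \<sigma> \<le> nm \<tau> * nm q" unfolding tr True using TD[OF tr(1)] BD[of q] by (intro nm_mult) auto
      also have "\<dots> \<le> nm \<tau> * N" unfolding N_def by (intro mult_left_mono) auto
      finally have ns: "nm \<sigma> \<le> nm \<tau> * N" .
      have "min c1 (c2 / N) * nm \<sigma> \<le> c2 / N * nm \<sigma>" by (intro mult_right_mono) auto
      also have "\<dots> \<le> c2 / N * (nm \<tau> * N)" using ns c2 N by (intro mult_left_mono) auto
      also have "\<dots> = c2 * nm \<tau>" using N by simp
      also have "\<dots> \<le> nm (\<sigma> * (d \<cdot>\<^sub>m z + w))" unfolding a by (rule c2(2)[OF tr(1)])
      finally show ?thesis .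
    qed
  qed
  moreover have "nm (d \<cdot>\<^sub>m u + w) \<le> \<epsilon> * real_of_int (d * b)"
  proof -
    have "nm (d \<cdot>\<^sub>m u + w) \<le> nm (d \<cdot>\<^sub>m u) + nm w" using bu w by (intro nm_add) auto
    also have "nm (d \<cdot>\<^sub>m u) \<le> real_of_int d * (\<epsilon> / 2 * real_of_int b)"
      unfolding nm_smult using ad(1) bu(3) by (intro mult_mono) auto
    also have "nm w \<le> \<epsilon> / 2 * (real_of_int d * real_of_int b)"
    proof -
      have "\<epsilon> / 2 * (real_of_int d * 1) \<le> \<epsilon> / 2 * (real_of_int d * real_of_int b)"
        using ad(1) bu(1) insert.prems by (intro mult_left_mono) auto
      thus ?thesis using nw mn by simp
    qed
    finally show ?thesis by (simp add: algebra_simps)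
  qed
  moreover have "is_col n (d \<cdot>\<^sub>m u + w)" "0 < d * b" using bu w ad by auto
  ultimately show ?case unfolding zz by blast
qed

lemma SL_thin:
  assumes n: "n > 0" and T: "T \<subseteq> SL n" "1\<^sub>m n \<in> T" "wd summable_on T"
    and L: "finite L" "L \<subseteq> SL n" "T \<subseteq> reach n L T"
  shows "thin n T"
proof -
  obtain l where l: "\<forall>N. finite {\<tau>\<in>T. l \<tau> \<le> (N::nat)}"
      "\<forall>\<tau>\<in>T. 0 < l \<tau> \<longrightarrow> (\<exists>\<sigma>\<in>T. \<exists>a\<in>L. l \<sigma> < l \<tau> \<and> \<tau> = a * \<sigma>)"
    using reach_length[OF L(1) T(2) L(3)] by blast
  define C where "C = (\<Sum>a\<in>L. nm a + n2 (iv n a))"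
  have C: "nm a \<le> C" "n2 (iv n a) \<le> C" if "a \<in> L" for a
  proof -
    have "nm a + n2 (iv n a) \<le> C" unfolding C_def using that L(1)
      by (intro member_le_sum[where f = "\<lambda>a. nm a + n2 (iv n a)"]) auto
    thus "nm a \<le> C" "n2 (iv n a) \<le> C" using nm_nonneg[of a] n2_nonneg[of "iv n a"] by linarith+
  qed
  have "\<exists>\<sigma>\<in>T. \<exists>a. l \<sigma> < l \<tau> \<and> \<tau> = a * \<sigma> \<and> dim_row a = n \<and> dim_col a = n \<and> nm a \<le> C \<and> n2 \<sigma> \<le> C * n2 \<tau>"
    if t: "\<tau> \<in> T" "0 < l \<tau>" for \<tau>
  proof -
    obtain \<sigma> a where s: "\<sigma> \<in> T" "a \<in> L" "l \<sigma> < l \<tau>" "\<tau> = a * \<sigma>" using l(2) t by blast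
    have aS: "a \<in> SL n" "\<sigma> \<in> SL n" using s T L by auto
    have "\<sigma> = iv n a * \<tau>" unfolding s(4) using aS by simp
    hence "n2 \<sigma> \<le> n2 (iv n a) * n2 \<tau>" using n2_mult[of "iv n a" \<tau>] aS s(4) by simp
    also have "\<dots> \<le> C * n2 \<tau>" using C(2)[OF s(2)] by (intro mult_right_mono) auto
    finally show ?thesis using s aS C(1)[OF s(2)] by (intro bexI[OF _ s(1)] exI[of _ a]) auto
  qed
  moreover have "0 \<le> C" unfolding C_def by (intro sum_nonneg add_nonneg_nonneg) auto
  moreover have "\<forall>\<tau>\<in>T. is_sq n \<tau> \<and> 1 \<le> nm \<tau>" using T(1) SL_nm_ge_1[OF _ n] by auto
  ultimately show ?thesis unfolding thin_def using T(3) l(1) by blast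
qed

text \<open>Transposition turns left multiplication into right multiplication. As \<open>T\<close> is closed under inverses, a chain for the inverse
of \<open>\<tau>\<close> yields a chain of right multiplications for \<open>\<tau>\<close>.\<close>

lemma SL_thin_transpose:
  assumes n: "n > 0" and T: "T \<subseteq> SL n" "1\<^sub>m n \<in> T" "wd summable_on T" "\<And>\<tau>. \<tau> \<in> T \<Longrightarrow> iv n \<tau> \<in> T"
    and L: "finite L" "L \<subseteq> SL n" "T \<subseteq> reach n L T"
  shows "thin n (transpose_mat ` T)"
proof -
  obtain l where l: "\<forall>N. finite {\<tau>\<in>T. l \<tau> \<le> (N::nat)}"
      "\<forall>\<tau>\<in>T. 0 < l \<tau> \<longrightarrow> (\<exists>\<sigma>\<in>T. \<exists>a\<in>L. l \<sigma> < l \<tau> \<and> \<tau> = a * \<sigma>)"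
    using reach_length[OF L(1) T(2) L(3)] by blast
  define C where "C = (\<Sum>a\<in>L. nm (iv n a) + n2 a)"
  have C: "nm (iv n a) \<le> C" "n2 a \<le> C" if "a \<in> L" for a
  proof -
    have "nm (iv n a) + n2 a \<le> C" unfolding C_def using that L(1)
      by (intro member_le_sum[where f = "\<lambda>a. nm (iv n a) + n2 a"]) auto
    thus "nm (iv n a) \<le> C" "n2 a \<le> C" using nm_nonneg[of "iv n a"] n2_nonneg[of a] by linarith+
  qed
  define l' where "l' = (\<lambda>A. l (iv n (transpose_mat A)))"
  have fin: "finite {A \<in> transpose_mat ` T. l' A \<le> N}" for N
  proof (rule finite_subset)
    show "{A \<in> transpose_mat ` T. l' A \<le> N} \<subseteq> (\<lambda>\<tau>. transpose_mat (iv n \<tau>)) ` {\<tau>\<in>T. l \<tau> \<le> N}"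
    proof
      fix A assume "A \<in> {A \<in> transpose_mat ` T. l' A \<le> N}"
      then obtain \<tau> where t: "\<tau> \<in> T" "A = transpose_mat \<tau>" "l (iv n \<tau>) \<le> N" unfolding l'_def by auto
      have "A = transpose_mat (iv n (iv n \<tau>))" using t T(1) by auto
      thus "A \<in> (\<lambda>\<tau>. transpose_mat (iv n \<tau>)) ` {\<tau>\<in>T. l \<tau> \<le> N}" using t T(4) by blast
    qed
  qed (use l(1) in auto)
  have lk: "\<exists>\<sigma>\<in>transpose_mat ` T. \<exists>a. l' \<sigma> < l' A \<and> A = a * \<sigma> \<and> dim_row a = n \<and> dim_col a = n \<and> nm a \<le> C \<and> n2 \<sigma> \<le> C * n2 A"
    if t: "A \<in> transpose_mat ` T" "0 < l' A" for A
  proof -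
    obtain \<tau> where tau: "\<tau> \<in> T" "A = transpose_mat \<tau>" using t by blast
    have "0 < l (iv n \<tau>)" using t(2) tau unfolding l'_def by simp
    then obtain \<sigma> a where s: "\<sigma> \<in> T" "a \<in> L" "l \<sigma> < l (iv n \<tau>)" "iv n \<tau> = a * \<sigma>" using l(2) T(4)[OF tau(1)] by blast
    have aS: "a \<in> SL n" "\<sigma> \<in> SL n" "\<tau> \<in> SL n" using s T L tau by auto
    have "\<tau> = iv n (a * \<sigma>)" using s(4) aS by (metis iv_iv)
    hence te: "\<tau> = iv n \<sigma> * iv n a" using iv_mult aS by metis
    have A: "A = transpose_mat (iv n a) * transpose_mat (iv n \<sigma>)"
      unfolding tau te using aS by (intro transpose_mult[of _ n n _ n]) (auto intro!: carrier_matI)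
    have "iv n \<sigma> = \<tau> * a" unfolding te using aS SL_assoc[of "iv n \<sigma>" n "iv n a" a] by simp
    hence "n2 (iv n \<sigma>) \<le> n2 \<tau> * n2 a" using n2_mult[of \<tau> a] aS by simp
    also have "\<dots> \<le> C * n2 \<tau>" using C(2)[OF s(2)] by (subst mult.commute) (intro mult_right_mono, auto)
    finally have n2: "n2 (transpose_mat (iv n \<sigma>)) \<le> C * n2 A" unfolding tau by simp
    have "l' (transpose_mat (iv n \<sigma>)) < l' A" unfolding l'_def tau using s(3) aS by simp
    moreover have "transpose_mat (iv n \<sigma>) \<in> transpose_mat ` T" using T(4) s(1) by blast
    ultimately show ?thesis using A n2 C(1)[OF s(2)] aS
      by (intro bexI[of _ "transpose_mat (iv n \<sigma>)"] exI[of _ "transpose_mat (iv n a)"]) auto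
  qed
  have "0 \<le> C" unfolding C_def by (intro sum_nonneg add_nonneg_nonneg) auto
  moreover have "\<forall>\<tau>\<in>transpose_mat ` T. is_sq n \<tau> \<and> 1 \<le> nm \<tau>" using T(1) SL_nm_ge_1[OF _ n] by auto
  moreover have "wd summable_on (transpose_mat ` T)"
  proof -
    have "inj_on transpose_mat T" by (intro inj_onI) (metis Matrix.transpose_transpose)
    moreover have "(wd \<circ> transpose_mat) = wd" by (intro ext) simp
    ultimately show ?thesis using summable_on_reindex[of transpose_mat T wd] T(3) by simp
  qed
  ultimately show ?thesis unfolding thin_def using fin lk by blast
qed

section \<open>Transvections in general position\<close>

text \<open>This is \<open>generic_incident_pair\<close> for the set \<open>S\<close> of all \<open>r \<tau> q\<close>: multiplication with the finitely many \<open>r\<close> and \<open>q\<close> changes norms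
and minors by bounded factors, good vectors for \<open>S\<close> are dense by \<open>good_dense\<close>, and the same lemma for the transposed matrices
gives one good covector. Central elements annihilate all incident pairs and have to be excluded.\<close>

lemma generic_transvection:
  assumes n: "n \<ge> 2" and T: "T \<subseteq> SL n" "1\<^sub>m n \<in> T" "wd summable_on T" "\<And>\<tau>. \<tau> \<in> T \<Longrightarrow> iv n \<tau> \<in> T"
    and L: "finite L" "L \<subseteq> SL n" "T \<subseteq> reach n L T"
    and y: "is_col n y" "good T y" and z: "is_row n z" "cogood T z"
    and A: "finite A" "A \<subseteq> SL n" and B: "finite B" "B \<subseteq> SL n"
  shows "\<exists>v f c. is_col n v \<and> is_row n f \<and> dotm n f v = 0 \<and> c > 0 \<and>
    (\<forall>r\<in>A. \<forall>q\<in>B. \<forall>\<tau>\<in>T. r * \<tau> * q \<notin> ZZ n \<longrightarrow> c * nm \<tau> \<le> nm (f * (r * \<tau> * q) * v))"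
proof -
  have n0: "n > 0" using n by simp
  have TD: "\<tau> \<in> SL n" if "\<tau> \<in> T" for \<tau> using that T by auto
  have AD: "r \<in> SL n" if "r \<in> A" for r using that A by auto
  have BD: "r \<in> SL n" if "r \<in> B" for r using that B by auto
  define S where "S = {r * \<tau> * q |r \<tau> q. r \<in> A \<and> \<tau> \<in> T \<and> q \<in> B}"
  have SD: "\<sigma> \<in> SL n" if "\<sigma> \<in> S" for \<sigma> using that TD AD BD unfolding S_def by auto
  define M where "M = 1 + (\<Sum>r\<in>A. nm r + nm (iv n r) + n2 r) + (\<Sum>r\<in>B. nm r + nm (iv n r) + n2 r)"
  have MA: "nm r \<le> M" "nm (iv n r) \<le> M" "n2 r \<le> M" if "r \<in> A" for r
  proof -
    have "nm r + nm (iv n r) + n2 r \<le> (\<Sum>r\<in>A. nm r + nm (iv n r) + n2 r)" using that A(1)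
      by (intro member_le_sum[where f = "\<lambda>r. nm r + nm (iv n r) + n2 r"]) auto
    moreover have "0 \<le> (\<Sum>r\<in>B. nm r + nm (iv n r) + n2 r)" by (intro sum_nonneg add_nonneg_nonneg) auto
    ultimately show "nm r \<le> M" "nm (iv n r) \<le> M" "n2 r \<le> M" unfolding M_def
      using nm_nonneg[of r] nm_nonneg[of "iv n r"] n2_nonneg[of r] by linarith+
  qed
  have MB: "nm r \<le> M" "nm (iv n r) \<le> M" "n2 r \<le> M" if "r \<in> B" for r
  proof -
    have "nm r + nm (iv n r) + n2 r \<le> (\<Sum>r\<in>B. nm r + nm (iv n r) + n2 r)" using that B(1)
      by (intro member_le_sum[where f = "\<lambda>r. nm r + nm (iv n r) + n2 r"]) auto
    moreover have "0 \<le> (\<Sum>r\<in>A. nm r + nm (iv n r) + n2 r)" by (intro sum_nonneg add_nonneg_nonneg) auto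
    ultimately show "nm r \<le> M" "nm (iv n r) \<le> M" "n2 r \<le> M" unfolding M_def
      using nm_nonneg[of r] nm_nonneg[of "iv n r"] n2_nonneg[of r] by linarith+
  qed
  have M1: "M \<ge> 1" unfolding M_def by (simp add: sum_nonneg)
  have nlow: "nm \<tau> \<le> M * nm (r * \<tau> * q) * M" if "r \<in> A" "\<tau> \<in> T" "q \<in> B" for r \<tau> q
  proof -
    have d: "r \<in> SL n" "\<tau> \<in> SL n" "q \<in> SL n" using that AD TD BD by auto
    have "nm \<tau> \<le> nm (iv n r) * nm (r * \<tau>)" using d by (intro nm_cancel_l) auto
    also have "\<dots> \<le> M * nm (r * \<tau>)" using MA(2)[OF that(1)] by (intro mult_right_mono) auto
    also have "nm (r * \<tau>) \<le> nm (r * \<tau> * q) * nm (iv n q)" using d by (intro nm_cancel_r) auto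
    also have "\<dots> \<le> nm (r * \<tau> * q) * M" using MB(2)[OF that(3)] by (intro mult_left_mono) auto
    finally show ?thesis using M1 by (simp add: mult_ac)
  qed
  have thin0: "finite {\<sigma>\<in>S. w \<le> wd \<sigma>}" if w: "w > 0" for w
  proof -
    define w' where "w' = w / (M ^ 6)"
    have w': "w' > 0" unfolding w'_def using w M1 by simp
    have fin: "finite {\<tau>\<in>T. w' \<le> wd \<tau>}" using finite_large_summands[OF T(3) w'] by simp
    have "{\<sigma>\<in>S. w \<le> wd \<sigma>} \<subseteq> (\<lambda>(r,\<tau>,q). r * \<tau> * q) ` (A \<times> {\<tau>\<in>T. w' \<le> wd \<tau>} \<times> B)"
    proof
      fix \<sigma> assume "\<sigma> \<in> {\<sigma>\<in>S. w \<le> wd \<sigma>}"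
      then obtain r \<tau> q where s: "r \<in> A" "\<tau> \<in> T" "q \<in> B" "\<sigma> = r * \<tau> * q" "w \<le> wd \<sigma>" unfolding S_def by blast
      have d: "r \<in> SL n" "\<tau> \<in> SL n" "q \<in> SL n" using s AD TD BD by auto
      have ns: "0 < nm \<sigma>" "0 < nm \<tau>" using SL_nm_ge_1[OF _ n0, of "r * \<tau> * q"] SL_nm_ge_1[OF d(2) n0] d s(4) by auto
      have "n2 \<sigma> \<le> n2 (r * \<tau>) * n2 q" unfolding s using d by (intro n2_mult) auto
      also have "\<dots> \<le> (n2 r * n2 \<tau>) * n2 q" using d by (intro mult_right_mono n2_mult) auto
      also have "\<dots> \<le> (M * n2 \<tau>) * M" using MA[OF s(1)] MB[OF s(3)] M1 by (intro mult_mono mult_right_mono) auto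
      finally have a: "n2 \<sigma> \<le> M^2 * n2 \<tau>" by (simp add: power2_eq_square mult_ac)
      have b: "nm \<tau> \<le> M^2 * nm \<sigma>" using nlow[OF s(1-3)] unfolding s(4) by (simp add: power2_eq_square mult_ac)
      have "(nm \<tau>)^2 \<le> (M^2 * nm \<sigma>)^2" using b ns by (intro power_mono) auto
      also have "\<dots> = M^4 * (nm \<sigma>)^2" by (simp add: power_mult_distrib flip: power_mult)
      finally have b2: "(nm \<tau>)^2 \<le> M^4 * (nm \<sigma>)^2" .
      have "w * (nm \<sigma>)^2 \<le> n2 \<sigma>" using s(5) ns unfolding wd_def by (simp add: field_simps)
      hence "w * (nm \<sigma>)^2 \<le> M^2 * n2 \<tau>" using a by linarith
      hence "M^4 * (w * (nm \<sigma>)^2) \<le> M^4 * (M^2 * n2 \<tau>)" using M1 by (intro mult_left_mono) auto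
      hence "w * (M^4 * (nm \<sigma>)^2) \<le> M^6 * n2 \<tau>" by (simp add: mult_ac flip: power_add)
      moreover have "w * (nm \<tau>)^2 \<le> w * (M^4 * (nm \<sigma>)^2)" using b2 w by (intro mult_left_mono) auto
      ultimately have "w * (nm \<tau>)^2 \<le> M^6 * n2 \<tau>" by linarith
      hence "w' \<le> wd \<tau>" unfolding w'_def wd_def using ns M1 by (simp add: field_simps)
      thus "\<sigma> \<in> (\<lambda>(r,\<tau>,q). r * \<tau> * q) ` (A \<times> {\<tau>\<in>T. w' \<le> wd \<tau>} \<times> B)" using s by force
    qed
    thus ?thesis using fin A(1) B(1) finite_subset by blast
  qed
  have Binv: "is_sq n q \<and> (\<exists>q'. is_sq n q' \<and> q * q' = 1\<^sub>m n)" if "q \<in> B" for q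
    using BD[OF that] by (intro conjI exI[of _ "iv n q"]) auto
  have goodS: "good S v" if v: "is_col n v" "good (rtrans T B) v" for v
  proof -
    obtain c where c: "c > 0" "\<And>\<sigma>. \<sigma> \<in> rtrans T B \<Longrightarrow> c * nm \<sigma> \<le> nm (\<sigma> * v)" using v unfolding good_def by blast
    show ?thesis unfolding good_def
    proof (intro exI[of _ "c / M^2"] conjI ballI)
      show "c / M^2 > 0" using c M1 by simp
    next
      fix \<sigma> assume "\<sigma> \<in> S"
      then obtain r \<tau> q where s: "r \<in> A" "\<tau> \<in> T" "q \<in> B" "\<sigma> = r * \<tau> * q" unfolding S_def by blast
      have d: "r \<in> SL n" "\<tau> \<in> SL n" "q \<in> SL n" using s AD TD BD by auto
      have e: "\<sigma> = r * (\<tau> * q)" unfolding s using d by (intro SL_assoc)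
      have "c * nm (\<tau> * q) \<le> nm (\<tau> * q * v)" using s by (intro c) (auto simp: rtrans_def)
      also have "\<dots> \<le> nm (iv n r) * nm (r * (\<tau> * q * v))" using d by (intro nm_cancel_l) auto
      also have "\<dots> \<le> M * nm (r * (\<tau> * q * v))" using MA[OF s(1)] by (intro mult_right_mono) auto
      also have "r * (\<tau> * q * v) = \<sigma> * v" unfolding e using d v by (intro mat_assoc[symmetric]) auto
      finally have 1: "c * nm (\<tau> * q) \<le> M * nm (\<sigma> * v)" .
      have "nm \<sigma> \<le> nm r * nm (\<tau> * q)" unfolding e using d by (intro nm_mult) auto
      also have "\<dots> \<le> M * nm (\<tau> * q)" using MA[OF s(1)] by (intro mult_right_mono) auto
      finally have "c * nm \<sigma> \<le> c * (M * nm (\<tau> * q))" using c by (intro mult_left_mono) auto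
      also have "\<dots> = M * (c * nm (\<tau> * q))" by simp
      also have "\<dots> \<le> M * (M * nm (\<sigma> * v))" using 1 M1 by (intro mult_left_mono) auto
      finally show "c / M^2 * nm \<sigma> \<le> nm (\<sigma> * v)" using M1 by (simp add: field_simps power2_eq_square)
    qed
  qed
  have dense: "\<exists>b u. b > 0 \<and> is_col n u \<and> nm u \<le> \<epsilon> * real_of_int b \<and> good S (b \<cdot>\<^sub>m x + u)"
    if xe: "is_col n x" "\<epsilon> > 0" for x \<epsilon>
  proof -
    obtain b u where bu: "b > 0" "is_col n u" "nm u \<le> \<epsilon> * real_of_int b" "good (rtrans T B) (b \<cdot>\<^sub>m x + u)"
      using good_dense[OF SL_thin[OF n0 T(1-3) L] n0 y B(1) Binv xe] by blast
    moreover have "good S (b \<cdot>\<^sub>m x + u)" using bu xe by (intro goodS) auto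
    ultimately show ?thesis by blast
  qed
  obtain f1 where f1: "is_row n f1" "cogood S f1"
  proof -
    have zt: "good (transpose_mat ` T) (transpose_mat z)"
    proof -
      obtain c where c: "c > 0" "\<And>\<tau>. \<tau> \<in> T \<Longrightarrow> c * nm \<tau> \<le> nm (z * \<tau>)" using z unfolding cogood_def by blast
      show ?thesis unfolding good_def
      proof (intro exI[of _ c] conjI ballI)
        fix \<sigma> assume "\<sigma> \<in> transpose_mat ` T"
        then obtain \<tau> where t: "\<tau> \<in> T" "\<sigma> = transpose_mat \<tau>" by blast
        have "transpose_mat \<tau> * transpose_mat z = transpose_mat (z * \<tau>)"
          using TD[OF t(1)] z by (intro transpose_mult[of _ 1 n _ n, symmetric]) (auto intro!: carrier_matI)
        thus "c * nm \<sigma> \<le> nm (\<sigma> * transpose_mat z)" using c(2)[OF t(1)] t(2) by simp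
      qed (use c in auto)
    qed
    have Ainv: "is_sq n q \<and> (\<exists>q'. is_sq n q' \<and> q * q' = 1\<^sub>m n)" if qA: "q \<in> transpose_mat ` A" for q
    proof -
      obtain r where r: "r \<in> A" "q = transpose_mat r" using qA by blast
      have "transpose_mat r * transpose_mat (iv n r) = transpose_mat (iv n r * r)"
        using AD[OF r(1)] by (intro transpose_mult[of _ n n _ n, symmetric]) (auto intro!: carrier_matI)
      also have "\<dots> = 1\<^sub>m n" using AD[OF r(1)] by simp
      finally show ?thesis using AD[OF r(1)] r(2) by (intro conjI exI[of _ "transpose_mat (iv n r)"]) auto
    qed
    have "\<exists>b u. b > 0 \<and> is_col n u \<and> nm u \<le> 1 * real_of_int b \<and>
        good (rtrans (transpose_mat ` T) (transpose_mat ` A)) (b \<cdot>\<^sub>m transpose_mat z + u)"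
      by (rule good_dense[OF SL_thin_transpose[OF n0 T L] n0 _ zt _ Ainv]) (use z A(1) in auto)
    then obtain b u where bu: "is_col n u" "good (rtrans (transpose_mat ` T) (transpose_mat ` A)) (b \<cdot>\<^sub>m transpose_mat z + u)" by blast
    define x where "x = b \<cdot>\<^sub>m transpose_mat z + u"
    have x: "is_col n x" "good (rtrans (transpose_mat ` T) (transpose_mat ` A)) x" unfolding x_def using bu by auto
    obtain c where c: "c > 0" "\<And>\<sigma>. \<sigma> \<in> rtrans (transpose_mat ` T) (transpose_mat ` A) \<Longrightarrow> c * nm \<sigma> \<le> nm (\<sigma> * x)"
      using x unfolding good_def by blast
    define f1 where "f1 = transpose_mat x"
    have f1: "is_row n f1" unfolding f1_def using x by simp
    have "cogood S f1" unfolding cogood_def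
    proof (intro exI[of _ "c / M^2"] conjI ballI)
      show "c / M^2 > 0" using c M1 by simp
    next
      fix \<sigma> assume "\<sigma> \<in> S"
      then obtain r \<tau> q where s: "r \<in> A" "\<tau> \<in> T" "q \<in> B" "\<sigma> = r * \<tau> * q" unfolding S_def by blast
      have d: "r \<in> SL n" "\<tau> \<in> SL n" "q \<in> SL n" using s AD TD BD by auto
      have t1: "transpose_mat \<tau> * transpose_mat r = transpose_mat (r * \<tau>)"
        using d by (intro transpose_mult[of _ n n _ n, symmetric]) (auto intro!: carrier_matI)
      have t2: "transpose_mat (r * \<tau>) * x = transpose_mat (f1 * (r * \<tau>))"
        unfolding f1_def using d x by (subst transpose_mult[of _ 1 n _ n]) (auto intro!: carrier_matI)
      have "transpose_mat (r * \<tau>) \<in> rtrans (transpose_mat ` T) (transpose_mat ` A)"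
        unfolding rtrans_def t1[symmetric] using s by blast
      from c(2)[OF this] have "c * nm (r * \<tau>) \<le> nm (f1 * (r * \<tau>))" unfolding t2 by simp
      also have "\<dots> \<le> nm (f1 * (r * \<tau>) * q) * nm (iv n q)" using d f1 by (intro nm_cancel_r) auto
      also have "\<dots> \<le> nm (f1 * (r * \<tau>) * q) * M" using MB[OF s(3)] by (intro mult_left_mono) auto
      also have "f1 * (r * \<tau>) * q = f1 * \<sigma>" unfolding s using d f1 by (intro mat_assoc) auto
      finally have 1: "c * nm (r * \<tau>) \<le> nm (f1 * \<sigma>) * M" .
      have "nm \<sigma> \<le> nm (r * \<tau>) * nm q" unfolding s using d by (intro nm_mult) auto
      also have "\<dots> \<le> nm (r * \<tau>) * M" using MB[OF s(3)] by (intro mult_left_mono) auto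
      finally have "c * nm \<sigma> \<le> c * (nm (r * \<tau>) * M)" using c by (intro mult_left_mono) auto
      also have "\<dots> = (c * nm (r * \<tau>)) * M" by simp
      also have "\<dots> \<le> (nm (f1 * \<sigma>) * M) * M" using 1 M1 by (intro mult_right_mono) auto
      finally show "c / M^2 * nm \<sigma> \<le> nm (f1 * \<sigma>)" using M1 by (simp add: field_simps power2_eq_square)
    qed
    with f1 show thesis by (rule that)
  qed
  have "\<exists>v f. is_col n v \<and> is_row n f \<and> dotm n f v = 0 \<and> (\<exists>c>0. \<forall>\<sigma>\<in>S - ZZ n. c * nm \<sigma> \<le> nm (f * \<sigma> * v))"
  proof (rule generic_incident_pair[OF n _ thin0 dense f1])
    show "is_sq n \<sigma> \<and> 1 \<le> nm \<sigma>" if "\<sigma> \<in> S" for \<sigma> using SD[OF that] SL_nm_ge_1[OF SD[OF that] n0] by auto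
    show "\<exists>v f. is_col n v \<and> is_row n f \<and> dotm n f v = 0 \<and> bil n f \<sigma> v \<noteq> 0" if "\<sigma> \<in> S - ZZ n" for \<sigma>
      using that SD by (intro nonscalar_incident) auto
  qed auto
  then obtain v f c where vf: "is_col n v" "is_row n f" "dotm n f v = 0" "c > 0" "\<And>\<sigma>. \<sigma> \<in> S - ZZ n \<Longrightarrow> c * nm \<sigma> \<le> nm (f * \<sigma> * v)"
    by blast
  have "c / M^2 * nm \<tau> \<le> nm (f * (r * \<tau> * q) * v)" if s: "r \<in> A" "q \<in> B" "\<tau> \<in> T" "r * \<tau> * q \<notin> ZZ n" for r q \<tau>
  proof -
    have "c / M^2 * nm \<tau> \<le> c / M^2 * (M * nm (r * \<tau> * q) * M)"
      using nlow[OF s(1,3,2)] vf(4) M1 by (intro mult_left_mono) auto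
    also have "\<dots> = c * nm (r * \<tau> * q)" using M1 by (simp add: field_simps power2_eq_square)
    also have "\<dots> \<le> nm (f * (r * \<tau> * q) * v)" using s by (intro vf(5)) (auto simp: S_def)
    finally show ?thesis .
  qed
  moreover have "c / M^2 > 0" using vf(4) M1 by simp
  ultimately show ?thesis using vf(1-3) by blast
qed

section \<open>Sums with a common bound\<close>

text \<open>Summability of non-negative functions together with an explicit bound, which is what an induction over word length
can carry along.\<close>

definition bsum :: "('a \<Rightarrow> real) \<Rightarrow> 'a set \<Rightarrow> real \<Rightarrow> bool" where
  "bsum w A s \<longleftrightarrow> (\<forall>F. finite F \<and> F \<subseteq> A \<longrightarrow> sum w F \<le> s)"

lemma bsum_summable:
  assumes "bsum w A s" "\<And>x. x \<in> A \<Longrightarrow> 0 \<le> w x" shows "w summable_on A"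
  by (rule nonneg_bdd_above_summable_on) (use assms in \<open>auto simp: bsum_def bdd_above_def\<close>)

lemma summable_bsum:
  assumes "w summable_on A" "\<And>x. x \<in> A \<Longrightarrow> 0 \<le> w x" shows "bsum w A (infsum w A)"
  unfolding bsum_def using finite_sum_le_infsum[OF assms(1)] assms(2) by blast

lemma bsum_nonneg: "bsum w A s \<Longrightarrow> 0 \<le> s"
  unfolding bsum_def by (metis empty_subsetI finite.emptyI sum.empty)

lemma bsum_subset: "bsum w A s \<Longrightarrow> B \<subseteq> A \<Longrightarrow> bsum w B s"
  unfolding bsum_def by blast

lemma bsum_Un:
  assumes "bsum w A s" "bsum w B t"
  shows "bsum w (A \<union> B) (s + t)"
  unfolding bsum_def
proof (intro allI impI)
  fix F assume F: "finite F \<and> F \<subseteq> A \<union> B"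
  have "sum w F = sum w (F \<inter> A) + sum w (F - A)" using F by (metis sum.Int_Diff)
  also have "sum w (F \<inter> A) \<le> s" using F assms(1) unfolding bsum_def by blast
  also have "sum w (F - A) \<le> t" using F assms(2) unfolding bsum_def by blast
  finally show "sum w F \<le> s + t" by simp
qed

lemma bsum_UN:
  assumes "finite I" "\<And>i. i \<in> I \<Longrightarrow> bsum w (A i) s"
  shows "bsum w (\<Union>i\<in>I. A i) (real (card I) * s)"
  using assms
proof (induction I rule: finite_induct)
  case empty thus ?case by (simp add: bsum_def)
next
  case (insert i I)
  hence "bsum w (A i \<union> (\<Union>i\<in>I. A i)) (s + real (card I) * s)" by (intro bsum_Un) auto
  thus ?case using insert by (simp add: algebra_simps)
qed

text \<open>Each element of \<open>Q\<close> is charged to one of its factorisations \<open>h a b\<close>. Distinct elements are charged to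
distinct pairs \<open>(a,b)\<close>, so the sum over \<open>Q\<close> is dominated by a product of two sums.\<close>

lemma bsum_image_prod:
  fixes u :: "'a \<Rightarrow> real" and v :: "'b \<Rightarrow> real"
  assumes A: "bsum u A s" "\<And>x. x \<in> A \<Longrightarrow> 0 \<le> u x" and B: "bsum v B t" "\<And>x. x \<in> B \<Longrightarrow> 0 \<le> v x"
    and K: "0 \<le> K" "\<And>a b. a \<in> A \<Longrightarrow> b \<in> B \<Longrightarrow> w (h a b) \<le> K * u a * v b"
    and Q: "Q \<subseteq> {h a b |a b. a \<in> A \<and> b \<in> B}"
  shows "bsum w Q (K * s * t)"
  unfolding bsum_def
proof (intro allI impI)
  fix F assume F: "finite F \<and> F \<subseteq> Q"
  have "\<forall>x\<in>F. \<exists>ab. fst ab \<in> A \<and> snd ab \<in> B \<and> x = h (fst ab) (snd ab)" using F Q by fastforce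
  then obtain pr where pr: "\<And>x. x \<in> F \<Longrightarrow> fst (pr x) \<in> A \<and> snd (pr x) \<in> B \<and> x = h (fst (pr x)) (snd (pr x))" by metis
  let ?A = "fst ` pr ` F" and ?B = "snd ` pr ` F"
  have fin: "finite ?A" "finite ?B" "?A \<subseteq> A" "?B \<subseteq> B" using F pr by auto
  have inj: "inj_on pr F" using pr by (metis inj_onI)
  have "sum w F \<le> (\<Sum>x\<in>F. K * u (fst (pr x)) * v (snd (pr x)))"
    using pr K(2) by (intro sum_mono) metis
  also have "\<dots> = (\<Sum>ab\<in>pr ` F. K * u (fst ab) * v (snd ab))" using inj by (simp add: sum.reindex)
  also have "\<dots> \<le> (\<Sum>ab\<in>?A \<times> ?B. K * u (fst ab) * v (snd ab))"
  proof (rule sum_mono2)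
    show "finite (?A \<times> ?B)" using fin by blast
    show "pr ` F \<subseteq> ?A \<times> ?B"
    proof
      fix x assume "x \<in> pr ` F"
      hence "fst x \<in> ?A" "snd x \<in> ?B" by blast+
      thus "x \<in> ?A \<times> ?B" by (simp add: mem_Times_iff)
    qed
    fix ab assume "ab \<in> ?A \<times> ?B - pr ` F"
    hence "fst ab \<in> A" "snd ab \<in> B" using fin by auto
    thus "0 \<le> K * u (fst ab) * v (snd ab)" using K A(2) B(2) by simp
  qed
  also have "\<dots> = (\<Sum>a\<in>?A. \<Sum>b\<in>?B. K * (u a * v b))"
    by (simp only: sum.cartesian_product' fst_conv snd_conv mult.assoc)
  also have "\<dots> = K * (sum u ?A * sum v ?B)"
    unfolding sum_product[of u ?A v ?B] by (simp only: sum_distrib_left)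
  also have "\<dots> \<le> K * (s * t)"
  proof (intro mult_left_mono mult_mono)
    show "sum u ?A \<le> s" using A(1) fin unfolding bsum_def by blast
    show "sum v ?B \<le> t" using B(1) fin unfolding bsum_def by blast
    show "0 \<le> s" using bsum_nonneg[OF A(1)] .
    show "0 \<le> sum v ?B" using fin B(2) by (intro sum_nonneg) auto
  qed (rule K(1))
  finally show "sum w F \<le> K * s * t" by (simp add: mult.assoc)
qed

section \<open>Ping-pong with letters close to rank one\<close>

text \<open>These are the words \<open>\<tau>\<^sub>0 X\<^sub>j \<tau>\<^sub>1 X\<^sub>k \<tau>\<^sub>2 \<dots>\<close> ending in a spacer from \<open>T\<close> that may be followed by the letter \<open>i\<close>; the
relation \<open>ok j \<tau> i\<close> says which spacers are admissible between the letters \<open>j\<close> and \<open>i\<close>.\<close>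

inductive pre :: "int mat set \<Rightarrow> ('i \<Rightarrow> int mat) \<Rightarrow> 'i set \<Rightarrow> ('i \<Rightarrow> int mat \<Rightarrow> 'i \<Rightarrow> bool) \<Rightarrow> 'i \<Rightarrow> int mat \<Rightarrow> bool"
  for T X L ok where
  pre_base: "\<tau> \<in> T \<Longrightarrow> pre T X L ok i \<tau>"
| pre_step: "pre T X L ok j \<beta> \<Longrightarrow> j \<in> L \<Longrightarrow> \<tau> \<in> T \<Longrightarrow> ok j \<tau> i \<Longrightarrow> pre T X L ok i (\<beta> * X j * \<tau>)"

text \<open>Up to a relative error \<open>\<eta>\<close> the letter \<open>X j\<close> is the rank one matrix \<open>p j * \<phi> j\<close> multiplied by the large number \<open>\<kappa> j\<close>. The separation
condition \<open>sep\<close> says that after an admissible spacer the image \<open>p j\<close> of one letter stays away from the kernel of the preceding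
one. Vectors and covectors are also given for indices outside \<open>L\<close>; such an index can only stand at the end of a
word and serves to test it. By \<open>okl\<close> and \<open>okr\<close> every spacer is admissible next to some letter on each side, so that the \<open>p i\<close> and
the \<open>\<phi> i\<close> are good for \<open>T\<close>. The constant \<open>c3\<close> is chosen such that the estimate in \<open>pre_attract\<close> reproduces itself.\<close>

locale pingpong =
  fixes n :: nat and T :: "int mat set" and X :: "'i \<Rightarrow> int mat" and L :: "'i set"
    and ok :: "'i \<Rightarrow> int mat \<Rightarrow> 'i \<Rightarrow> bool" and p \<phi> :: "'i \<Rightarrow> int mat" and \<kappa> :: "'i \<Rightarrow> int"
    and E :: "'i \<Rightarrow> int mat" and C c \<eta> c3 :: real
  assumes Tsq: "\<tau> \<in> T \<Longrightarrow> is_sq n \<tau>"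
    and psh: "is_col n (p i)" and fsh: "is_row n (\<phi> i)"
    and pC: "nm (p i) \<le> C" and fC: "nm (\<phi> i) \<le> C" and C1: "1 \<le> C" and c0: "0 < c"
    and Xeq: "j \<in> L \<Longrightarrow> X j = \<kappa> j \<cdot>\<^sub>m (p j * \<phi> j) + E j"
    and Esq: "j \<in> L \<Longrightarrow> is_sq n (E j)" and En: "j \<in> L \<Longrightarrow> nm (E j) \<le> \<eta> * \<bar>real_of_int (\<kappa> j)\<bar>"
    and sep: "\<tau> \<in> T \<Longrightarrow> ok i \<tau> j \<Longrightarrow> c * nm \<tau> \<le> nm (\<phi> i * \<tau> * p j)"
    and okl: "\<exists>i. ok i \<tau> j" and okr: "\<exists>j. ok i \<tau> j"
    and c3: "c3 = c / (2 * (C + 1))"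
    and \<eta>: "0 \<le> \<eta>" "\<eta> \<le> c3" "2 * C * \<eta> \<le> c * c3" "2 * \<eta> \<le> c3\<^sup>2"
begin

lemma C0: "0 < C" using C1 by linarith
lemma c30: "0 < c3" unfolding c3 using c0 C1 by simp

lemma Xsq: "j \<in> L \<Longrightarrow> is_sq n (X j)"
  using Xeq Esq psh fsh by auto

lemma nm_tp: "\<tau> \<in> T \<Longrightarrow> c / C * nm \<tau> \<le> nm (\<tau> * p i)"
proof -
  assume t: "\<tau> \<in> T"
  obtain j where "ok j \<tau> i" using okl by blast
  from sep[OF t this] have "c * nm \<tau> \<le> nm (\<phi> j * \<tau> * p i)" .
  also have "\<phi> j * \<tau> * p i = \<phi> j * (\<tau> * p i)" using Tsq[OF t] fsh psh by (intro mat_assoc) auto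
  also have "nm (\<phi> j * (\<tau> * p i)) \<le> nm (\<phi> j) * nm (\<tau> * p i)" using Tsq[OF t] fsh psh by (intro nm_mult) auto
  also have "\<dots> \<le> C * nm (\<tau> * p i)" by (intro mult_right_mono fC) auto
  finally show ?thesis using C0 by (simp add: field_simps)
qed

lemma nm_ft: "\<tau> \<in> T \<Longrightarrow> c / C * nm \<tau> \<le> nm (\<phi> i * \<tau>)"
proof -
  assume t: "\<tau> \<in> T"
  obtain j where "ok i \<tau> j" using okr by blast
  from sep[OF t this] have "c * nm \<tau> \<le> nm (\<phi> i * \<tau> * p j)" .
  also have "\<dots> \<le> nm (\<phi> i * \<tau>) * nm (p j)" using Tsq[OF t] fsh psh by (intro nm_mult) auto
  also have "\<dots> \<le> nm (\<phi> i * \<tau>) * C" by (intro mult_left_mono pC) auto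
  finally show ?thesis using C0 by (simp add: field_simps)
qed

lemma X_expand:
  assumes "j \<in> L" "dim_col \<beta> = n" "dim_row M = n"
  shows "\<beta> * X j * M = \<kappa> j \<cdot>\<^sub>m ((\<beta> * p j) * (\<phi> j * M)) + \<beta> * E j * M"
proof -
  have "\<beta> * X j * M = \<beta> * (\<kappa> j \<cdot>\<^sub>m (p j * \<phi> j) + E j) * M" using Xeq[OF assms(1)] by simp
  also have "\<beta> * (\<kappa> j \<cdot>\<^sub>m (p j * \<phi> j) + E j) = \<kappa> j \<cdot>\<^sub>m (\<beta> * (p j * \<phi> j)) + \<beta> * E j"
    using assms Esq psh fsh by (intro mult_scaled_add) auto
  also have "\<dots> = \<kappa> j \<cdot>\<^sub>m (\<beta> * (p j * \<phi> j)) + 1 \<cdot>\<^sub>m (\<beta> * E j)" by (intro eq_matI) auto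
  also have "\<dots> * M = \<kappa> j \<cdot>\<^sub>m (\<beta> * (p j * \<phi> j) * M) + 1 \<cdot>\<^sub>m (\<beta> * E j * M)"
    using assms Esq psh fsh by (intro lincomb_mult) auto
  also have "\<beta> * (p j * \<phi> j) * M = (\<beta> * p j) * (\<phi> j * M)"
    using assms psh fsh by (simp add: mat_assoc)
  also have "1 \<cdot>\<^sub>m (\<beta> * E j * M) = \<beta> * E j * M" by (intro eq_matI) auto
  finally show ?thesis .
qed

lemma X_bounds:
  assumes j: "j \<in> L" and d: "dim_col \<beta> = n" "dim_row M = n"
  shows "nm (\<beta> * X j * M) \<le> \<bar>real_of_int (\<kappa> j)\<bar> * (nm (\<beta> * p j) * nm (\<phi> j * M) + \<eta> * nm \<beta> * nm M)"
    and "\<bar>real_of_int (\<kappa> j)\<bar> * (nm (\<beta> * p j) * nm (\<phi> j * M) - \<eta> * nm \<beta> * nm M) \<le> nm (\<beta> * X j * M)"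
proof -
  let ?k = "\<bar>real_of_int (\<kappa> j)\<bar>"
  have a: "nm (\<kappa> j \<cdot>\<^sub>m ((\<beta> * p j) * (\<phi> j * M))) = ?k * (nm (\<beta> * p j) * nm (\<phi> j * M))"
    unfolding nm_smult using psh fsh by (subst nm_mult1) auto
  have "nm (\<beta> * E j * M) \<le> nm (\<beta> * E j) * nm M" using d Esq[OF j] by (intro nm_mult) auto
  also have "\<dots> \<le> (nm \<beta> * nm (E j)) * nm M" using d Esq[OF j] by (intro mult_right_mono nm_mult) auto
  also have "\<dots> \<le> (nm \<beta> * (\<eta> * ?k)) * nm M" using En[OF j] by (intro mult_right_mono mult_left_mono) auto
  finally have b: "nm (\<beta> * E j * M) \<le> ?k * (\<eta> * nm \<beta> * nm M)" by (simp add: mult_ac)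
  have "nm (\<beta> * X j * M) \<le> nm (\<kappa> j \<cdot>\<^sub>m ((\<beta> * p j) * (\<phi> j * M))) + nm (\<beta> * E j * M)"
    unfolding X_expand[OF assms] using psh fsh d Esq[OF j] by (intro nm_add) auto
  thus "nm (\<beta> * X j * M) \<le> ?k * (nm (\<beta> * p j) * nm (\<phi> j * M) + \<eta> * nm \<beta> * nm M)"
    using a b by (simp add: distrib_left)
  have "nm (\<kappa> j \<cdot>\<^sub>m ((\<beta> * p j) * (\<phi> j * M))) - nm (\<beta> * E j * M) \<le> nm (\<beta> * X j * M)"
    unfolding X_expand[OF assms] using psh fsh d Esq[OF j] by (intro nm_add_ge) auto
  thus "?k * (nm (\<beta> * p j) * nm (\<phi> j * M) - \<eta> * nm \<beta> * nm M) \<le> nm (\<beta> * X j * M)"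
    using a b by (simp add: right_diff_distrib)
qed

text \<open>A word does not shrink the direction of the next letter. In the inductive step \<open>\<beta> X\<^sub>j \<tau>\<close> is close to \<open>\<kappa>\<^sub>j (\<beta> p\<^sub>j) (\<phi>\<^sub>j \<tau>)\<close>, so both
its norm and its effect on \<open>p\<^sub>i\<close> are proportional to \<open>nm (\<beta> p\<^sub>j)\<close>; the error term involves \<open>nm \<beta>\<close>, which the induction
hypothesis bounds by \<open>nm (\<beta> p\<^sub>j)\<close>. Hence the constant does not deteriorate with the length of the word.\<close>

lemma pre_attract:
  "pre T X L ok i \<beta> \<Longrightarrow> is_sq n \<beta> \<and> c3 * nm \<beta> \<le> nm (\<beta> * p i)"
proof (induction rule: pre.induct)
  case (pre_base \<tau> i)
  have "c3 \<le> c / C" unfolding c3 using c0 C1 by (intro divide_left_mono) auto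
  hence "c3 * nm \<tau> \<le> c / C * nm \<tau>" by (intro mult_right_mono) auto
  thus ?case using nm_tp[OF pre_base, of i] Tsq[OF pre_base] by linarith
next
  case (pre_step j \<beta> \<tau> i)
  have d: "is_sq n \<beta>" "is_sq n \<tau>" "is_sq n (X j)" using pre_step Tsq Xsq by auto
  let ?k = "\<bar>real_of_int (\<kappa> j)\<bar>" and ?A = "nm (\<beta> * p j)" and ?t = "nm \<tau>"
  have bA: "nm \<beta> \<le> ?A / c3" using pre_step.IH c30 by (simp add: field_simps)
  have \<tau>0: "0 \<le> ?t" by simp
  have "nm (\<tau> * p i) \<le> ?t * C"
    using nm_mult[of \<tau> "p i"] d psh mult_left_mono[OF pC[of i], of ?t] by force
  hence "\<eta> * nm \<beta> * nm (\<tau> * p i) \<le> \<eta> * (?A / c3) * (?t * C)"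
    using \<eta>(1) bA c30 by (intro mult_mono mult_nonneg_nonneg) auto
  also have "\<dots> = (C * \<eta> / c3) * (?t * ?A)" by simp
  also have "\<dots> \<le> (c / 2) * (?t * ?A)" using \<eta>(3) c30 by (intro mult_right_mono) (auto simp: field_simps)
  finally have e1: "\<eta> * nm \<beta> * nm (\<tau> * p i) \<le> c / 2 * (?t * ?A)" .
  have "?A * (c * ?t) \<le> ?A * nm (\<phi> j * (\<tau> * p i))"
    using sep[OF pre_step.hyps(3,4)] mat_assoc[of "\<phi> j" \<tau> "p i"] d fsh psh by (intro mult_left_mono) auto
  hence "?k * (c / 2 * (?t * ?A)) \<le> ?k * (?A * nm (\<phi> j * (\<tau> * p i)) - \<eta> * nm \<beta> * nm (\<tau> * p i))"
    using e1 by (intro mult_left_mono) (auto simp: algebra_simps)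
  also have "\<dots> \<le> nm (\<beta> * X j * (\<tau> * p i))" using d psh by (intro X_bounds(2) pre_step) auto
  also have "\<beta> * X j * (\<tau> * p i) = \<beta> * X j * \<tau> * p i" using d psh by (intro mat_assoc[symmetric]) auto
  finally have low: "?k * (c / 2 * (?t * ?A)) \<le> nm (\<beta> * X j * \<tau> * p i)" .
  have "nm (\<beta> * X j * \<tau>) \<le> ?k * (?A * nm (\<phi> j * \<tau>) + \<eta> * nm \<beta> * ?t)"
    using d by (intro X_bounds(1) pre_step) auto
  also have "\<dots> \<le> ?k * (?A * (C * ?t) + ?A * ?t)"
  proof (intro mult_left_mono add_mono)
    have "nm (\<phi> j * \<tau>) \<le> nm (\<phi> j) * ?t" using d fsh by (intro nm_mult) auto
    also have "\<dots> \<le> C * ?t" by (intro mult_right_mono fC) auto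
    finally show "nm (\<phi> j * \<tau>) \<le> C * ?t" .
    have "\<eta> * nm \<beta> \<le> c3 * nm \<beta>" using \<eta>(2) by (intro mult_right_mono) auto
    also have "\<dots> \<le> ?A" using pre_step.IH by simp
    finally show "\<eta> * nm \<beta> * ?t \<le> ?A * ?t" by (intro mult_right_mono) auto
  qed auto
  finally have up: "nm (\<beta> * X j * \<tau>) \<le> ?k * ((C + 1) * (?t * ?A))" by (simp add: algebra_simps)
  have "c3 * nm (\<beta> * X j * \<tau>) \<le> c3 * (?k * ((C + 1) * (?t * ?A)))" using up c30 by (intro mult_left_mono) auto
  also have "\<dots> = ?k * (c / 2 * (?t * ?A))" unfolding c3 using C1 by (simp add: field_simps)
  also have "\<dots> \<le> nm (\<beta> * X j * \<tau> * p i)" by (rule low)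
  finally show ?case using d by auto
qed

definition c5 :: real where "c5 = c3 * (c / (2 * C))"

lemma c50: "0 < c5" unfolding c5_def using c30 c0 C0 by simp

lemma pre_grow:
  assumes "pre T X L ok j \<beta>" "j \<in> L" "\<tau> \<in> T"
  shows "c5 * \<bar>real_of_int (\<kappa> j)\<bar> * nm \<beta> * nm \<tau> \<le> nm (\<beta> * X j * \<tau>)"
proof -
  note b = pre_attract[OF assms(1)]
  have d: "is_sq n \<beta>" "is_sq n \<tau>" using b Tsq assms by auto
  let ?k = "\<bar>real_of_int (\<kappa> j)\<bar>"
  have "2 * \<eta> \<le> c * c3 / C" using \<eta>(3) C0 by (simp add: field_simps)
  hence "(\<eta> + c5) * (nm \<beta> * nm \<tau>) \<le> (c3 * (c / C)) * (nm \<beta> * nm \<tau>)"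
    unfolding c5_def by (intro mult_right_mono) (auto simp: field_simps)
  also have "\<dots> = (c3 * nm \<beta>) * (c / C * nm \<tau>)" by simp
  also have "\<dots> \<le> nm (\<beta> * p j) * nm (\<phi> j * \<tau>)"
    using b nm_ft[OF assms(3), of j] c30 c0 C0 by (intro mult_mono) auto
  finally have "c5 * (nm \<beta> * nm \<tau>) \<le> nm (\<beta> * p j) * nm (\<phi> j * \<tau>) - \<eta> * nm \<beta> * nm \<tau>" by (simp add: algebra_simps)
  hence "?k * (c5 * (nm \<beta> * nm \<tau>)) \<le> ?k * (nm (\<beta> * p j) * nm (\<phi> j * \<tau>) - \<eta> * nm \<beta> * nm \<tau>)"
    by (intro mult_left_mono) auto
  also have "\<dots> \<le> nm (\<beta> * X j * \<tau>)" using d by (intro X_bounds(2) assms) auto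
  finally show ?thesis by (simp add: mult_ac)
qed

lemma X_up: "j \<in> L \<Longrightarrow> nm (X j) \<le> \<bar>real_of_int (\<kappa> j)\<bar> * (C * C + \<eta>)"
proof -
  assume j: "j \<in> L"
  have "nm (X j) \<le> nm (\<kappa> j \<cdot>\<^sub>m (p j * \<phi> j)) + nm (E j)" unfolding Xeq[OF j] using Esq[OF j] psh fsh by (intro nm_add) auto
  also have "nm (\<kappa> j \<cdot>\<^sub>m (p j * \<phi> j)) = \<bar>real_of_int (\<kappa> j)\<bar> * (nm (p j) * nm (\<phi> j))"
    unfolding nm_smult using psh fsh by (subst nm_mult1) auto
  also have "\<dots> \<le> \<bar>real_of_int (\<kappa> j)\<bar> * (C * C)" using pC fC C0 by (intro mult_left_mono mult_mono) auto
  also have "nm (E j) \<le> \<bar>real_of_int (\<kappa> j)\<bar> * \<eta>" using En[OF j] by (simp add: mult.commute)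
  finally show ?thesis by (simp add: distrib_left)
qed

lemma X_n2: "j \<in> L \<Longrightarrow> n2 (X j) \<le> (real_of_int (\<kappa> j))\<^sup>2 * (4 * (C * C) * \<eta> + 2 * \<eta>\<^sup>2)"
proof -
  assume j: "j \<in> L"
  let ?k = "\<bar>real_of_int (\<kappa> j)\<bar>"
  have "n2 (X j) \<le> 4 * ?k * (nm (p j) * nm (\<phi> j)) * nm (E j) + 2 * (nm (E j))\<^sup>2"
    unfolding Xeq[OF j] using Esq[OF j] psh fsh by (intro n2_rank_one_perturb) auto
  also have "\<dots> \<le> 4 * ?k * (C * C) * (\<eta> * ?k) + 2 * (\<eta> * ?k)\<^sup>2"
    using pC fC C0 En[OF j] \<eta>(1) by (intro add_mono mult_mono mult_left_mono power_mono mult_nonneg_nonneg) auto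
  also have "\<dots> = ?k\<^sup>2 * (4 * (C * C) * \<eta> + 2 * \<eta>\<^sup>2)" by (simp add: power2_eq_square algebra_simps)
  finally show ?thesis by simp
qed

definition \<theta> :: real where "\<theta> = (4 * (C * C) * \<eta> + 2 * \<eta>\<^sup>2) / c5\<^sup>2"

lemma \<theta>0: "0 \<le> \<theta>" unfolding \<theta>_def using \<eta>(1) C0 by simp

text \<open>The minors of \<open>X j\<close> are of order \<open>\<eta> * \<kappa>\<^sup>2\<close> only, since \<open>X j\<close> is close to rank one, whereas by \<open>pre_grow\<close> the square of the norm of
the word gains a factor of order \<open>\<kappa>\<^sup>2\<close>. So each letter costs a factor \<open>\<theta>\<close> of order \<open>\<eta>\<close>.\<close>

lemma pre_wd:
  assumes "pre T X L ok j \<beta>" "j \<in> L" "\<tau> \<in> T" "\<kappa> j \<noteq> 0" "0 < nm \<beta>" "0 < nm \<tau>"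
  shows "wd (\<beta> * X j * \<tau>) \<le> \<theta> * wd \<beta> * wd \<tau>"
proof -
  let ?k = "\<bar>real_of_int (\<kappa> j)\<bar>" and ?W = "\<beta> * X j * \<tau>"
  have d: "is_sq n \<beta>" "is_sq n \<tau>" "is_sq n (X j)" using pre_attract[OF assms(1)] Tsq assms Xsq by auto
  have k: "0 < ?k" using assms(4) by simp
  have g: "c5 * ?k * nm \<beta> * nm \<tau> \<le> nm ?W" by (rule pre_grow[OF assms(1-3)])
  have g0: "0 < c5 * ?k * nm \<beta> * nm \<tau>" using c50 k assms(5,6) by simp
  have "n2 ?W \<le> n2 (\<beta> * X j) * n2 \<tau>" using d by (intro n2_mult) auto
  also have "\<dots> \<le> (n2 \<beta> * n2 (X j)) * n2 \<tau>" using d by (intro mult_right_mono n2_mult) auto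
  also have "\<dots> \<le> (n2 \<beta> * (?k\<^sup>2 * (4 * (C * C) * \<eta> + 2 * \<eta>\<^sup>2))) * n2 \<tau>"
    using X_n2[OF assms(2)] by (intro mult_right_mono mult_left_mono) auto
  finally have a: "n2 ?W \<le> n2 \<beta> * n2 \<tau> * ?k\<^sup>2 * (4 * (C * C) * \<eta> + 2 * \<eta>\<^sup>2)" by (simp add: mult_ac)
  have "wd ?W \<le> (n2 \<beta> * n2 \<tau> * ?k\<^sup>2 * (4 * (C * C) * \<eta> + 2 * \<eta>\<^sup>2)) / (c5 * ?k * nm \<beta> * nm \<tau>)\<^sup>2"
    unfolding wd_def using a g g0 \<eta>(1) C0 by (intro frac_le power_mono) auto
  also have "\<dots> = \<theta> * wd \<beta> * wd \<tau>"
    unfolding \<theta>_def wd_def using c50 k assms(5,6) by (simp add: power_mult_distrib mult_ac)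
  finally show ?thesis .
qed

end

lemma pingpong_transpose:
  assumes "pingpong n T X L ok p \<phi> \<kappa> E C c \<eta> c3"
  shows "pingpong n (transpose_mat ` T) (\<lambda>i. transpose_mat (X i)) L (\<lambda>i \<tau> j. ok j (transpose_mat \<tau>) i)
     (\<lambda>i. transpose_mat (\<phi> i)) (\<lambda>i. transpose_mat (p i)) \<kappa> (\<lambda>i. transpose_mat (E i)) C c \<eta> c3"
proof -
  interpret pingpong n T X L ok p \<phi> \<kappa> E C c \<eta> c3 by (rule assms)
  have tr: "transpose_mat (A * B) = transpose_mat B * transpose_mat A" if "dim_col A = dim_row B" for A B :: "int mat"
    using that by (intro transpose_mult[of _ "dim_row A" "dim_col A" _ "dim_col B"]) (auto intro!: carrier_matI)
  show ?thesis
  proof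
    fix \<tau> i j assume t: "\<tau> \<in> transpose_mat ` T" "ok j (transpose_mat \<tau>) i"
    then obtain \<sigma> where s: "\<sigma> \<in> T" "\<tau> = transpose_mat \<sigma>" by blast
    have "transpose_mat (p i) * \<tau> * transpose_mat (\<phi> j) = transpose_mat (\<phi> j * (\<sigma> * p i))"
      unfolding s using Tsq[OF s(1)] psh fsh by (simp add: tr)
    also have "\<phi> j * (\<sigma> * p i) = \<phi> j * \<sigma> * p i" using Tsq[OF s(1)] psh fsh by (intro mat_assoc[symmetric]) auto
    finally show "c * nm \<tau> \<le> nm (transpose_mat (p i) * \<tau> * transpose_mat (\<phi> j))"
      using sep[OF s(1)] t(2) s(2) by simp
  next
    fix j assume j: "j \<in> L"
    show "transpose_mat (X j) = \<kappa> j \<cdot>\<^sub>m (transpose_mat (\<phi> j) * transpose_mat (p j)) + transpose_mat (E j)"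
      unfolding Xeq[OF j] using psh fsh Esq[OF j]
      by (subst tr[symmetric]) (auto intro!: eq_matI)
  qed (use Tsq psh fsh pC fC C1 c0 Esq En okl okr c3 \<eta> in auto)
qed

section \<open>Tame subgroups\<close>

definition mid :: "nat \<Rightarrow> int mat \<Rightarrow> int mat set \<Rightarrow> int mat set" where
  "mid n g D = {a * q * b |a q b. a \<in> D \<and> q \<in> {g, iv n g} \<and> b \<in> D}"

definition TT :: "nat \<Rightarrow> int mat \<Rightarrow> int mat set \<Rightarrow> int mat set" where
  "TT n g D = D \<union> mid n g D"

text \<open>The center is included so that \<open>D\<close> is the preimage of a subgroup of the quotient. Finite generation provides the
chains in \<open>TT n g D\<close> along which \<open>good_line\<close> descends, and the good vector and covector are its starting point. The
condition on \<open>a * g * b = g\<close> says that \<open>D\<close> and its conjugate by \<open>g\<close> intersect in the center. The last condition keeps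
\<open>g\<close> out of \<open>D\<close>; moreover, in a group that contains \<open>D\<close> and an element of a double coset of \<open>g\<close>, it makes \<open>g * g\<close> available as an element
outside \<open>TT n g D\<close>.\<close>

definition tame :: "nat \<Rightarrow> int mat \<Rightarrow> int mat set \<Rightarrow> bool" where
  "tame n g D \<longleftrightarrow> subgroup D (SL_int n) \<and> ZZ n \<subseteq> D \<and>
     (\<exists>S. finite S \<and> S \<subseteq> SL n \<and> D = generate (SL_int n) S) \<and>
     wd summable_on D \<and>
     (\<exists>c>0. \<forall>a\<in>D. \<forall>b\<in>D. \<forall>q\<in>{g, iv n g}. c * nm a * nm b \<le> nm (a * q * b)) \<and>
     (\<exists>y z. is_col n y \<and> is_row n z \<and> good (TT n g D) y \<and> cogood (TT n g D) z) \<and>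
     (\<forall>a\<in>D. \<forall>b\<in>D. a * g * b = g \<longrightarrow> a \<in> ZZ n) \<and> g * g \<notin> TT n g D"

lemma sub_SL:
  assumes "subgroup D (SL_int n)"
  shows "D \<subseteq> SL n" "1\<^sub>m n \<in> D" "a \<in> D \<Longrightarrow> b \<in> D \<Longrightarrow> a * b \<in> D" "a \<in> D \<Longrightarrow> iv n a \<in> D"
  using subgroup.subset[OF assms] subgroup.one_closed[OF assms] subgroup.m_closed[OF assms, of a b]
    subgroup.m_inv_closed[OF assms, of a] by auto

lemma TT_SL: "subgroup D (SL_int n) \<Longrightarrow> g \<in> SL n \<Longrightarrow> TT n g D \<subseteq> SL n"
  using sub_SL[of D n] unfolding TT_def mid_def by (auto 0 4)

lemma TT_iv:
  assumes D: "subgroup D (SL_int n)" and g: "g \<in> SL n" and t: "\<tau> \<in> TT n g D"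
  shows "iv n \<tau> \<in> TT n g D"
proof (cases "\<tau> \<in> D")
  case True thus ?thesis using sub_SL[OF D] unfolding TT_def by auto
next
  case False
  then obtain a q b where t: "a \<in> D" "q \<in> {g, iv n g}" "b \<in> D" "\<tau> = a * q * b" using t unfolding TT_def mid_def by blast
  have s: "a \<in> SL n" "b \<in> SL n" "q \<in> SL n" using t sub_SL(1)[OF D] g by auto
  have "iv n \<tau> = iv n b * (iv n q * iv n a)" unfolding t using s by (simp add: iv_mult)
  also have "\<dots> = iv n b * iv n q * iv n a" using s by (intro SL_assoc[symmetric]) auto
  finally have "iv n \<tau> = iv n b * iv n q * iv n a" .
  moreover have "iv n q \<in> {g, iv n g}" using t(2) g by auto
  ultimately show ?thesis using sub_SL(4)[OF D] t unfolding TT_def mid_def by blast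
qed

lemma bsum_mid:
  assumes D: "D \<subseteq> SL n" and n: "n > 0" and g: "g \<in> SL n" and s: "bsum wd D s"
    and c: "c > 0" "\<And>a b q. a \<in> D \<Longrightarrow> b \<in> D \<Longrightarrow> q \<in> {g, iv n g} \<Longrightarrow> c * nm a * nm b \<le> nm (a * q * b)"
  shows "\<exists>t. bsum wd (mid n g D) t"
proof -
  have one: "bsum wd {a * q * b |a b. a \<in> D \<and> b \<in> D} (n2 q / c\<^sup>2 * s * s)" if q: "q \<in> {g, iv n g}" for q
  proof (rule bsum_image_prod[where h = "\<lambda>a b. a * q * b"])
    fix a b assume ab: "a \<in> D" "b \<in> D"
    have S: "a \<in> SL n" "b \<in> SL n" "q \<in> SL n" using ab q D g by auto
    have p: "0 < nm a" "0 < nm b" using SL_nm_ge_1[OF S(1) n] SL_nm_ge_1[OF S(2) n] by auto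
    have "n2 (a * q * b) \<le> n2 (a * q) * n2 b" using S by (intro n2_mult) auto
    also have "\<dots> \<le> (n2 a * n2 q) * n2 b" using S by (intro mult_right_mono n2_mult) auto
    finally have u: "n2 (a * q * b) \<le> n2 q * n2 a * n2 b" by (simp add: mult_ac)
    have "wd (a * q * b) \<le> (n2 q * n2 a * n2 b) / (c * nm a * nm b)\<^sup>2"
      unfolding wd_def using u c(2)[OF ab q] c(1) p by (intro frac_le power_mono) auto
    also have "\<dots> = n2 q / c\<^sup>2 * wd a * wd b" unfolding wd_def using c p by (simp add: power_mult_distrib)
    finally show "wd (a * q * b) \<le> n2 q / c\<^sup>2 * wd a * wd b" .
  qed (use s c in auto)
  have "mid n g D = {a * g * b |a b. a \<in> D \<and> b \<in> D} \<union> {a * iv n g * b |a b. a \<in> D \<and> b \<in> D}"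
    unfolding mid_def by blast
  thus ?thesis using bsum_Un[OF one[of g] one[of "iv n g"]] by auto
qed

text \<open>Left multiplication by an element of a generated group, decomposed into generators. The assumption on all translates
\<open>d * \<sigma>\<close> guarantees that the intermediate products belong to \<open>T\<close>.\<close>

lemma generate_reach:
  assumes S: "S \<subseteq> SL n" and T: "T \<subseteq> SL n" and L: "S \<union> iv n ` S \<subseteq> L"
    and x: "x \<in> generate (SL_int n) S"
  shows "\<sigma> \<in> reach n L T \<Longrightarrow> \<sigma> \<in> SL n \<Longrightarrow> (\<And>d. d \<in> generate (SL_int n) S \<Longrightarrow> d * \<sigma> \<in> T) \<Longrightarrow> x * \<sigma> \<in> reach n L T"
  using x
proof (induction arbitrary: \<sigma> rule: generate.induct)
  case one thus ?case by simp
next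
  case (incl h)
  have "h * \<sigma> \<in> T" using incl generate.incl by metis
  thus ?case using incl L by (intro reach_mult) auto
next
  case (inv h)
  have "iv n h * \<sigma> \<in> T" using inv generate.inv by metis
  thus ?case using inv L by (intro reach_mult) auto
next
  case (eng h1 h2)
  have S1: "generate (SL_int n) S \<subseteq> SL n" using group.generate_incl[OF group_SL_int] S by blast
  have SS: "h1 \<in> SL n" "h2 \<in> SL n" using eng S1 by auto
  have 2: "h2 * \<sigma> \<in> reach n L T" using eng by blast
  have "d * (h2 * \<sigma>) \<in> T" if d: "d \<in> generate (SL_int n) S" for d
  proof -
    have "d * h2 \<in> generate (SL_int n) S" using generate.eng[OF d eng(2)] by simp
    hence "d * h2 * \<sigma> \<in> T" using eng by blast
    thus ?thesis using SL_assoc[of d n h2 \<sigma>] SS d S1 eng.prems by auto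
  qed
  hence "h1 * (h2 * \<sigma>) \<in> reach n L T" using eng(3)[OF 2] SS eng.prems by auto
  thus ?case using SL_assoc SS eng.prems by simp
qed

text \<open>Transversality makes \<open>wd (a q b)\<close> at most a constant times \<open>wd a * wd b\<close>, so summability passes from \<open>D\<close> to the double cosets.
The set is reached from the identity through \<open>b\<close>, \<open>q b\<close> and \<open>a q b\<close>.\<close>

lemma tame_TT:
  assumes t: "tame n g D" and g: "g \<in> SL n" and n: "n > 0"
  shows "TT n g D \<subseteq> SL n" "1\<^sub>m n \<in> TT n g D" "wd summable_on TT n g D"
    "\<And>\<tau>. \<tau> \<in> TT n g D \<Longrightarrow> iv n \<tau> \<in> TT n g D"
    "\<exists>L. finite L \<and> L \<subseteq> SL n \<and> TT n g D \<subseteq> reach n L (TT n g D)"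
proof -
  have D: "subgroup D (SL_int n)" using t unfolding tame_def by blast
  note DS = sub_SL[OF D]
  show T1: "TT n g D \<subseteq> SL n" by (rule TT_SL[OF D g])
  show T2: "1\<^sub>m n \<in> TT n g D" using DS unfolding TT_def by auto
  show "\<And>\<tau>. \<tau> \<in> TT n g D \<Longrightarrow> iv n \<tau> \<in> TT n g D" using TT_iv[OF D g] .
  have sm: "wd summable_on D" using t unfolding tame_def by blast
  obtain c where c: "c > 0" "\<forall>a\<in>D. \<forall>b\<in>D. \<forall>q\<in>{g, iv n g}. c * nm a * nm b \<le> nm (a * q * b)" using t unfolding tame_def by blast
  have bs: "bsum wd D (infsum wd D)" using sm by (intro summable_bsum) auto
  then obtain s where "bsum wd (mid n g D) s" using bsum_mid[OF DS(1) n g bs c(1)] c(2) by blast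
  hence "bsum wd (TT n g D) (infsum wd D + s)" unfolding TT_def using bs by (intro bsum_Un)
  thus "wd summable_on TT n g D" by (rule bsum_summable) auto
  obtain S where S: "finite S" "S \<subseteq> SL n" "D = generate (SL_int n) S" using t unfolding tame_def by blast
  define L where "L = S \<union> iv n ` S \<union> {g, iv n g}"
  have L: "finite L" "L \<subseteq> SL n" "S \<union> iv n ` S \<subseteq> L" unfolding L_def using S g by auto
  have r1: "b \<in> reach n L (TT n g D)" if b: "b \<in> D" for b
  proof -
    have "b * 1\<^sub>m n \<in> reach n L (TT n g D)"
    proof (rule generate_reach[OF S(2) T1 L(3)])
      show "d * 1\<^sub>m n \<in> TT n g D" if "d \<in> generate (SL_int n) S" for d
        using that S(3) DS(1) unfolding TT_def by auto
    qed (use b S(3) reach_one in auto)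
    thus ?thesis using b DS(1) by auto
  qed
  have "TT n g D \<subseteq> reach n L (TT n g D)"
  proof
    fix \<tau> assume tau: "\<tau> \<in> TT n g D"
    show "\<tau> \<in> reach n L (TT n g D)"
    proof (cases "\<tau> \<in> D")
      case True thus ?thesis by (rule r1)
    next
      case False
      then obtain a q b where ab: "a \<in> D" "q \<in> {g, iv n g}" "b \<in> D" "\<tau> = a * q * b" using tau unfolding TT_def mid_def by blast
      have s: "a \<in> SL n" "b \<in> SL n" "q \<in> SL n" using ab DS(1) g by auto
      have m: "d * (q * b) \<in> TT n g D" if "d \<in> D" for d
      proof -
        have "d * q * b \<in> mid n g D" unfolding mid_def using that ab by blast
        thus ?thesis using SL_assoc[of d n q b] s that DS(1) unfolding TT_def by auto
      qed
      have "q * b \<in> TT n g D" using m[OF DS(2)] s by auto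
      hence 1: "q * b \<in> reach n L (TT n g D)" using r1[OF ab(3)] ab(2) unfolding L_def by (intro reach_mult) auto
      have "a * (q * b) \<in> reach n L (TT n g D)"
        by (rule generate_reach[OF S(2) T1 L(3) _ 1]) (use ab s m S(3) in auto)
      thus ?thesis unfolding ab(4) using SL_assoc s by simp
    qed
  qed
  thus "\<exists>L. finite L \<and> L \<subseteq> SL n \<and> TT n g D \<subseteq> reach n L (TT n g D)" using L by blast
qed

section \<open>Adding ping-pong letters to a tame subgroup\<close>

text \<open>Two elements and their inverses, and an index \<open>St\<close> that is not a letter: its vector and covector are separated from
all letters and become the good vector and covector of the extended group.\<close>

datatype ix = Xp | Xm | Yp | Ym | St

fun bar :: "ix \<Rightarrow> ix" where
  "bar Xp = Xm" | "bar Xm = Xp" | "bar Yp = Ym" | "bar Ym = Yp" | "bar St = St"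

lemma bar_bar [simp]: "bar (bar i) = i" by (cases i) auto

definition letters :: "ix set" where "letters = {Xp, Xm, Yp, Ym}"

lemma bar_letters [simp]: "bar i \<in> letters \<longleftrightarrow> i \<in> letters" by (cases i) (auto simp: letters_def)
lemma letters_St: "i \<in> letters \<Longrightarrow> i \<noteq> St" by (auto simp: letters_def)

text \<open>A central spacer between a letter and its inverse is the one configuration in which cancellation takes place.\<close>

definition okz :: "nat \<Rightarrow> ix \<Rightarrow> int mat \<Rightarrow> ix \<Rightarrow> bool" where
  "okz n i \<tau> j \<longleftrightarrow> \<not> (\<tau> \<in> ZZ n \<and> i = bar j)"

lemma pre_mono: "pre D X L ok i \<beta> \<Longrightarrow> D \<subseteq> T \<Longrightarrow> pre T X L ok i \<beta>"
  by (induction rule: pre.induct) (auto intro: pre.intros)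

lemma ZZ_subgroup: "subgroup (ZZ n) (SL_int n)"
  using group.center_normal[OF group_SL_int] normal_imp_subgroup by blast

lemma ZZ_SL: "z \<in> ZZ n \<Longrightarrow> z \<in> SL n" unfolding center_def by auto
lemma ZZ_comm: "z \<in> ZZ n \<Longrightarrow> x \<in> SL n \<Longrightarrow> z * x = x * z" unfolding center_def by auto
lemma ZZ_iv: "x \<in> SL n \<Longrightarrow> iv n x \<in> ZZ n \<longleftrightarrow> x \<in> ZZ n"
  using sub_SL(4)[OF ZZ_subgroup] by (metis iv_iv)

lemma pre_SL:
  "pre T X letters ok i \<beta> \<Longrightarrow> T \<subseteq> SL n \<Longrightarrow> (\<And>j. j \<in> letters \<Longrightarrow> X j \<in> SL n) \<Longrightarrow> \<beta> \<in> SL n"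
  by (induction rule: pre.induct) auto

text \<open>Transposed inverses of admissible words are admissible for the transposed system, so what ping-pong proves about vectors also
holds for covectors.\<close>

lemma pre_inverse:
  assumes "pre T X letters (okz n) i \<beta>" and T: "T \<subseteq> SL n" "\<And>\<tau>. \<tau> \<in> T \<Longrightarrow> iv n \<tau> \<in> T"
    and X: "\<And>j. j \<in> letters \<Longrightarrow> X j \<in> SL n" "\<And>j. j \<in> letters \<Longrightarrow> X (bar j) = iv n (X j)"
  shows "pre (transpose_mat ` T) (\<lambda>i. transpose_mat (X i)) letters (\<lambda>i \<tau> j. okz n j (transpose_mat \<tau>) i)
     (bar i) (transpose_mat (iv n \<beta>))"
  using assms(1)
proof (induction rule: pre.induct)
  case (pre_base \<tau> i)
  thus ?case using T by (intro pre.pre_base) auto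
next
  case (pre_step j \<beta> \<tau> i)
  have S: "\<beta> \<in> SL n" "X j \<in> SL n" "\<tau> \<in> SL n" using pre_SL[OF pre_step(1) T(1) X(1)] X pre_step T by auto
  have tr: "transpose_mat (A * B) = transpose_mat B * transpose_mat A" if "A \<in> SL n" "B \<in> SL n" for A B :: "int mat"
    using that by (intro transpose_mult[of _ n n _ n]) (auto intro!: carrier_matI)
  have "iv n (\<beta> * X j * \<tau>) = iv n \<tau> * (X (bar j) * iv n \<beta>)" using S X(2)[OF pre_step(2)] by (simp add: iv_mult)
  hence eq: "transpose_mat (iv n (\<beta> * X j * \<tau>)) = transpose_mat (iv n \<beta>) * transpose_mat (X (bar j)) * transpose_mat (iv n \<tau>)"
    using S X(2)[OF pre_step(2)] by (simp add: tr)
  show ?case unfolding eq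
  proof (rule pre.pre_step)
    show "okz n (bar i) (transpose_mat (transpose_mat (iv n \<tau>))) (bar j)"
      using pre_step.hyps(4) ZZ_iv[OF S(3)] unfolding okz_def by (auto simp: Matrix.transpose_transpose)
  qed (use pre_step T in auto)
qed

text \<open>The set \<open>P\<close> consists of elements that must not enter \<open>TT\<close>. The coefficient in \<open>th\<close> is \<open>8 = 4 * 2\<close>, as there are four letters and the
sum of \<open>wd\<close> is allowed to double. By \<open>big\<close> a word that contains a letter has larger norm than \<open>g\<close>, \<open>g * g\<close> and
the elements of \<open>P\<close>.\<close>

locale extension =
  fixes n :: nat and g :: "int mat" and D S :: "int mat set" and X p \<phi> :: "ix \<Rightarrow> int mat"
    and \<kappa> :: "ix \<Rightarrow> int" and E :: "ix \<Rightarrow> int mat" and C c \<eta> c3 s :: real and P :: "int mat set"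
  assumes n0: "n > 0" and gS: "g \<in> SL n" and tm: "tame n g D"
    and SS: "finite S" "S \<subseteq> SL n" "D = generate (SL_int n) S"
    and pp: "pingpong n (TT n g D) X letters (okz n) p \<phi> \<kappa> E C c \<eta> c3"
    and XS: "i \<in> letters \<Longrightarrow> X i \<in> SL n" and Xbar: "i \<in> letters \<Longrightarrow> X (bar i) = iv n (X i)"
    and bs: "bsum wd D s" and th: "8 * pingpong.\<theta> C c \<eta> c3 * s \<le> 1"
    and big: "i \<in> letters \<Longrightarrow> \<pi> \<in> P \<union> {g, g * g} \<Longrightarrow> nm \<pi> < pingpong.c5 C c c3 * \<bar>real_of_int (\<kappa> i)\<bar>"
begin

sublocale pingpong n "TT n g D" X letters "okz n" p \<phi> \<kappa> E C c \<eta> c3 by (rule pp)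

abbreviation "T \<equiv> TT n g D"

lemma Dsub: "subgroup D (SL_int n)" using tm unfolding tame_def by blast
lemmas DS = sub_SL[OF Dsub]
lemma DSL: "a \<in> D \<Longrightarrow> a \<in> SL n" using DS(1) by auto
lemma DT: "D \<subseteq> T" unfolding TT_def by auto
lemma ZD: "ZZ n \<subseteq> D" using tm unfolding tame_def by blast
lemma TSL: "T \<subseteq> SL n" by (rule TT_SL[OF Dsub gS])

text \<open>The reduced words. They are closed under right multiplication by the generators and hence form the whole
extended group (\<open>Dplus_eq\<close>).\<close>

definition Dp :: "int mat set" where
  "Dp = D \<union> {\<beta> * X i * \<delta> |\<beta> i \<delta>. i \<in> letters \<and> pre D X letters (okz n) i \<beta> \<and> \<delta> \<in> D}"

lemma preD_SL: "pre D X letters (okz n) i \<beta> \<Longrightarrow> \<beta> \<in> SL n"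
  using pre_SL[of D X "okz n" i \<beta> n] DS(1) XS by blast

lemma preT_SL: "pre T X letters (okz n) i \<beta> \<Longrightarrow> \<beta> \<in> SL n"
  using pre_SL[of T X "okz n" i \<beta> n] TSL XS by blast

lemma Dp_cases:
  assumes "w \<in> Dp"
  obtains "w \<in> D" | \<beta> i \<delta> where "i \<in> letters" "pre D X letters (okz n) i \<beta>" "\<delta> \<in> D" "w = \<beta> * X i * \<delta>"
  using assms unfolding Dp_def by blast

lemma Dp_word: "i \<in> letters \<Longrightarrow> pre D X letters (okz n) i \<beta> \<Longrightarrow> \<delta> \<in> D \<Longrightarrow> \<beta> * X i * \<delta> \<in> Dp"
  unfolding Dp_def by blast

lemma Dp_SL: "w \<in> Dp \<Longrightarrow> w \<in> SL n"
  by (erule Dp_cases) (use DSL preD_SL XS in auto)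

lemma pre_Dp: "pre D X letters (okz n) j \<beta> \<Longrightarrow> \<beta> \<in> Dp"
  by (induction rule: pre.induct) (auto simp: Dp_def)

lemma Dp_mult_D:
  assumes "w \<in> Dp" "d \<in> D" shows "w * d \<in> Dp"
  using assms(1)
proof (cases rule: Dp_cases)
  case 1 thus ?thesis using DS assms unfolding Dp_def by auto
next
  case (2 \<beta> i \<delta>)
  have "w * d = \<beta> * X i * (\<delta> * d)" unfolding 2 using preD_SL[OF 2(2)] XS[OF 2(1)] DSL 2(3) assms(2) by (intro SL_assoc) auto
  thus ?thesis using 2 DS(3)[OF 2(3) assms(2)] Dp_word by simp
qed

lemma Dp_mult_X:
  assumes "w \<in> Dp" "i \<in> letters" shows "w * X i \<in> Dp"
  using assms(1)
proof (cases rule: Dp_cases)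
  case 1
  have "w * X i * 1\<^sub>m n \<in> Dp" using 1 assms DS by (intro Dp_word pre_base) auto
  thus ?thesis using DSL[OF 1] XS[OF assms(2)] by simp
next
  case (2 \<beta> j \<delta>)
  have S: "\<beta> \<in> SL n" "X j \<in> SL n" "\<delta> \<in> SL n" "X i \<in> SL n" using preD_SL XS DSL 2 assms by auto
  show ?thesis
  proof (cases "okz n j \<delta> i")
    case True
    hence "pre D X letters (okz n) i w" unfolding 2(4) using 2 by (intro pre_step) auto
    hence "w * X i * 1\<^sub>m n \<in> Dp" using assms DS by (intro Dp_word) auto
    thus ?thesis using Dp_SL[OF assms(1)] S by simp
  next
    case False
    hence z: "\<delta> \<in> ZZ n" "j = bar i" unfolding okz_def by auto
    have xx: "X j * X i = 1\<^sub>m n" unfolding z(2) Xbar[OF assms(2)] using S by simp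
    have "w * X i = \<beta> * X j * (\<delta> * X i)" unfolding 2 using S by (intro SL_assoc) auto
    also have "\<delta> * X i = X i * \<delta>" using ZZ_comm[OF z(1) S(4)] .
    also have "\<beta> * X j * (X i * \<delta>) = \<beta> * (X j * (X i * \<delta>))" using S by (intro SL_assoc) auto
    also have "X j * (X i * \<delta>) = X j * X i * \<delta>" using S by (intro SL_assoc[symmetric]) auto
    also have "\<dots> = \<delta>" unfolding xx using S by simp
    finally show ?thesis using Dp_mult_D[OF pre_Dp[OF 2(2)] 2(3)] by simp
  qed
qed

definition Dplus :: "int mat set" where "Dplus = generate (SL_int n) (S \<union> X ` letters)"

lemma gens: "finite (S \<union> X ` letters)" "S \<union> X ` letters \<subseteq> SL n"
  using SS XS unfolding letters_def by auto

lemma Dplus_sub: "subgroup Dplus (SL_int n)"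
  unfolding Dplus_def using group.generate_is_subgroup[OF group_SL_int] gens by blast
lemmas DPS = sub_SL[OF Dplus_sub]

lemma D_Dplus: "D \<subseteq> Dplus"
  unfolding SS(3) Dplus_def by (rule group.mono_generate[OF group_SL_int]) auto

lemma X_Dplus: "i \<in> letters \<Longrightarrow> X i \<in> Dplus"
  unfolding Dplus_def by (intro generate.incl) auto

lemma Dplus_eq: "Dplus = Dp"
proof
  have "w * x \<in> Dp" if "x \<in> Dplus" "w \<in> Dp" for w x
    using that unfolding Dplus_def
  proof (induction arbitrary: w rule: generate.induct)
    case one thus ?case using Dp_SL by simp
  next
    case (incl h)
    thus ?case
    proof (cases "h \<in> S")
      case True
      hence "h \<in> D" unfolding SS(3) by (intro generate.incl)
      thus ?thesis using Dp_mult_D incl by simp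
    next
      case False thus ?thesis using incl Dp_mult_X by auto
    qed
  next
    case (inv h)
    thus ?case
    proof (cases "h \<in> S")
      case True
      hence "iv n h \<in> D" unfolding SS(3) by (intro generate.inv)
      thus ?thesis using Dp_mult_D inv by simp
    next
      case False
      then obtain i where i: "i \<in> letters" "h = X i" using inv by auto
      hence "iv n h = X (bar i)" using Xbar by simp
      thus ?thesis using inv Dp_mult_X i by simp
    qed
  next
    case (eng h1 h2)
    have "h1 \<in> SL n" "h2 \<in> SL n" using eng DPS(1) unfolding Dplus_def by auto
    hence "w * (h1 * h2) = w * h1 * h2" using eng.prems Dp_SL SL_assoc by metis
    thus ?case using eng by simp
  qed
  from this[of _ "1\<^sub>m n"] show "Dplus \<subseteq> Dp" using DS(2) DPS(1) unfolding Dp_def by force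
  have pr: "\<beta> \<in> Dplus" if "pre D X letters (okz n) i \<beta>" for i \<beta>
    using that by (induction rule: pre.induct) (use D_Dplus X_Dplus DPS(3) in auto)
  show "Dp \<subseteq> Dplus"
  proof
    fix w assume "w \<in> Dp"
    thus "w \<in> Dplus" by (cases rule: Dp_cases) (use D_Dplus X_Dplus DPS(3) pr in auto)
  qed
qed

text \<open>In a product \<open>w * q * w'\<close> with \<open>q\<close> one of \<open>g\<close> and its inverse, the spacers of \<open>w\<close> and \<open>w'\<close> next to \<open>q\<close> merge into an element of a double coset.
It is not central, so it is admissible between any two letters and no cancellation occurs.\<close>

lemma mid_nonscalar:
  assumes "a \<in> D" "b \<in> D" "q \<in> {g, iv n g}" shows "a * q * b \<notin> ZZ n"
proof
  assume z: "a * q * b \<in> ZZ n"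
  have S: "a \<in> SL n" "b \<in> SL n" "q \<in> SL n" using assms DSL gS by auto
  have "q = iv n a * (a * q * b) * iv n b" using S by (simp add: SL_assoc)
  hence "q \<in> D" using z ZD assms DS by (metis in_mono)
  hence "g \<in> D" using assms(3) DS(4) gS by (metis insertE iv_iv singletonD)
  hence "g * g \<in> D" using DS by auto
  thus False using tm DT unfolding tame_def by blast
qed

lemma mid_T: "a \<in> D \<Longrightarrow> b \<in> D \<Longrightarrow> q \<in> {g, iv n g} \<Longrightarrow> a * q * b \<in> T"
  unfolding TT_def mid_def by blast

lemma compose_base:
  assumes w: "w \<in> Dplus" and q: "q \<in> {g, iv n g}" and d: "d \<in> D"
  shows "pre T X letters (okz n) j (w * q * d)"
  using w unfolding Dplus_eq
proof (cases rule: Dp_cases)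
  case 1 thus ?thesis using mid_T q d by (intro pre_base) auto
next
  case (2 \<beta> i \<delta>)
  have S: "\<beta> * X i \<in> SL n" "\<delta> \<in> SL n" "q \<in> SL n" "d \<in> SL n" using 2 q d preD_SL XS DSL gS by auto
  have "w * q * d = \<beta> * X i * (\<delta> * q * d)" unfolding 2 using S by (simp add: SL_assoc)
  moreover have "pre T X letters (okz n) j (\<beta> * X i * (\<delta> * q * d))"
    using 2 q d mid_T mid_nonscalar pre_mono[OF 2(2) DT] by (intro pre_step) (auto simp: okz_def)
  ultimately show ?thesis by simp
qed

lemma compose:
  assumes "pre D X letters (okz n) j \<beta>" and w: "w \<in> Dplus" and q: "q \<in> {g, iv n g}"
  shows "pre T X letters (okz n) j (w * q * \<beta>)"
  using assms(1)
proof (induction rule: pre.induct)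
  case (pre_base \<tau> i) thus ?case using compose_base[OF w q] by simp
next
  case (pre_step j \<beta> \<tau> i)
  have S: "w \<in> SL n" "q \<in> SL n" "\<beta> \<in> SL n" "X j \<in> SL n" "\<tau> \<in> SL n"
    using w DPS(1) q gS preD_SL pre_step XS DSL by auto
  have "w * q * (\<beta> * X j * \<tau>) = w * q * \<beta> * X j * \<tau>" using S by (simp add: SL_assoc)
  thus ?case using pre_step DT by (auto intro: pre.pre_step)
qed

text \<open>Elements with an expression that contains a letter. By \<open>lword_big\<close> they have large norm.\<close>

definition lword :: "int mat \<Rightarrow> bool" where
  "lword w \<longleftrightarrow> (\<exists>\<beta> j \<tau>. j \<in> letters \<and> pre T X letters (okz n) j \<beta> \<and> \<tau> \<in> T \<and> w = \<beta> * X j * \<tau>)"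

lemma Dplus_lword:
  assumes "w \<in> Dplus" shows "w \<in> D \<or> lword w"
  using assms unfolding Dplus_eq
proof (cases rule: Dp_cases)
  case 1 thus ?thesis by simp
next
  case (2 \<beta> i \<delta>)
  thus ?thesis unfolding lword_def using pre_mono[OF 2(2) DT] DT by blast
qed

lemma mid_lword:
  assumes w: "w \<in> Dplus" "w' \<in> Dplus" and q: "q \<in> {g, iv n g}"
  shows "w \<in> D \<and> w' \<in> D \<or> lword (w * q * w')"
  using w(2) unfolding Dplus_eq
proof (cases rule: Dp_cases)
  case 1
  note w' = 1
  show ?thesis using w(1) unfolding Dplus_eq
  proof (cases rule: Dp_cases)
    case 1 thus ?thesis using w' by simp
  next
    case (2 \<beta> i \<delta>)
    have S: "\<beta> * X i \<in> SL n" "\<delta> \<in> SL n" "q \<in> SL n" "w' \<in> SL n" using 2 q w' preD_SL XS DSL gS by auto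
    have "w * q * w' = \<beta> * X i * (\<delta> * q * w')" unfolding 2 using S by (simp add: SL_assoc)
    thus ?thesis unfolding lword_def using 2 pre_mono[OF 2(2) DT] mid_T[OF 2(3) w' q] by blast
  qed
next
  case (2 \<beta> i \<delta>)
  have S: "w \<in> SL n" "\<beta> \<in> SL n" "X i \<in> SL n" "\<delta> \<in> SL n" "q \<in> SL n" using 2 q w DPS(1) preD_SL XS DSL gS by auto
  have "w * q * w' = w * q * \<beta> * X i * \<delta>" unfolding 2 using S by (simp add: SL_assoc)
  thus ?thesis unfolding lword_def using 2 compose[OF 2(2) w(1) q] DT by blast
qed

lemma lword_big:
  assumes "lword w" "\<pi> \<in> P \<union> {g, g * g}" shows "w \<noteq> \<pi>"
proof -
  obtain \<beta> j \<tau> where w: "j \<in> letters" "pre T X letters (okz n) j \<beta>" "\<tau> \<in> T" "w = \<beta> * X j * \<tau>"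
    using assms unfolding lword_def by blast
  have ge: "1 \<le> nm \<beta>" "1 \<le> nm \<tau>" using SL_nm_ge_1[OF _ n0] preT_SL[OF w(2)] TSL w(3) by auto
  have "nm \<pi> < c5 * \<bar>real_of_int (\<kappa> j)\<bar>" using big[OF w(1) assms(2)] .
  also have "\<dots> = c5 * \<bar>real_of_int (\<kappa> j)\<bar> * 1 * 1" by simp
  also have "\<dots> \<le> c5 * \<bar>real_of_int (\<kappa> j)\<bar> * nm \<beta> * nm \<tau>"
    using ge c50 by (intro mult_mono mult_nonneg_nonneg) auto
  also have "\<dots> \<le> nm w" unfolding w(4) by (rule pre_grow[OF w(2,1,3)])
  finally show ?thesis by auto
qed

abbreviation "T' \<equiv> TT n g Dplus"

lemma T'_cases: "\<tau> \<in> T' \<Longrightarrow> \<tau> \<in> T \<or> lword \<tau>"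
  using Dplus_lword mid_lword mid_T DT unfolding TT_def[of n g Dplus] mid_def by blast

lemma T'_P: "T' \<inter> P \<subseteq> T"
  using T'_cases lword_big by blast

lemma okz_St: "j \<in> letters \<Longrightarrow> okz n j \<tau> St"
  unfolding okz_def using letters_St by auto

lemma T'_pre: "\<tau> \<in> T' \<Longrightarrow> pre T X letters (okz n) St \<tau>"
  using T'_cases[of \<tau>] unfolding lword_def by (auto intro: pre.intros okz_St)

lemma good_T': "good T' (p St)"
  unfolding good_def using c30 pre_attract[OF T'_pre] by blast

lemma co_attract:
  assumes "pre T X letters (okz n) i \<beta>"
  shows "c3 * nm (iv n \<beta>) \<le> nm (\<phi> (bar i) * iv n \<beta>)"
proof -
  note pt = pre_inverse[OF assms TSL TT_iv[OF Dsub gS] XS Xbar]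
  interpret tr: pingpong n "transpose_mat ` T" "\<lambda>i. transpose_mat (X i)" letters "\<lambda>i \<tau> j. okz n j (transpose_mat \<tau>) i"
     "\<lambda>i. transpose_mat (\<phi> i)" "\<lambda>i. transpose_mat (p i)" \<kappa> "\<lambda>i. transpose_mat (E i)" C c \<eta> c3
    by (rule pingpong_transpose[OF pp])
  have b: "iv n \<beta> \<in> SL n" using preT_SL[OF assms] by auto
  have "transpose_mat (iv n \<beta>) * transpose_mat (\<phi> (bar i)) = transpose_mat (\<phi> (bar i) * iv n \<beta>)"
    using b fsh by (intro transpose_mult[of _ 1 n _ n, symmetric]) (auto intro!: carrier_matI)
  thus ?thesis using tr.pre_attract[OF pt] by simp
qed

lemma cogood_T': "cogood T' (\<phi> St)"
  unfolding cogood_def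
proof (intro exI[of _ c3] conjI ballI)
  fix \<tau> assume t: "\<tau> \<in> T'"
  have S: "\<tau> \<in> SL n" using TT_SL[OF Dplus_sub gS] t by blast
  show "c3 * nm \<tau> \<le> nm (\<phi> St * \<tau>)"
    using co_attract[OF T'_pre[OF TT_iv[OF Dplus_sub gS t]]] S by simp
qed (rule c30)

lemma left_form:
  assumes "w \<in> Dplus"
  shows "w \<in> D \<or> (\<exists>\<delta> j \<beta>. \<delta> \<in> D \<and> j \<in> letters \<and> w = \<delta> * X j * \<beta> \<and> \<beta> \<in> SL n \<and> c3 * nm \<beta> \<le> nm (\<phi> j * \<beta>))"
proof -
  have wS: "w \<in> SL n" using assms DPS(1) by blast
  have "iv n w \<in> Dp" using DPS(4)[OF assms] unfolding Dplus_eq .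
  thus ?thesis
  proof (cases rule: Dp_cases)
    case 1
    hence "iv n (iv n w) \<in> D" by (rule DS(4))
    thus ?thesis using wS by simp
  next
    case (2 \<beta> i \<delta>)
    have S: "\<beta> \<in> SL n" "X i \<in> SL n" "\<delta> \<in> SL n" using preD_SL XS DSL 2 by auto
    have "w = iv n (\<beta> * X i * \<delta>)" using 2(4) wS by (metis iv_iv)
    also have "\<dots> = iv n \<delta> * X (bar i) * iv n \<beta>" using S Xbar[OF 2(1)] by (simp add: iv_mult SL_assoc)
    finally have "w = iv n \<delta> * X (bar i) * iv n \<beta>" .
    moreover have "c3 * nm (iv n \<beta>) \<le> nm (\<phi> (bar i) * iv n \<beta>)" by (rule co_attract[OF pre_mono[OF 2(2) DT]])
    ultimately show ?thesis using 2 DS(4) S by (metis SL_iv bar_letters)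
  qed
qed

text \<open>If \<open>w'\<close> is in \<open>D\<close>, the word \<open>w\<close> splits off its last letter and transversality of \<open>D\<close> applies to the merged spacer.
Otherwise \<open>w'\<close> is split at its first letter \<open>X j\<close>: then \<open>w * q * \<delta>\<close> is an admissible word in front of \<open>X j\<close>, the rest of \<open>w'\<close> is one
behind it in the transposed sense, so both have a component of proportional size along the rank one part of \<open>X j\<close>.\<close>

lemma transversal:
  "\<exists>c>0. \<forall>a\<in>Dplus. \<forall>b\<in>Dplus. \<forall>q\<in>{g, iv n g}. c * nm a * nm b \<le> nm (a * q * b)"
proof -
  obtain c4 where c4: "c4 > 0" "\<And>a b q. a \<in> D \<Longrightarrow> b \<in> D \<Longrightarrow> q \<in> {g, iv n g} \<Longrightarrow> c4 * nm a * nm b \<le> nm (a * q * b)"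
    using tm unfolding tame_def by blast
  define K where "K = C * C + \<eta>"
  have K: "K > 0" unfolding K_def using C0 \<eta>(1) by (simp add: add_pos_nonneg)
  define cA where "cA = min c4 (c5 * c4 / K)"
  have cA: "cA > 0" unfolding cA_def using c4 c50 K by simp
  have A: "cA * nm w * nm d \<le> nm (w * q * d)" if w: "w \<in> Dplus" and d: "d \<in> D" and q: "q \<in> {g, iv n g}" for w d q
    using w unfolding Dplus_eq
  proof (cases rule: Dp_cases)
    case 1
    have "cA * nm w * nm d \<le> c4 * nm w * nm d" unfolding cA_def by (intro mult_right_mono) auto
    thus ?thesis using c4(2)[OF 1 d q] by simp
  next
    case (2 \<beta> i \<delta>)
    have S: "\<beta> \<in> SL n" "X i \<in> SL n" "\<delta> \<in> SL n" "q \<in> SL n" "d \<in> SL n" using 2 q d preD_SL XS DSL gS by auto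
    let ?k = "\<bar>real_of_int (\<kappa> i)\<bar>"
    have e: "w * q * d = \<beta> * X i * (\<delta> * q * d)" unfolding 2 using S by (simp add: SL_assoc)
    have "nm w \<le> nm (\<beta> * X i) * nm \<delta>" unfolding 2 using S by (intro nm_mult) auto
    also have "\<dots> \<le> nm \<beta> * nm (X i) * nm \<delta>" using S by (intro mult_right_mono nm_mult) auto
    also have "\<dots> \<le> nm \<beta> * (?k * K) * nm \<delta>" using X_up[OF 2(1)] unfolding K_def by (intro mult_right_mono mult_left_mono) auto
    finally have u: "nm w \<le> nm \<beta> * (?k * K) * nm \<delta>" .
    have "cA * nm w * nm d \<le> c5 * c4 / K * nm w * nm d" unfolding cA_def by (intro mult_right_mono) auto
    also have "\<dots> \<le> c5 * c4 / K * (nm \<beta> * (?k * K) * nm \<delta>) * nm d"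
      using u c50 c4 K by (intro mult_right_mono mult_left_mono) auto
    also have "\<dots> = c5 * ?k * nm \<beta> * (c4 * nm \<delta> * nm d)" using K by (simp add: field_simps)
    also have "\<dots> \<le> c5 * ?k * nm \<beta> * nm (\<delta> * q * d)" using c4(2)[OF 2(3) d q] c50 by (intro mult_left_mono) auto
    also have "\<dots> \<le> nm (w * q * d)" unfolding e by (rule pre_grow[OF pre_mono[OF 2(2) DT] 2(1) mid_T[OF 2(3) d q]])
    finally show ?thesis .
  qed
  define cB where "cB = min cA (c3\<^sup>2 / (2 * K) * cA)"
  have cB: "cB > 0" unfolding cB_def using cA c30 K by simp
  have "cB * nm w * nm w' \<le> nm (w * q * w')" if w: "w \<in> Dplus" and w': "w' \<in> Dplus" and q: "q \<in> {g, iv n g}" for w w' q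
    using left_form[OF w']
  proof (elim disjE exE conjE)
    assume d: "w' \<in> D"
    have "cB * nm w * nm w' \<le> cA * nm w * nm w'" unfolding cB_def by (intro mult_right_mono) auto
    thus ?thesis using A[OF w d q] by simp
  next
    fix \<delta> j \<beta> assume f: "\<delta> \<in> D" "j \<in> letters" "w' = \<delta> * X j * \<beta>" "\<beta> \<in> SL n" "c3 * nm \<beta> \<le> nm (\<phi> j * \<beta>)"
    have S: "w \<in> SL n" "X j \<in> SL n" "\<delta> \<in> SL n" "q \<in> SL n" using f q w DPS(1) XS DSL gS by auto
    let ?k = "\<bar>real_of_int (\<kappa> j)\<bar>" and ?b = "w * q * \<delta>"
    have e: "w * q * w' = ?b * X j * \<beta>" unfolding f using S f(4) by (simp add: SL_assoc)
    have pb: "c3 * nm ?b \<le> nm (?b * p j)" using pre_attract[OF compose_base[OF w q f(1)]] by blast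
    have "nm w' \<le> nm (\<delta> * X j) * nm \<beta>" unfolding f(3) using S f(4) by (intro nm_mult) auto
    also have "\<dots> \<le> nm \<delta> * nm (X j) * nm \<beta>" using S by (intro mult_right_mono nm_mult) auto
    also have "\<dots> \<le> nm \<delta> * (?k * K) * nm \<beta>" using X_up[OF f(2)] unfolding K_def by (intro mult_right_mono mult_left_mono) auto
    finally have u: "nm w' \<le> nm \<delta> * (?k * K) * nm \<beta>" .
    have "cB * nm w * nm w' \<le> c3\<^sup>2 / (2 * K) * cA * nm w * nm w'" unfolding cB_def by (intro mult_right_mono) auto
    also have "\<dots> \<le> c3\<^sup>2 / (2 * K) * cA * nm w * (nm \<delta> * (?k * K) * nm \<beta>)"
      using u cA K by (intro mult_left_mono mult_nonneg_nonneg) auto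
    also have "\<dots> = ?k * (c3\<^sup>2 / 2 * (cA * nm w * nm \<delta>) * nm \<beta>)" using K by (simp add: field_simps)
    also have "\<dots> \<le> ?k * (c3\<^sup>2 / 2 * nm ?b * nm \<beta>)"
      using A[OF w f(1) q] by (intro mult_left_mono mult_right_mono) auto
    also have "\<dots> \<le> ?k * (nm (?b * p j) * nm (\<phi> j * \<beta>) - \<eta> * nm ?b * nm \<beta>)"
    proof (intro mult_left_mono)
      have "(c3 * nm ?b) * (c3 * nm \<beta>) \<le> nm (?b * p j) * nm (\<phi> j * \<beta>)" using pb f(5) c30 by (intro mult_mono) auto
      moreover have "\<eta> * (nm ?b * nm \<beta>) \<le> c3\<^sup>2 / 2 * (nm ?b * nm \<beta>)" using \<eta>(4) by (intro mult_right_mono) auto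
      ultimately show "c3\<^sup>2 / 2 * nm ?b * nm \<beta> \<le> nm (?b * p j) * nm (\<phi> j * \<beta>) - \<eta> * nm ?b * nm \<beta>"
        by (simp add: power2_eq_square algebra_simps)
    qed auto
    also have "\<dots> \<le> nm (w * q * w')" unfolding e using S f(4) by (intro X_bounds(2) f(2)) auto
    finally show ?thesis .
  qed
  thus ?thesis using cB by blast
qed

text \<open>Words with at most \<open>k\<close> letters. The sum of \<open>wd\<close> over such words is bounded independently of \<open>k\<close>: appending a letter and a spacer
multiplies the bound \<open>2 * s\<close> by \<open>4 * \<theta> * s \<le> 1 / 2\<close>, and the elements of \<open>D\<close> contribute the other half.\<close>

fun level :: "nat \<Rightarrow> int mat set" where
  "level 0 = D"
| "level (Suc k) = D \<union> (\<Union>j\<in>letters. {\<beta> * X j * \<delta> |\<beta> \<delta>. \<beta> \<in> {\<beta>\<in>level k. pre D X letters (okz n) j \<beta>} \<and> \<delta> \<in> D})"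

lemma level_mono: "level k \<subseteq> level (Suc k)"
proof (induction k)
  case 0 show ?case by auto
next
  case (Suc k)
  show ?case
  proof
    fix w assume "w \<in> level (Suc k)"
    then consider "w \<in> D" | j \<beta> \<delta> where "j \<in> letters" "\<beta> \<in> level k" "pre D X letters (okz n) j \<beta>" "\<delta> \<in> D" "w = \<beta> * X j * \<delta>"
      by auto
    thus "w \<in> level (Suc (Suc k))"
    proof cases
      case 1 thus ?thesis by simp
    next
      case 2
      hence "\<beta> \<in> level (Suc k)" using Suc.IH by blast
      thus ?thesis unfolding level.simps(2)[of "Suc k"] using 2 by blast
    qed
  qed
qed

lemma level_mono': "k \<le> m \<Longrightarrow> level k \<subseteq> level m"
  by (rule lift_Suc_mono_le[of level]) (use level_mono in auto)

lemma pre_level: "pre D X letters (okz n) j \<beta> \<Longrightarrow> \<exists>k. \<beta> \<in> level k"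
proof (induction rule: pre.induct)
  case (pre_base \<tau> i) thus ?case by (intro exI[of _ 0]) simp
next
  case (pre_step j \<beta> \<tau> i)
  then obtain k where "\<beta> \<in> level k" by blast
  thus ?case using pre_step by (intro exI[of _ "Suc k"]) auto
qed

lemma Dplus_level: "w \<in> Dplus \<Longrightarrow> \<exists>k. w \<in> level k"
  unfolding Dplus_eq
proof (erule Dp_cases)
  show "w \<in> D \<Longrightarrow> \<exists>k. w \<in> level k" by (intro exI[of _ 0]) simp
  fix \<beta> i \<delta> assume a: "i \<in> letters" "pre D X letters (okz n) i \<beta>" "\<delta> \<in> D" "w = \<beta> * X i * \<delta>"
  then obtain k where "\<beta> \<in> level k" using pre_level by blast
  thus "\<exists>k. w \<in> level k" using a by (intro exI[of _ "Suc k"]) auto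
qed

lemma bsum_level: "bsum wd (level k) (2 * s)"
proof (induction k)
  case 0
  show ?case using bs bsum_nonneg[OF bs] unfolding bsum_def by force
next
  case (Suc k)
  have "bsum wd (\<Union>j\<in>letters. {\<beta> * X j * \<delta> |\<beta> \<delta>. \<beta> \<in> {\<beta>\<in>level k. pre D X letters (okz n) j \<beta>} \<and> \<delta> \<in> D}) (real (card letters) * (\<theta> * (2 * s) * s))"
  proof (rule bsum_UN)
    fix j assume j: "j \<in> letters"
    show "bsum wd {\<beta> * X j * \<delta> |\<beta> \<delta>. \<beta> \<in> {\<beta>\<in>level k. pre D X letters (okz n) j \<beta>} \<and> \<delta> \<in> D} (\<theta> * (2 * s) * s)"
    proof (rule bsum_image_prod[where h = "\<lambda>\<beta> \<delta>. \<beta> * X j * \<delta>" and A = "{\<beta>\<in>level k. pre D X letters (okz n) j \<beta>}" and B = D])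
      show "bsum wd {\<beta>\<in>level k. pre D X letters (okz n) j \<beta>} (2 * s)" by (rule bsum_subset[OF Suc.IH]) auto
      show "bsum wd D s" by (rule bs)
      fix \<beta> \<delta> assume b: "\<beta> \<in> {\<beta>\<in>level k. pre D X letters (okz n) j \<beta>}" and d: "\<delta> \<in> D"
      have "nm g < c5 * \<bar>real_of_int (\<kappa> j)\<bar>" using big[OF j, of g] by simp
      hence k: "\<kappa> j \<noteq> 0" using nm_nonneg[of g] by (metis abs_zero leD mult_zero_right of_int_0)
      have "1 \<le> nm \<beta>" "1 \<le> nm \<delta>" using b d preD_SL DSL SL_nm_ge_1[OF _ n0] by auto
      thus "wd (\<beta> * X j * \<delta>) \<le> \<theta> * wd \<beta> * wd \<delta>"
        using b d j k DT pre_mono[OF _ DT] by (intro pre_wd) auto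
    qed (use \<theta>0 in auto)
  qed (auto simp: letters_def)
  moreover have "real (card letters) * (\<theta> * (2 * s) * s) \<le> s"
  proof -
    have "(8 * \<theta> * s) * s \<le> 1 * s" using th bsum_nonneg[OF bs] by (intro mult_right_mono) auto
    thus ?thesis by (simp add: letters_def mult_ac)
  qed
  ultimately have "bsum wd (\<Union>j\<in>letters. {\<beta> * X j * \<delta> |\<beta> \<delta>. \<beta> \<in> {\<beta>\<in>level k. pre D X letters (okz n) j \<beta>} \<and> \<delta> \<in> D}) s"
    unfolding bsum_def by force
  from bsum_Un[OF bs this] show ?case by simp
qed

lemma bsum_Dplus: "bsum wd Dplus (2 * s)"
  unfolding bsum_def
proof (intro allI impI)
  fix F assume F: "finite F \<and> F \<subseteq> Dplus"
  have "\<exists>k. F \<subseteq> level k"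
  proof -
    have "\<forall>w\<in>F. \<exists>k. w \<in> level k" using F Dplus_level by blast
    then obtain h where h: "\<And>w. w \<in> F \<Longrightarrow> w \<in> level (h w)" by metis
    have "w \<in> level (Max (h ` F))" if "w \<in> F" for w
    proof -
      have "h w \<le> Max (h ` F)" using F that by (intro Max_ge) auto
      thus ?thesis using h[OF that] level_mono' by blast
    qed
    thus ?thesis by blast
  qed
  thus "sum wd F \<le> 2 * s" using bsum_level F unfolding bsum_def by blast
qed

theorem tame_Dplus: "tame n g Dplus"
  unfolding tame_def
proof (intro conjI)
  show "subgroup Dplus (SL_int n)" by (rule Dplus_sub)
  show "ZZ n \<subseteq> Dplus" using ZD D_Dplus by blast
  show "\<exists>S. finite S \<and> S \<subseteq> SL n \<and> Dplus = generate (SL_int n) S" using gens unfolding Dplus_def by blast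
  show "wd summable_on Dplus" by (rule bsum_summable[OF bsum_Dplus]) auto
  show "\<exists>c>0. \<forall>a\<in>Dplus. \<forall>b\<in>Dplus. \<forall>q\<in>{g, iv n g}. c * nm a * nm b \<le> nm (a * q * b)" by (rule transversal)
  show "\<exists>y z. is_col n y \<and> is_row n z \<and> good T' y \<and> cogood T' z"
    using psh fsh good_T' cogood_T' by blast
  show "g * g \<notin> T'"
  proof
    assume "g * g \<in> T'"
    moreover have "g * g \<notin> T" using tm unfolding tame_def by blast
    ultimately show False using T'_cases lword_big[of "g * g" "g * g"] by blast
  qed
  show "\<forall>a\<in>Dplus. \<forall>b\<in>Dplus. a * g * b = g \<longrightarrow> a \<in> ZZ n"
  proof (intro ballI impI)
    fix a b assume ab: "a \<in> Dplus" "b \<in> Dplus" "a * g * b = g"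
    have "\<not> lword (a * g * b)" using lword_big[of g g] ab(3) by auto
    hence "a \<in> D \<and> b \<in> D" using mid_lword[OF ab(1,2), of g] by blast
    thus "a \<in> ZZ n" using ab(3) tm unfolding tame_def by blast
  qed
qed

end

section \<open>Transvections\<close>

definition tv :: "nat \<Rightarrow> int mat \<Rightarrow> int mat \<Rightarrow> int \<Rightarrow> int mat" where
  "tv n v f k = 1\<^sub>m n + k \<cdot>\<^sub>m (v * f)"

lemma tv_dim [simp]: "is_col n v \<Longrightarrow> dim_row (tv n v f k) = n" "is_row n f \<Longrightarrow> dim_col (tv n v f k) = n"
  unfolding tv_def by auto

lemma outer_ent:
  "dim_col A = 1 \<Longrightarrow> dim_row B = 1 \<Longrightarrow> i < dim_row A \<Longrightarrow> j < dim_col B \<Longrightarrow>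
   (A * B :: int mat) $$ (i,j) = A $$ (i,0) * B $$ (0,j)"
  by (subst index_mult_sum) auto

lemma scalar_middle:
  assumes "dim_col A = 1" "dim_row M = 1" "dim_col M = 1" "dim_row B = 1"
  shows "A * (M * B) = M $$ (0,0) \<cdot>\<^sub>m (A * B :: int mat)"
proof (rule eq_matI)
  fix i j assume "i < dim_row (M $$ (0,0) \<cdot>\<^sub>m (A * B))" "j < dim_col (M $$ (0,0) \<cdot>\<^sub>m (A * B))"
  hence ij: "i < dim_row A" "j < dim_col B" by auto
  have "(A * (M * B)) $$ (i,j) = A $$ (i,0) * (M $$ (0,0) * B $$ (0,j))"
    using outer_ent[of A "M * B" i j] outer_ent[of M B 0 j] assms ij by simp
  also have "\<dots> = M $$ (0,0) * (A * B) $$ (i,j)" using outer_ent[of A B i j] assms ij by simp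
  finally show "(A * (M * B)) $$ (i,j) = (M $$ (0,0) \<cdot>\<^sub>m (A * B)) $$ (i,j)" using ij by simp
qed auto

lemma smult_mult_left: "dim_col A = dim_row B \<Longrightarrow> (k \<cdot>\<^sub>m A) * B = k \<cdot>\<^sub>m (A * B :: int mat)"
  by (metis carrier_matI mult_smult_assoc_mat)

lemma smult_mult_right: "dim_col A = dim_row B \<Longrightarrow> A * (k \<cdot>\<^sub>m B) = k \<cdot>\<^sub>m (A * B :: int mat)"
  by (metis carrier_matI mult_smult_distrib)

text \<open>For \<open>A = 1\<close> this says that \<open>v * f\<close> squares to zero if \<open>f v = 0\<close>; in general it is what makes products of
transvections explicit.\<close>

lemma vf_square:
  assumes v: "is_col n v" and f: "is_row n f" and A: "is_sq n A"
  shows "(v * f) * A * (v * f) = bil n f A v \<cdot>\<^sub>m (v * f)"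
proof -
  have "(v * f) * A * (v * f) = v * ((f * A * v) * f)" using assms by (simp add: mat_assoc)
  also have "\<dots> = (f * A * v) $$ (0,0) \<cdot>\<^sub>m (v * f)" using assms by (intro scalar_middle) auto
  also have "(f * A * v) $$ (0,0) = bil n f A v" using assms by (intro bil_entry) auto
  finally show ?thesis .
qed

lemma vf_ent: "is_col n v \<Longrightarrow> is_row n f \<Longrightarrow> i < n \<Longrightarrow> j < n \<Longrightarrow> (v * f) $$ (i,j) = v $$ (i,0) * f $$ (0,j)"
  by (intro outer_ent) auto

lemma tv_mult:
  assumes v: "is_col n v" and f: "is_row n f" and 0: "dotm n f v = 0"
  shows "tv n v f a * tv n v f b = tv n v f (a + b)"
proof (rule eq_matI)
  fix i j assume "i < dim_row (tv n v f (a + b))" "j < dim_col (tv n v f (a + b))"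
  hence ij: "i < n" "j < n" using v f by auto
  have e: "tv n v f k $$ (i,j) = (if i = j then 1 else 0) + k * (v $$ (i,0) * f $$ (0,j))" if "i < n" "j < n" for i j k
    unfolding tv_def using that v f vf_ent[OF v f that] by (auto simp del: index_mult_mat(1))
  have "(tv n v f a * tv n v f b) $$ (i,j) = (\<Sum>m<n. ((if i = m then 1 else 0) + a * (v $$ (i,0) * f $$ (0,m)))
      * ((if m = j then 1 else 0) + b * (v $$ (m,0) * f $$ (0,j))))"
    using ij v f by (simp add: index_mult_sum e del: index_mult_mat(1))
  also have "\<dots> = (\<Sum>m<n. (if m = i then (if i = j then 1 else 0) + b * (v $$ (i,0) * f $$ (0,j)) else 0)
     + (if m = j then a * (v $$ (i,0) * f $$ (0,j)) else 0) + a * b * v $$ (i,0) * f $$ (0,j) * (f $$ (0,m) * v $$ (m,0)))"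
    by (intro sum.cong refl) (auto simp: algebra_simps)
  also have "\<dots> = (if i = j then 1 else 0) + b * (v $$ (i,0) * f $$ (0,j)) + a * (v $$ (i,0) * f $$ (0,j))
      + a * b * v $$ (i,0) * f $$ (0,j) * dotm n f v"
    using ij by (simp add: sum.distrib sum_distrib_left[symmetric] dotm_def)
  also have "\<dots> = tv n v f (a + b) $$ (i,j)" unfolding e[OF ij] 0 by (simp add: algebra_simps)
  finally show "(tv n v f a * tv n v f b) $$ (i,j) = tv n v f (a + b) $$ (i,j)" .
qed (use v f in auto)

lemma tv_0: "is_col n v \<Longrightarrow> is_row n f \<Longrightarrow> tv n v f 0 = 1\<^sub>m n"
  unfolding tv_def by (intro eq_matI) auto

text \<open>An even parameter makes the transvection the square of an integral matrix with integral inverse, and such a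
matrix has determinant \<open>1\<close> or \<open>-1\<close>.\<close>

lemma tv_SL:
  assumes v: "is_col n v" and f: "is_row n f" and 0: "dotm n f v = 0"
  shows "tv n v f (2 * k) \<in> SL n"
proof -
  have c: "tv n v f a \<in> carrier_mat n n" for a using v f by (intro carrier_matI) auto
  have "Determinant.det (tv n v f k) * Determinant.det (tv n v f (- k)) = 1"
    using det_mult[OF c c, of k "- k"] tv_mult[OF assms, of k "- k"] tv_0[OF v f] by simp
  hence "Determinant.det (tv n v f k) = 1 \<or> Determinant.det (tv n v f k) = - 1"
    by (simp only: zmult_eq_1_iff) blast
  hence "Determinant.det (tv n v f k) * Determinant.det (tv n v f k) = 1" by auto
  hence "Determinant.det (tv n v f (2 * k)) = 1"
    using det_mult[OF c c, of k k] tv_mult[OF assms, of k k] by simp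
  thus ?thesis using c v f unfolding SL_iff by auto
qed

lemma tv_iv:
  assumes v: "is_col n v" and f: "is_row n f" and 0: "dotm n f v = 0"
  shows "iv n (tv n v f (2 * k)) = tv n v f (2 * (- k))"
  using tv_SL[OF assms, of k] tv_SL[OF assms, of "- k"] tv_mult[OF assms, of "2 * k" "2 * (- k)"] tv_0[OF v f]
  by (intro iv_unique) auto

section \<open>Elements escaping a thin set\<close>

text \<open>A family in \<open>SL n\<close> whose norm grows linearly in \<open>m\<close>, while the minor in the rows 0 and 1 and the columns 1 and 2 is
\<open>m\<^sup>2\<close>. So \<open>wd\<close> is bounded below on it.\<close>

definition Rm :: "nat \<Rightarrow> nat \<Rightarrow> int mat" where
  "Rm n m = Matrix.mat n n (\<lambda>(i,j). if i = j then 1 else if (i = 0 \<and> j = 1) \<or> (i = 1 \<and> j = 2) then int m else 0)"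

lemma Rm_SL: "Rm n m \<in> SL n"
proof -
  have c: "Rm n m \<in> carrier_mat n n" unfolding Rm_def by simp
  have "upper_triangular (Rm n m)" unfolding Rm_def by (auto simp: upper_triangular_def)
  hence "Determinant.det (Rm n m) = prod_list (diag_mat (Rm n m))" using det_upper_triangular c by blast
  also have "diag_mat (Rm n m) = map (\<lambda>_. 1) [0..<n]" unfolding diag_mat_def Rm_def by (auto intro!: map_cong)
  also have "prod_list (map (\<lambda>_. 1 :: int) [0..<n]) = 1" by (induction n) auto
  finally show ?thesis using c unfolding SL_iff by auto
qed

lemma minor_le: 
  assumes "i < dim_row A" "j < dim_row A" "k < dim_col A" "l < dim_col A"
  shows "\<bar>real_of_int (A $$ (i,k) * A $$ (j,l) - A $$ (i,l) * A $$ (j,k))\<bar> \<le> n2 A"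
proof -
  let ?f = "\<lambda>i j k l. \<bar>real_of_int (A $$ (i,k) * A $$ (j,l) - A $$ (i,l) * A $$ (j,k))\<bar>"
  have "?f i j k l \<le> (\<Sum>l<dim_col A. ?f i j k l)" using assms by (intro member_le_sum[where f = "?f i j k"]) auto
  also have "\<dots> \<le> (\<Sum>k<dim_col A. \<Sum>l<dim_col A. ?f i j k l)"
    using assms by (intro member_le_sum[where f = "\<lambda>k. \<Sum>l<dim_col A. ?f i j k l"]) (auto intro!: sum_nonneg)
  also have "\<dots> \<le> (\<Sum>j<dim_row A. \<Sum>k<dim_col A. \<Sum>l<dim_col A. ?f i j k l)"
    using assms by (intro member_le_sum[where f = "\<lambda>j. \<Sum>k<dim_col A. \<Sum>l<dim_col A. ?f i j k l"]) (auto intro!: sum_nonneg)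
  also have "\<dots> \<le> n2 A" unfolding n2_def
    using assms by (intro member_le_sum[where f = "\<lambda>i. \<Sum>j<dim_row A. \<Sum>k<dim_col A. \<Sum>l<dim_col A. ?f i j k l"]) (auto intro!: sum_nonneg)
  finally show ?thesis .
qed

text \<open>On the matrices \<open>A * Rm n m * B\<close> with \<open>m \<ge> 1\<close> the function \<open>wd\<close> is bounded below, so a set on which \<open>wd\<close> is summable contains finitely
many of them only.\<close>

lemma escape:
  assumes n: "n \<ge> 3" and T: "T \<subseteq> SL n" "wd summable_on T"
    and Q: "finite Q" "Q \<subseteq> SL n \<times> SL n"
  shows "\<exists>r\<in>SL n. \<forall>(A,B)\<in>Q. A * r * B \<notin> T"
proof -
  have n0: "n > 0" using n by simp
  have fin: "finite {m. m \<ge> 1 \<and> A * Rm n m * B \<in> T}" if AB: "A \<in> SL n" "B \<in> SL n" for A B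
  proof -
    define K where "K = (n2 (iv n A) + 1) * (n2 (iv n B) + 1)"
    define N where "N = nm A * nm B * (real n * real n)"
    have K: "K > 0" unfolding K_def by (intro mult_pos_pos add_nonneg_pos) auto
    have N: "N > 0" unfolding N_def using SL_nm_ge_1[OF AB(1) n0] SL_nm_ge_1[OF AB(2) n0] n0 by (intro mult_pos_pos) auto
    define \<epsilon> where "\<epsilon> = 1 / (K * N\<^sup>2)"
    have e: "\<epsilon> > 0" unfolding \<epsilon>_def using K N by simp
    have wl: "\<epsilon> \<le> wd (A * Rm n m * B)" if m: "m \<ge> 1" for m
    proof -
      let ?R = "Rm n m" and ?W = "A * Rm n m * B"
      have R: "?R \<in> SL n" by (rule Rm_SL)
      have W: "?W \<in> SL n" using AB R by auto
      have m0: "0 < real m" using m by simp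
      have "(real m)\<^sup>2 = \<bar>real_of_int (?R $$ (0,1) * ?R $$ (1,2) - ?R $$ (0,2) * ?R $$ (1,1))\<bar>"
        unfolding Rm_def using n by (simp add: power2_eq_square)
      also have "\<dots> \<le> n2 ?R" using R n by (intro minor_le) auto
      also have "?R = iv n A * ?W * iv n B" using AB R by (simp add: SL_assoc)
      also have "n2 (iv n A * ?W * iv n B) \<le> n2 (iv n A) * n2 ?W * n2 (iv n B)"
        using AB W by (intro order_trans[OF n2_mult] mult_right_mono n2_mult) auto
      also have "\<dots> \<le> (n2 (iv n A) + 1) * n2 ?W * (n2 (iv n B) + 1)" by (intro mult_mono mult_nonneg_nonneg) auto
      finally have a: "(real m)\<^sup>2 \<le> K * n2 ?W" unfolding K_def by (simp add: mult_ac)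
      have "nm ?W \<le> nm (A * ?R) * nm B" using AB R by (intro nm_mult) auto
      also have "\<dots> \<le> nm A * nm ?R * nm B" using AB R by (intro mult_right_mono nm_mult) auto
      also have "\<dots> \<le> nm A * (real n * real n * real m) * nm B"
        using m by (intro mult_right_mono mult_left_mono nm_le_entries) (auto simp: Rm_def)
      finally have b: "nm ?W \<le> N * real m" unfolding N_def by (simp add: mult_ac)
      have p: "0 < nm ?W" using SL_nm_ge_1[OF W n0] by simp
      have "(nm ?W)\<^sup>2 \<le> (N * real m)\<^sup>2" using b p by (intro power_mono) auto
      also have "\<dots> = N\<^sup>2 * (real m)\<^sup>2" by (simp add: power_mult_distrib)
      also have "\<dots> \<le> N\<^sup>2 * (K * n2 ?W)" using a by (intro mult_left_mono) auto
      finally show ?thesis unfolding \<epsilon>_def wd_def using p K N by (simp add: field_simps)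
    qed
    have "finite {\<tau>\<in>T. \<epsilon> \<le> wd \<tau>}" using finite_large_summands[OF T(2) e] by simp
    moreover have "inj_on (\<lambda>m. A * Rm n m * B) {m. m \<ge> 1 \<and> A * Rm n m * B \<in> T}"
    proof (rule inj_onI)
      fix m m' assume "A * Rm n m * B = A * Rm n m' * B"
      moreover have "iv n A * (A * Rm n m * B) * iv n B = Rm n m" for m using AB Rm_SL[of n m] by (simp add: SL_assoc)
      ultimately have "Rm n m = Rm n m'" by metis
      hence "Rm n m $$ (0,1) = Rm n m' $$ (0,1)" by simp
      thus "m = m'" unfolding Rm_def using n by simp
    qed
    moreover have "(\<lambda>m. A * Rm n m * B) ` {m. m \<ge> 1 \<and> A * Rm n m * B \<in> T} \<subseteq> {\<tau>\<in>T. \<epsilon> \<le> wd \<tau>}" using wl by auto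
    ultimately show ?thesis by (meson finite_imageD finite_subset)
  qed
  have "finite (\<Union>q\<in>Q. {m. m \<ge> 1 \<and> fst q * Rm n m * snd q \<in> T})" using Q fin by (intro finite_UN_I) auto
  moreover have "infinite {1::nat..}" by (rule infinite_Ici)
  ultimately have "infinite ({1::nat..} - (\<Union>q\<in>Q. {m. m \<ge> 1 \<and> fst q * Rm n m * snd q \<in> T}))" by (rule Diff_infinite_finite)
  then obtain m where m: "m \<in> {1::nat..} - (\<Union>q\<in>Q. {m. m \<ge> 1 \<and> fst q * Rm n m * snd q \<in> T})" using infinite_imp_nonempty by blast
  show ?thesis
  proof (rule bexI[OF _ Rm_SL[of n m]], rule ballI)
    fix q assume "q \<in> Q"
    thus "case q of (A, B) \<Rightarrow> A * Rm n m * B \<notin> T" using m by (cases q) auto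
  qed
qed

section \<open>The extension step\<close>

text \<open>The product of a transvection and a conjugate of it is, for large \<open>k\<close>, dominated by a rank one matrix with a coefficient of order
\<open>k\<^sup>2\<close>, and the rest is of order \<open>k\<close>.\<close>

lemma loxodromic_expand:
  assumes v: "is_col n v" and f: "is_row n f" and u: "u \<in> SL n"
  shows "tv n v f k * (u * tv n v f k * iv n u) =
     (k * k * bil n f u v) \<cdot>\<^sub>m (v * (f * iv n u)) + (1\<^sub>m n + k \<cdot>\<^sub>m (v * f + u * (v * f) * iv n u))"
    and "(u * tv n v f k * iv n u) * tv n v f k =
     (k * k * bil n f (iv n u) v) \<cdot>\<^sub>m ((u * v) * f) + (1\<^sub>m n + k \<cdot>\<^sub>m (v * f + u * (v * f) * iv n u))"
proof -
  let ?P = "v * f" and ?Q = "u * (v * f) * iv n u"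
  have P: "is_sq n ?P" and Q: "is_sq n ?Q" using v f u by auto
  have 1: "A * (1\<^sub>m n + k \<cdot>\<^sub>m B) = A + k \<cdot>\<^sub>m (A * B)" if "is_sq n A" "is_sq n B" for A B
  proof -
    have "A * (1\<^sub>m n + k \<cdot>\<^sub>m B) = A * (k \<cdot>\<^sub>m B + 1\<^sub>m n)" using that by (intro arg_cong[where f = "\<lambda>x. A * x"] eq_matI) auto
    also have "\<dots> = k \<cdot>\<^sub>m (A * B) + A * 1\<^sub>m n" using that by (intro mult_scaled_add) auto
    also have "\<dots> = A + k \<cdot>\<^sub>m (A * B)" using that by (intro eq_matI) auto
    finally show ?thesis .
  qed
  have 2: "(1\<^sub>m n + k \<cdot>\<^sub>m B) * A = A + k \<cdot>\<^sub>m (B * A)" if "is_sq n A" "is_sq n B" for A B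
  proof -
    have "(1\<^sub>m n + k \<cdot>\<^sub>m B) * A = (1 \<cdot>\<^sub>m 1\<^sub>m n + k \<cdot>\<^sub>m B) * A" using that by (intro arg_cong[where f = "\<lambda>x. x * A"] eq_matI) auto
    also have "\<dots> = 1 \<cdot>\<^sub>m (1\<^sub>m n * A) + k \<cdot>\<^sub>m (B * A)" using that by (intro lincomb_mult) auto
    also have "\<dots> = A + k \<cdot>\<^sub>m (B * A)" using that by (intro eq_matI) auto
    finally show ?thesis .
  qed
  have cj: "u * tv n v f k * iv n u = 1\<^sub>m n + k \<cdot>\<^sub>m ?Q"
  proof -
    have "u * tv n v f k = u + k \<cdot>\<^sub>m (u * ?P)" unfolding tv_def using u P by (intro 1) auto
    also have "\<dots> = 1 \<cdot>\<^sub>m u + k \<cdot>\<^sub>m (u * ?P)" using u P by (intro eq_matI) auto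
    also have "\<dots> * iv n u = 1 \<cdot>\<^sub>m (u * iv n u) + k \<cdot>\<^sub>m (u * ?P * iv n u)" using u P by (intro lincomb_mult) auto
    also have "\<dots> = 1\<^sub>m n + k \<cdot>\<^sub>m ?Q" using u P by (intro eq_matI) auto
    finally show ?thesis .
  qed
  have PQ: "?P * ?Q = bil n f u v \<cdot>\<^sub>m (v * (f * iv n u))"
  proof -
    have "?P * ?Q = ?P * u * ?P * iv n u" using v f u by (simp add: mat_assoc)
    also have "?P * u * ?P = bil n f u v \<cdot>\<^sub>m ?P" using v f u by (intro vf_square) auto
    also have "\<dots> * iv n u = bil n f u v \<cdot>\<^sub>m (?P * iv n u)"
      using v f u by (intro smult_mult_left) auto
    also have "?P * iv n u = v * (f * iv n u)" using v f u by (intro mat_assoc) auto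
    finally show ?thesis .
  qed
  have QP: "?Q * ?P = bil n f (iv n u) v \<cdot>\<^sub>m ((u * v) * f)"
  proof -
    have "?Q * ?P = u * (?P * iv n u * ?P)" using v f u by (simp add: mat_assoc)
    also have "?P * iv n u * ?P = bil n f (iv n u) v \<cdot>\<^sub>m ?P" using v f u by (intro vf_square) auto
    also have "u * (bil n f (iv n u) v \<cdot>\<^sub>m ?P) = bil n f (iv n u) v \<cdot>\<^sub>m (u * ?P)"
      using v f u by (intro smult_mult_right) auto
    also have "bil n f (iv n u) v \<cdot>\<^sub>m (u * ?P) = bil n f (iv n u) v \<cdot>\<^sub>m ((u * v) * f)"
      using mat_assoc[of u v f] v f u by simp
    finally show ?thesis .
  qed
  have "tv n v f k * (u * tv n v f k * iv n u) = tv n v f k + k \<cdot>\<^sub>m (tv n v f k * ?Q)"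
    unfolding cj using v f Q by (intro 1) auto
  also have "tv n v f k * ?Q = ?Q + k \<cdot>\<^sub>m (?P * ?Q)" unfolding tv_def using P Q by (intro 2) auto
  finally show "tv n v f k * (u * tv n v f k * iv n u) =
     (k * k * bil n f u v) \<cdot>\<^sub>m (v * (f * iv n u)) + (1\<^sub>m n + k \<cdot>\<^sub>m (?P + ?Q))"
    unfolding PQ unfolding tv_def using v f u by (intro eq_matI) (auto simp: algebra_simps simp del: index_mult_mat(1))
  have "(u * tv n v f k * iv n u) * tv n v f k = tv n v f k + k \<cdot>\<^sub>m (?Q * tv n v f k)"
    unfolding cj using v f Q by (intro 2) auto
  also have "?Q * tv n v f k = ?Q + k \<cdot>\<^sub>m (?Q * ?P)" unfolding tv_def using P Q by (intro 1) auto
  finally show "(u * tv n v f k * iv n u) * tv n v f k =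
     (k * k * bil n f (iv n u) v) \<cdot>\<^sub>m ((u * v) * f) + (1\<^sub>m n + k \<cdot>\<^sub>m (?P + ?Q))"
    unfolding QP unfolding tv_def using v f u by (intro eq_matI) (auto simp: algebra_simps simp del: index_mult_mat(1))
qed

lemma sandwich:
  assumes "is_sq n l" "is_sq n r" "is_col n p" "is_row n f" "is_sq n E"
  shows "l * (k \<cdot>\<^sub>m (p * f) + E) * r = k \<cdot>\<^sub>m ((l * p) * (f * r)) + l * E * r"
proof -
  have "l * (k \<cdot>\<^sub>m (p * f) + E) = k \<cdot>\<^sub>m (l * (p * f)) + l * E" using assms by (intro mult_scaled_add) auto
  also have "\<dots> = k \<cdot>\<^sub>m (l * (p * f)) + 1 \<cdot>\<^sub>m (l * E)" using assms by (intro eq_matI) auto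
  also have "\<dots> * r = k \<cdot>\<^sub>m (l * (p * f) * r) + 1 \<cdot>\<^sub>m (l * E * r)" using assms by (intro lincomb_mult) auto
  also have "l * (p * f) * r = (l * p) * (f * r)" using assms by (simp add: mat_assoc)
  also have "1 \<cdot>\<^sub>m (l * E * r) = l * E * r" using assms by (intro eq_matI) auto
  finally show ?thesis .
qed

lemma abs_ge_1_int: "(x::int) \<noteq> 0 \<Longrightarrow> 1 \<le> \<bar>real_of_int x\<bar>"
proof -
  assume "x \<noteq> 0"
  hence "1 \<le> \<bar>x\<bar>" by linarith
  hence "real_of_int 1 \<le> real_of_int \<bar>x\<bar>" by (simp only: of_int_le_iff)
  thus ?thesis by simp
qed

lemma ZZ_T_mult:
  assumes D: "subgroup D (SL_int n)" "ZZ n \<subseteq> D" and g: "g \<in> SL n" and t: "\<tau> \<in> TT n g D" and z: "z \<in> ZZ n"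
  shows "\<tau> * z \<in> TT n g D"
proof (cases "\<tau> \<in> D")
  case True thus ?thesis using sub_SL(3)[OF D(1)] D(2) z unfolding TT_def by blast
next
  case False
  then obtain a q b where a: "a \<in> D" "q \<in> {g, iv n g}" "b \<in> D" "\<tau> = a * q * b" using t unfolding TT_def mid_def by blast
  have S: "a \<in> SL n" "b \<in> SL n" "q \<in> SL n" "z \<in> SL n" using a sub_SL(1)[OF D(1)] g ZZ_SL[OF z] by auto
  have "\<tau> * z = a * q * (b * z)" unfolding a using S by (simp add: mat_assoc)
  moreover have "b * z \<in> D" using a(3) z D sub_SL(3)[OF D(1)] by blast
  ultimately show ?thesis using a unfolding TT_def mid_def by blast
qed

text \<open>The new elements are \<open>x = s u s u\<^sup>-\<^sup>1\<close> with a transvection \<open>s = 1 + K v f\<close>, and \<open>h x e\<close>. By \<open>loxodromic_expand\<close> these and their inverses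
are close to multiples of \<open>(Q v) (f R)\<close>, where \<open>Q\<close> and \<open>R\<close> are the values \<open>Qq i\<close> and \<open>Rr i\<close> for the respective letter \<open>i\<close>. The separation condition of
\<open>pingpong\<close> asks for lower bounds for \<open>f (Rr i * \<tau> * Qq j) v\<close>, and these are provided by \<open>generic_transvection\<close> unless \<open>Rr i * \<tau> * Qq j\<close> is
central. To exclude that, \<open>u\<close>, \<open>a\<close> and \<open>b\<close> are chosen such that \<open>Qq j * Rr i\<close> is not in \<open>TT n g D\<close>, except for mutually inverse letters,
where it is the identity and \<open>okz\<close> excludes central \<open>\<tau>\<close>.\<close>

lemma extension_step:
  assumes n3: "n \<ge> 3" and g: "g \<in> SL n" and tm: "tame n g D"
    and h: "h \<in> SL n" "h \<notin> TT n g D" and e: "e \<in> SL n" "e \<notin> TT n g D" and P: "finite P"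
  shows "\<exists>D'. tame n g D' \<and> D \<subseteq> D' \<and> TT n g D' \<inter> P \<subseteq> TT n g D \<and> (\<exists>x\<in>D'. h * x * e \<in> D')"
proof -
  have n0: "n > 0" and n2: "n \<ge> 2" using n3 by auto
  let ?T = "TT n g D"
  note tT = tame_TT[OF tm g n0]
  have Dsub: "subgroup D (SL_int n)" and ZD: "ZZ n \<subseteq> D" using tm unfolding tame_def by auto
  obtain L where L: "finite L" "L \<subseteq> SL n" "?T \<subseteq> reach n L ?T" using tT(5) by blast
  obtain y z where yz: "is_col n y" "good ?T y" "is_row n z" "cogood ?T z" using tm unfolding tame_def by blast
  \<comment> \<open>the elements \<open>u\<close>, \<open>a\<close> and \<open>b\<close> avoid just those translates of \<open>TT n g D\<close> that \<open>QRne\<close> refers to below\<close>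
  obtain u where u: "u \<in> SL n" "u \<notin> ?T" "u * iv n h \<notin> ?T" "iv n e * u \<notin> ?T" "iv n e * u * iv n h \<notin> ?T"
  proof -
    have "\<exists>r\<in>SL n. \<forall>(A,B)\<in>{(1\<^sub>m n,1\<^sub>m n),(1\<^sub>m n,iv n h),(iv n e,1\<^sub>m n),(iv n e, iv n h)}. A * r * B \<notin> ?T"
      by (rule escape[OF n3 tT(1,3)]) (use h e in auto)
    then obtain r where "r \<in> SL n" "\<forall>(A,B)\<in>{(1\<^sub>m n,1\<^sub>m n),(1\<^sub>m n,iv n h),(iv n e,1\<^sub>m n),(iv n e, iv n h)}. A * r * B \<notin> ?T" by blast
    thus thesis using that[of r] h e by auto
  qed
  obtain a where a: "a \<in> SL n" "\<And>r. r \<in> {iv n u, 1\<^sub>m n, iv n u * e, iv n h} \<Longrightarrow> a * r \<notin> ?T"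
  proof -
    have "\<exists>r\<in>SL n. \<forall>(A,B)\<in>{1\<^sub>m n} \<times> {iv n u, 1\<^sub>m n, iv n u * e, iv n h}. A * r * B \<notin> ?T"
      by (rule escape[OF n3 tT(1,3)]) (use u h e in auto)
    then obtain r where r: "r \<in> SL n" "\<forall>(A,B)\<in>{1\<^sub>m n} \<times> {iv n u, 1\<^sub>m n, iv n u * e, iv n h}. A * r * B \<notin> ?T" by blast
    show thesis by (rule that[OF r(1)]) (use r in auto)
  qed
  obtain b where b: "b \<in> SL n" "\<And>q. q \<in> {1\<^sub>m n, u, h, iv n e * u, a} \<Longrightarrow> q * b \<notin> ?T"
  proof -
    have "\<exists>r\<in>SL n. \<forall>(A,B)\<in>{1\<^sub>m n, u, h, iv n e * u, a} \<times> {1\<^sub>m n}. A * r * B \<notin> ?T"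
      by (rule escape[OF n3 tT(1,3)]) (use u h e a in auto)
    then obtain r where r: "r \<in> SL n" "\<forall>(A,B)\<in>{1\<^sub>m n, u, h, iv n e * u, a} \<times> {1\<^sub>m n}. A * r * B \<notin> ?T" by blast
    show thesis
    proof (rule that[OF r(1)])
      fix q assume q: "q \<in> {1\<^sub>m n, u, h, iv n e * u, a}"
      hence "q * r * 1\<^sub>m n \<notin> ?T" using r(2) by blast
      moreover have "q * r \<in> SL n" using q u h e a r by auto
      ultimately show "q * r \<notin> ?T" by simp
    qed
  qed
  define Rr where "Rr = (\<lambda>i. case i of Xp \<Rightarrow> iv n u | Xm \<Rightarrow> 1\<^sub>m n | Yp \<Rightarrow> iv n u * e | Ym \<Rightarrow> iv n h | St \<Rightarrow> b)"
  define Qq where "Qq = (\<lambda>i. case i of Xp \<Rightarrow> 1\<^sub>m n | Xm \<Rightarrow> u | Yp \<Rightarrow> h | Ym \<Rightarrow> iv n e * u | St \<Rightarrow> a)"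
  have RS: "Rr i \<in> SL n" and QS: "Qq i \<in> SL n" for i
    unfolding Rr_def Qq_def using u h e a b by (cases i; simp)+
  have ivT: "x \<notin> ?T" if "x \<in> SL n" "iv n x \<notin> ?T" for x using tT(4) that by blast
  have QRexempt: "Qq j * Rr i = 1\<^sub>m n" if "i = bar j" "j \<noteq> St" for i j
    using that u h e unfolding Rr_def Qq_def by (cases j) (simp_all add: mat_assoc)
  have QRne: "Qq j * Rr i \<notin> ?T" if "i \<noteq> bar j \<or> j = St" for i j
  proof -
    have 1: "iv n u \<notin> ?T" "h * iv n u \<notin> ?T" "iv n e \<notin> ?T" "iv n u * e \<notin> ?T" "h * (iv n u * e) \<notin> ?T" "iv n h \<notin> ?T"
      using ivT[of "iv n u"] ivT[of "h * iv n u"] ivT[of "iv n e"] ivT[of "iv n u * e"] ivT[of "h * (iv n u * e)"] ivT[of "iv n h"] u h e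
      by (simp_all add: iv_mult)
    have 2: "iv n e * u * iv n u = iv n e" "u * (iv n u * e) = e" using u e by (simp_all add: mat_assoc)
    have St1: "Qq St * Rr i \<notin> ?T" for i
      using a(2) b(2)[of a] unfolding Qq_def Rr_def by (cases i) auto
    have St2: "Qq j * Rr St \<notin> ?T" for j
      using b(2) unfolding Qq_def Rr_def by (cases j) auto
    show ?thesis
    proof (cases "i = St \<or> j = St")
      case True thus ?thesis using St1 St2 by blast
    next
      case False
      show ?thesis using that False 1 2 u h e unfolding Qq_def Rr_def
        by (cases i; cases j) (simp_all)
    qed
  qed
  have nonz: "Rr i * \<tau> * Qq j \<notin> ZZ n" if t: "\<tau> \<in> ?T" and ok: "okz n i \<tau> j" for i \<tau> j
  proof
    assume zz: "Rr i * \<tau> * Qq j \<in> ZZ n"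
    \<comment> \<open>if \<open>Rr i * \<tau> * Qq j = \<zeta>\<close> is central, then \<open>\<tau> * (Qq j * Rr i) = \<zeta>\<close>, and so \<open>Qq j * Rr i\<close> is in \<open>TT n g D\<close>\<close>
    define \<zeta> where "\<zeta> = Rr i * \<tau> * Qq j"
    have S: "\<tau> \<in> SL n" "\<zeta> \<in> SL n" using t tT(1) zz ZZ_SL unfolding \<zeta>_def by auto
    have "Qq j * \<zeta> * Rr i = Qq j * Rr i * \<tau> * (Qq j * Rr i)"
      unfolding \<zeta>_def using S RS[of i] QS[of j] by (simp add: mat_assoc)
    also have "Qq j * \<zeta> * Rr i = Qq j * Rr i * \<zeta>"
      using ZZ_comm[of \<zeta> n "Rr i"] zz RS[of i] QS[of j] S unfolding \<zeta>_def[symmetric] by (simp add: mat_assoc)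
    finally have "Qq j * Rr i * \<zeta> = Qq j * Rr i * (\<tau> * (Qq j * Rr i))"
      using S RS[of i] QS[of j] by (simp add: mat_assoc)
    hence "iv n (Qq j * Rr i) * (Qq j * Rr i * \<zeta>) = iv n (Qq j * Rr i) * (Qq j * Rr i * (\<tau> * (Qq j * Rr i)))" by simp
    hence zt: "\<zeta> = \<tau> * (Qq j * Rr i)" using S RS[of i] QS[of j] iv_l'[of "Qq j * Rr i" n] by simp
    show False
    proof (cases "i = bar j \<and> j \<noteq> St")
      case True
      hence "\<zeta> = \<tau>" using zt QRexempt[of i j] S by simp
      thus False using ok True zz unfolding okz_def \<zeta>_def[symmetric] by auto
    next
      case False
      hence ne: "Qq j * Rr i \<notin> ?T" using QRne by blast
      have "Qq j * Rr i = iv n \<tau> * \<zeta>" unfolding zt using S RS[of i] QS[of j] by simp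
      moreover have "iv n \<tau> * \<zeta> \<in> ?T" using ZZ_T_mult[OF Dsub ZD g tT(4)[OF t]] zz unfolding \<zeta>_def[symmetric] by blast
      ultimately show False using ne by simp
    qed
  qed
  have finR: "finite (range Rr)" "finite (range Qq)"
  proof -
    have "(UNIV :: ix set) = {Xp, Xm, Yp, Ym, St}" using ix.exhaust by auto
    hence "finite (UNIV :: ix set)" by (metis finite.emptyI finite_insert)
    thus "finite (range Rr)" "finite (range Qq)" by auto
  qed
  obtain v f c where vf: "is_col n v" "is_row n f" "dotm n f v = 0" "c > 0"
    "\<And>r q \<tau>. r \<in> range Rr \<Longrightarrow> q \<in> range Qq \<Longrightarrow> \<tau> \<in> ?T \<Longrightarrow> r * \<tau> * q \<notin> ZZ n \<Longrightarrow> c * nm \<tau> \<le> nm (f * (r * \<tau> * q) * v)"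
  proof -
    have "\<exists>v f c. is_col n v \<and> is_row n f \<and> dotm n f v = 0 \<and> c > 0 \<and>
      (\<forall>r\<in>range Rr. \<forall>q\<in>range Qq. \<forall>\<tau>\<in>?T. r * \<tau> * q \<notin> ZZ n \<longrightarrow> c * nm \<tau> \<le> nm (f * (r * \<tau> * q) * v))"
      by (rule generic_transvection[OF n2 tT(1-4) L yz]) (use finR RS QS in auto)
    thus thesis using that by blast
  qed
  define p \<phi> where "p = (\<lambda>i. Qq i * v)" and "\<phi> = (\<lambda>i. f * Rr i)"
  have psh: "is_col n (p i)" and fsh: "is_row n (\<phi> i)" for i
    unfolding p_def \<phi>_def using vf(1,2) RS[of i] QS[of i] by auto
  have sep: "c * nm \<tau> \<le> nm (\<phi> i * \<tau> * p j)" if t: "\<tau> \<in> ?T" and ok: "okz n i \<tau> j" for \<tau> i j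
  proof -
    have S: "\<tau> \<in> SL n" using t tT(1) by blast
    have "\<phi> i * \<tau> * p j = f * (Rr i * \<tau> * Qq j) * v"
      unfolding p_def \<phi>_def using vf(1,2) RS[of i] QS[of j] S by (simp add: mat_assoc)
    thus ?thesis using vf(5)[of "Rr i" "Qq j" \<tau>] t nonz[OF t ok] by simp
  qed
  define \<alpha> \<alpha>' where "\<alpha> = bil n f u v" and "\<alpha>' = bil n f (iv n u) v"
  have nm1: "1 \<le> nm (1\<^sub>m n :: int mat)" using SL_nm_ge_1[OF SL_one n0] .
  have \<alpha>0: "\<alpha> \<noteq> 0"
  proof -
    have "c * nm (1\<^sub>m n) \<le> nm (\<phi> Xm * 1\<^sub>m n * p Xm)" by (rule sep[OF tT(2)]) (simp add: okz_def)
    also have "\<phi> Xm * 1\<^sub>m n * p Xm = f * u * v" unfolding p_def \<phi>_def Rr_def Qq_def using vf(1,2) u(1) by (simp add: mat_assoc)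
    also have "nm (f * u * v) = \<bar>real_of_int \<alpha>\<bar>" unfolding \<alpha>_def using vf(1,2) u(1) by (intro nm_bil) auto
    finally have "c * nm (1\<^sub>m n) \<le> \<bar>real_of_int \<alpha>\<bar>" .
    moreover have "0 < c * nm (1\<^sub>m n)" using vf(4) nm1 by simp
    ultimately show ?thesis by auto
  qed
  have \<alpha>'0: "\<alpha>' \<noteq> 0"
  proof -
    have "c * nm (1\<^sub>m n) \<le> nm (\<phi> Xp * 1\<^sub>m n * p Xp)" by (rule sep[OF tT(2)]) (simp add: okz_def)
    also have "\<phi> Xp * 1\<^sub>m n * p Xp = f * iv n u * v" unfolding p_def \<phi>_def Rr_def Qq_def using vf(1,2) u(1) by (simp add: mat_assoc)
    also have "nm (f * iv n u * v) = \<bar>real_of_int \<alpha>'\<bar>" unfolding \<alpha>'_def using vf(1,2) u(1) by (intro nm_bil) auto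
    finally have "c * nm (1\<^sub>m n) \<le> \<bar>real_of_int \<alpha>'\<bar>" .
    moreover have "0 < c * nm (1\<^sub>m n)" using vf(4) nm1 by simp
    ultimately show ?thesis by auto
  qed
  \<comment> \<open>The relative error \<open>\<eta>\<close> has to be at most \<open>\<eta>0\<close>, which collects the requirements of \<open>pingpong\<close> and of \<open>extension\<close>. As the error terms
     are of order \<open>ME * K\<close> and the main terms of order \<open>K\<^sup>2\<close>, it is achieved by a large \<open>K\<close>; \<open>K\<close> is even because of \<open>tv_SL\<close>.\<close>
  define C where "C = 1 + (\<Sum>i\<in>{Xp, Xm, Yp, Ym, St}. nm (p i) + nm (\<phi> i))"
  have Cb: "nm (p i) \<le> C" "nm (\<phi> i) \<le> C" for i
  proof -
    have "nm (p i) + nm (\<phi> i) \<le> (\<Sum>i\<in>{Xp, Xm, Yp, Ym, St}. nm (p i) + nm (\<phi> i))"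
      by (intro member_le_sum[where f = "\<lambda>i. nm (p i) + nm (\<phi> i)"]) (cases i, auto)
    thus "nm (p i) \<le> C" "nm (\<phi> i) \<le> C" unfolding C_def using nm_nonneg[of "p i"] nm_nonneg[of "\<phi> i"] by linarith+
  qed
  have C1: "1 \<le> C" unfolding C_def by (simp add: sum_nonneg)
  define c3 where "c3 = c / (2 * (C + 1))"
  define c5 where "c5 = c3 * (c / (2 * C))"
  have c30: "c3 > 0" unfolding c3_def using vf(4) C1 by simp
  have c50: "c5 > 0" unfolding c5_def using c30 vf(4) C1 by simp
  obtain s where s: "bsum wd D s"
  proof -
    have "wd summable_on D" using tm unfolding tame_def by blast
    thus thesis using that summable_bsum[of wd D] by auto
  qed
  have s0: "0 \<le> s" by (rule bsum_nonneg[OF s])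
  define B0 where "B0 = v * f + u * (v * f) * iv n u"
  have B0: "is_sq n B0" unfolding B0_def using vf(1,2) u(1) by auto
  define ME where "ME = (nm (1\<^sub>m n) + nm B0) * (1 + nm h * nm e + nm (iv n e) * nm (iv n h))"
  have ME1: "0 < ME" unfolding ME_def using nm1 by (intro mult_pos_pos add_pos_nonneg) auto
  define \<eta>0 where "\<eta>0 = min (min c3 (c * c3 / (2 * C))) (min (c3\<^sup>2 / 2) (min 1 (c5\<^sup>2 / ((4 * (C * C) + 2) * (8 * (s + 1))))))"
  have \<eta>00: "\<eta>0 > 0" unfolding \<eta>0_def using c30 c50 vf(4) C1 s0 by (auto intro!: divide_pos_pos mult_pos_pos add_nonneg_pos)
  define PP where "PP = P \<union> {g, g * g}"
  have PP: "finite PP" unfolding PP_def using P by simp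
  define k :: nat where "k = nat \<lceil>1 + ME / \<eta>0 + (sum nm PP + 1) / c5\<rceil>"
  have k: "1 + ME / \<eta>0 + (sum nm PP + 1) / c5 \<le> real k" unfolding k_def by linarith
  have sP: "0 \<le> sum nm PP" by (intro sum_nonneg) auto
  define K where "K = 2 * int k"
  let ?K = "real_of_int K"
  have t1: "0 \<le> ME / \<eta>0" "0 \<le> (sum nm PP + 1) / c5" using ME1 \<eta>00 c50 sP by auto
  have K1: "1 \<le> ?K" "ME / \<eta>0 \<le> ?K" "(sum nm PP + 1) / c5 \<le> ?K" using k t1 unfolding K_def by auto
  define \<eta> where "\<eta> = ME / ?K"
  have \<eta>p: "0 \<le> \<eta>" unfolding \<eta>_def using ME1 K1 by simp
  have \<eta>le: "\<eta> \<le> \<eta>0" unfolding \<eta>_def using K1 \<eta>00 by (simp add: field_simps)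
  have \<eta>s: "\<eta> \<le> c3" "2 * C * \<eta> \<le> c * c3" "2 * \<eta> \<le> c3\<^sup>2" "\<eta> \<le> 1" "\<eta> * ((4 * (C * C) + 2) * (8 * (s + 1))) \<le> c5\<^sup>2"
  proof -
    have l: "\<eta> \<le> c3" "\<eta> \<le> c * c3 / (2 * C)" "\<eta> \<le> c3\<^sup>2 / 2" "\<eta> \<le> 1" "\<eta> \<le> c5\<^sup>2 / ((4 * (C * C) + 2) * (8 * (s + 1)))"
      using \<eta>le unfolding \<eta>0_def by auto
    show "\<eta> \<le> c3" "\<eta> \<le> 1" using l by auto
    show "2 * C * \<eta> \<le> c * c3" using l(2) C1 by (simp add: field_simps)
    show "2 * \<eta> \<le> c3\<^sup>2" using l(3) by simp
    have "0 < (4 * (C * C) + 2) * (8 * (s + 1))" using s0 by (intro mult_pos_pos add_nonneg_pos) auto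
    thus "\<eta> * ((4 * (C * C) + 2) * (8 * (s + 1))) \<le> c5\<^sup>2" using l(5) by (subst (asm) pos_le_divide_eq) auto
  qed
  define x where "x = tv n v f K * (u * tv n v f K * iv n u)"
  have tvS: "tv n v f K \<in> SL n" unfolding K_def using vf by (intro tv_SL) auto
  have tvI: "iv n (tv n v f K) = tv n v f (- K)" unfolding K_def using tv_iv[OF vf(1-3), of "int k"] by simp
  have xS: "x \<in> SL n" unfolding x_def using tvS u(1) by auto
  have ivx: "iv n x = (u * tv n v f (- K) * iv n u) * tv n v f (- K)"
    unfolding x_def using tvS u(1) tvI[symmetric] by (simp add: iv_mult mat_assoc)
  define X where "X = (\<lambda>i. case i of Xp \<Rightarrow> x | Xm \<Rightarrow> iv n x | Yp \<Rightarrow> h * x * e | Ym \<Rightarrow> iv n e * iv n x * iv n h | St \<Rightarrow> 1\<^sub>m n)"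
  define \<kappa> where "\<kappa> = (\<lambda>i. case i of Xp \<Rightarrow> K * K * \<alpha> | Xm \<Rightarrow> K * K * \<alpha>' | Yp \<Rightarrow> K * K * \<alpha> | Ym \<Rightarrow> K * K * \<alpha>' | St \<Rightarrow> 1)"
  define E1 E2 where "E1 = 1\<^sub>m n + K \<cdot>\<^sub>m B0" and "E2 = 1\<^sub>m n + (- K) \<cdot>\<^sub>m B0"
  define E where "E = (\<lambda>i. case i of Xp \<Rightarrow> E1 | Xm \<Rightarrow> E2 | Yp \<Rightarrow> h * E1 * e | Ym \<Rightarrow> iv n e * E2 * iv n h | St \<Rightarrow> 1\<^sub>m n)"
  have E12: "is_sq n E1" "is_sq n E2" unfolding E1_def E2_def using B0 by auto
  have XS: "X i \<in> SL n" for i unfolding X_def using xS h(1) e(1) by (cases i) auto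
  have Xbar: "X (bar i) = iv n (X i)" if "i \<in> letters" for i
    using that xS h(1) e(1) unfolding X_def letters_def by (cases i) (auto simp: iv_mult mat_assoc)
  have x1: "x = (K * K * \<alpha>) \<cdot>\<^sub>m (v * (f * iv n u)) + E1"
    unfolding x_def E1_def B0_def \<alpha>_def using loxodromic_expand(1)[OF vf(1,2) u(1)] .
  have x2: "iv n x = (K * K * \<alpha>') \<cdot>\<^sub>m ((u * v) * f) + E2"
    unfolding ivx E2_def B0_def \<alpha>'_def using loxodromic_expand(2)[OF vf(1,2) u(1), of "- K"] by simp
  have Xeq: "X j = \<kappa> j \<cdot>\<^sub>m (p j * \<phi> j) + E j" if "j \<in> letters" for j
  proof -
    have y1: "h * x * e = (K * K * \<alpha>) \<cdot>\<^sub>m ((h * v) * (f * (iv n u * e))) + h * E1 * e"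
    proof -
      have "h * x * e = (K * K * \<alpha>) \<cdot>\<^sub>m ((h * v) * ((f * iv n u) * e)) + h * E1 * e"
        unfolding x1 using vf(1,2) u(1) h(1) e(1) E12 by (intro sandwich[where n = n]) auto
      also have "(f * iv n u) * e = f * (iv n u * e)" using vf(2) u(1) e(1) by (intro mat_assoc) auto
      finally show ?thesis .
    qed
    have y2: "iv n e * iv n x * iv n h = (K * K * \<alpha>') \<cdot>\<^sub>m ((iv n e * u * v) * (f * iv n h)) + iv n e * E2 * iv n h"
    proof -
      have "iv n e * iv n x * iv n h = (K * K * \<alpha>') \<cdot>\<^sub>m ((iv n e * (u * v)) * (f * iv n h)) + iv n e * E2 * iv n h"
        unfolding x2 using vf(1,2) u(1) h(1) e(1) E12 by (intro sandwich[where n = n]) auto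
      also have "iv n e * (u * v) = iv n e * u * v" using vf(1) u(1) e(1) by (intro mat_assoc[symmetric]) auto
      finally show ?thesis .
    qed
    show ?thesis using that x1 x2 y1 y2 vf(1,2) unfolding letters_def X_def \<kappa>_def p_def \<phi>_def Qq_def Rr_def E_def
      by auto
  qed
  have Esq: "is_sq n (E j)" for j unfolding E_def using E12 h(1) e(1) by (cases j) auto
  have \<kappa>K: "?K * ?K \<le> \<bar>real_of_int (\<kappa> j)\<bar>" if "j \<in> letters" for j
  proof -
    have "?K * ?K * 1 \<le> ?K * ?K * \<bar>real_of_int \<alpha>\<bar>" "?K * ?K * 1 \<le> ?K * ?K * \<bar>real_of_int \<alpha>'\<bar>"
      using abs_ge_1_int[OF \<alpha>0] abs_ge_1_int[OF \<alpha>'0] by (intro mult_left_mono; simp)+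
    thus ?thesis using that unfolding letters_def \<kappa>_def by (auto simp: abs_mult)
  qed
  have En: "nm (E j) \<le> \<eta> * \<bar>real_of_int (\<kappa> j)\<bar>" if j: "j \<in> letters" for j
  proof -
    let ?N = "nm (1\<^sub>m n) + nm B0"
    have N0: "0 \<le> ?N" by simp
    have b: "nm (1\<^sub>m n + k' \<cdot>\<^sub>m B0) \<le> ?K * ?N" if "\<bar>real_of_int k'\<bar> = ?K" for k'
    proof -
      have "nm (1\<^sub>m n + k' \<cdot>\<^sub>m B0) \<le> nm (1\<^sub>m n) + nm (k' \<cdot>\<^sub>m B0)" using B0 by (intro nm_add) auto
      also have "\<dots> = 1 * nm (1\<^sub>m n) + ?K * nm B0" using that by (simp add: nm_smult)
      also have "\<dots> \<le> ?K * nm (1\<^sub>m n) + ?K * nm B0" using K1 by (intro add_mono mult_right_mono) auto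
      finally show ?thesis by (simp add: distrib_left)
    qed
    have b1: "nm E1 \<le> ?K * ?N" "nm E2 \<le> ?K * ?N" unfolding E1_def E2_def using K1 by (intro b; simp)+
    have sw: "nm (l * F * r) \<le> nm l * nm r * (?K * ?N)" if "is_sq n l" "is_sq n F" "is_sq n r" "nm F \<le> ?K * ?N" for l F r
    proof -
      have "nm (l * F * r) \<le> nm (l * F) * nm r" using that by (intro nm_mult) auto
      also have "\<dots> \<le> (nm l * nm F) * nm r" using that by (intro mult_right_mono nm_mult) auto
      also have "\<dots> \<le> (nm l * (?K * ?N)) * nm r" using that by (intro mult_right_mono mult_left_mono) auto
      finally show ?thesis by (simp add: mult_ac)
    qed
    let ?W = "1 + nm h * nm e + nm (iv n e) * nm (iv n h)"
    have W: "1 \<le> ?W" "nm h * nm e \<le> ?W" "nm (iv n e) * nm (iv n h) \<le> ?W" by simp_all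
    have KN: "0 \<le> ?K * ?N" using K1 N0 by simp
    have "nm (E j) \<le> ?W * (?K * ?N)"
    proof -
      have "1 * (?K * ?N) \<le> ?W * (?K * ?N)" by (rule mult_right_mono[OF W(1) KN])
      moreover have "nm h * nm e * (?K * ?N) \<le> ?W * (?K * ?N)" by (rule mult_right_mono[OF W(2) KN])
      moreover have "nm (iv n e) * nm (iv n h) * (?K * ?N) \<le> ?W * (?K * ?N)" by (rule mult_right_mono[OF W(3) KN])
      moreover have "nm (h * E1 * e) \<le> nm h * nm e * (?K * ?N)" using h(1) e(1) E12 b1 by (intro sw) auto
      moreover have "nm (iv n e * E2 * iv n h) \<le> nm (iv n e) * nm (iv n h) * (?K * ?N)" using h(1) e(1) E12 b1 by (intro sw) auto
      ultimately show ?thesis using j b1 unfolding E_def letters_def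
        by (elim insertE emptyE; hypsubst; simp only: ix.case; linarith?)
    qed
    also have "\<dots> = \<eta> * (?K * ?K)" unfolding \<eta>_def ME_def using K1 by (simp add: field_simps)
    also have "\<dots> \<le> \<eta> * \<bar>real_of_int (\<kappa> j)\<bar>" using \<kappa>K[OF j] \<eta>p by (intro mult_left_mono) auto
    finally show ?thesis .
  qed
  have pp: "pingpong n ?T X letters (okz n) p \<phi> \<kappa> E C c \<eta> c3"
  proof
    show "is_sq n \<tau>" if "\<tau> \<in> ?T" for \<tau> using tT(1) that by auto
    show "\<exists>i. okz n i \<tau> j" for \<tau> j unfolding okz_def by (rule exI[of _ "if bar j = Xp then Xm else Xp"]) auto
    show "\<exists>j. okz n i \<tau> j" for i \<tau> unfolding okz_def by (rule exI[of _ "if i = Xp then Xp else Xm"]) auto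
  qed (use psh fsh Cb C1 vf(4) Xeq Esq En sep c3_def \<eta>p \<eta>s in auto)
  have c5eq: "pingpong.c5 C c c3 = c5" unfolding c5_def using pingpong.c5_def[OF pp] .
  have theq: "pingpong.\<theta> C c \<eta> c3 = (4 * (C * C) * \<eta> + 2 * \<eta>\<^sup>2) / c5\<^sup>2" using pingpong.\<theta>_def[OF pp] unfolding c5eq .
  obtain S where S: "finite S" "S \<subseteq> SL n" "D = generate (SL_int n) S" using tm unfolding tame_def by blast
  have ext: "extension n g D S X p \<phi> \<kappa> E C c \<eta> c3 s P"
  proof (rule extension.intro)
    show "8 * pingpong.\<theta> C c \<eta> c3 * s \<le> 1"
    proof -
      have "\<eta>\<^sup>2 \<le> \<eta>" using \<eta>s(4) \<eta>p by (simp add: power2_eq_square mult_left_le)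
      hence "4 * (C * C) * \<eta> + 2 * \<eta>\<^sup>2 \<le> \<eta> * (4 * (C * C) + 2)" by (simp add: algebra_simps)
      hence "(4 * (C * C) * \<eta> + 2 * \<eta>\<^sup>2) * (8 * (s + 1)) \<le> \<eta> * (4 * (C * C) + 2) * (8 * (s + 1))"
        using s0 by (intro mult_right_mono) auto
      also have "\<dots> \<le> c5\<^sup>2" using \<eta>s(5) by (simp add: mult_ac)
      finally have 1: "(4 * (C * C) * \<eta> + 2 * \<eta>\<^sup>2) * (8 * (s + 1)) \<le> c5\<^sup>2" .
      have "(4 * (C * C) * \<eta> + 2 * \<eta>\<^sup>2) * (8 * s) \<le> (4 * (C * C) * \<eta> + 2 * \<eta>\<^sup>2) * (8 * (s + 1))"
        using \<eta>p C1 by (intro mult_left_mono) auto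
      hence "(4 * (C * C) * \<eta> + 2 * \<eta>\<^sup>2) * (8 * s) \<le> c5\<^sup>2" using 1 by linarith
      thus ?thesis unfolding theq using c50 by (simp add: field_simps)
    qed
    show "nm \<pi> < pingpong.c5 C c c3 * \<bar>real_of_int (\<kappa> i)\<bar>" if i: "i \<in> letters" and pi: "\<pi> \<in> P \<union> {g, g * g}" for i \<pi>
    proof -
      have "nm \<pi> \<le> sum nm PP" using pi PP unfolding PP_def by (intro member_le_sum) auto
      hence "nm \<pi> < sum nm PP + 1" by simp
      also have "\<dots> \<le> c5 * ?K" using K1(3) c50 by (simp add: field_simps)
      also have "\<dots> \<le> c5 * (?K * ?K)"
      proof (intro mult_left_mono)
        show "?K \<le> ?K * ?K" using K1(1) mult_right_mono[of 1 ?K ?K] by simp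
      qed (use c50 in auto)
      also have "\<dots> \<le> c5 * \<bar>real_of_int (\<kappa> i)\<bar>" using \<kappa>K[OF i] c50 by (intro mult_left_mono) auto
      finally show ?thesis unfolding c5eq .
    qed
  qed (rule n0 g tm S(1) S(2) S(3) pp XS Xbar s; assumption)+
  interpret ex: extension n g D S X p \<phi> \<kappa> E C c \<eta> c3 s P by (rule ext)
  have "X Xp \<in> ex.Dplus" "X Yp \<in> ex.Dplus" by (intro ex.X_Dplus; simp add: letters_def)+
  hence "x \<in> ex.Dplus" "h * x * e \<in> ex.Dplus" unfolding X_def by simp_all
  thus ?thesis using ex.tame_Dplus ex.D_Dplus ex.T'_P by blast
qed

section \<open>A maximal subgroup from a tame one\<close>

text \<open>Replace \<open>h\<close> by an element \<open>h1\<close> of the group generated by \<open>D\<close> and \<open>h\<close> that is outside \<open>TT n g D\<close>: if \<open>h\<close> is in a double coset of \<open>g\<close> or its inverse, then \<open>g\<close>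
is in that group and \<open>g * g\<close> will do. Write \<open>e = r * e'\<close> with both factors outside \<open>TT n g D\<close>, and apply the extension step to \<open>(h1,r)\<close> and then to
\<open>(h1,e')\<close>, taking care in the first step that \<open>h1\<close> and \<open>e'\<close> stay outside.\<close>

lemma tame_forcing_extension:
  assumes n3: "n \<ge> 3" and g: "g \<in> SL n" and tm: "tame n g D"
    and h: "h \<in> SL n" "h \<notin> D" and e: "e \<in> SL n"
  shows "\<exists>D'. tame n g D' \<and> D \<subseteq> D' \<and> (\<forall>H. subgroup H (SL_int n) \<and> D' \<subseteq> H \<and> h \<in> H \<longrightarrow> e \<in> H)"
proof -
  have n0: "n > 0" using n3 by simp
  note tT = tame_TT[OF tm g n0]
  have Dsub: "subgroup D (SL_int n)" using tm unfolding tame_def by blast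
  obtain h1 where h1: "h1 \<in> SL n" "h1 \<notin> TT n g D"
    "\<And>H. subgroup H (SL_int n) \<Longrightarrow> D \<subseteq> H \<Longrightarrow> h \<in> H \<Longrightarrow> h1 \<in> H"
  proof (cases "h \<in> TT n g D")
    case False thus thesis using that h by blast
  next
    case True
    then obtain a q b where ab: "a \<in> D" "q \<in> {g, iv n g}" "b \<in> D" "h = a * q * b" using h(2) unfolding TT_def mid_def by blast
    have S: "a \<in> SL n" "b \<in> SL n" "q \<in> SL n" using ab sub_SL(1)[OF Dsub] g by auto
    show thesis
    proof (rule that)
      show "g * g \<in> SL n" by (rule SL_mult[OF g g])
      show "g * g \<notin> TT n g D" using tm unfolding tame_def by blast
      fix H assume H: "subgroup H (SL_int n)" "D \<subseteq> H" "h \<in> H"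
      note HS = sub_SL[OF H(1)]
      have "q = iv n a * h * iv n b" unfolding ab(4) using S by (simp add: mat_assoc)
      moreover have "iv n a * h * iv n b \<in> H"
        using ab(1,3) H(2,3) by (intro HS(3) HS(4)) auto
      ultimately have qH: "q \<in> H" by simp
      have "g \<in> H"
      proof (cases "q = g")
        case True thus ?thesis using qH by simp
      next
        case False
        hence "iv n q = g" using ab(2) g by auto
        thus ?thesis using HS(4)[OF qH] by simp
      qed
      thus "g * g \<in> H" by (intro HS(3))
    qed
  qed
  obtain r where r: "r \<in> SL n" "r \<notin> TT n g D" "iv n e * r \<notin> TT n g D"
  proof -
    have "\<exists>r\<in>SL n. \<forall>(A,B)\<in>{(1\<^sub>m n,1\<^sub>m n),(iv n e,1\<^sub>m n)}. A * r * B \<notin> TT n g D"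
      by (rule escape[OF n3 tT(1,3)]) (use e in auto)
    then obtain r where "r \<in> SL n" "\<forall>(A,B)\<in>{(1\<^sub>m n,1\<^sub>m n),(iv n e,1\<^sub>m n)}. A * r * B \<notin> TT n g D" by blast
    thus thesis using that[of r] e by auto
  qed
  define e' where "e' = iv n r * e"
  have e': "e' \<in> SL n" unfolding e'_def using r e by auto
  have e'T: "e' \<notin> TT n g D"
  proof
    assume "e' \<in> TT n g D"
    hence "iv n e' \<in> TT n g D" by (rule tT(4))
    thus False unfolding e'_def using r e by (simp add: iv_mult)
  qed
  obtain D1 x1 where D1: "tame n g D1" "D \<subseteq> D1" "TT n g D1 \<inter> {h1, e'} \<subseteq> TT n g D" "x1 \<in> D1" "h1 * x1 * r \<in> D1"
    using extension_step[OF n3 g tm h1(1,2) r(1,2), of "{h1, e'}"] by blast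
  have "h1 \<notin> TT n g D1" "e' \<notin> TT n g D1" using D1(3) h1(2) e'T by auto
  then obtain D2 x2 where D2: "tame n g D2" "D1 \<subseteq> D2" "x2 \<in> D2" "h1 * x2 * e' \<in> D2"
    using extension_step[OF n3 g D1(1) h1(1) _ e', of "{}"] by blast
  have "e \<in> H" if H: "subgroup H (SL_int n)" "D2 \<subseteq> H" "h \<in> H" for H
  proof -
    note HS = sub_SL[OF H(1)]
    have h1H: "h1 \<in> H" using h1(3)[OF H(1) _ H(3)] H(2) D1(2) D2(2) by blast
    have solve: "y \<in> H" if "x \<in> H" "h1 * x * y \<in> H" "y \<in> SL n" for x y
    proof -
      have "h1 * x \<in> H" using HS(3) h1H that by blast
      hence "iv n (h1 * x) * (h1 * x * y) \<in> H" using HS that by blast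
      moreover have "h1 * x \<in> SL n" using \<open>h1 * x \<in> H\<close> HS(1) by blast
      ultimately show ?thesis using that(3) by simp
    qed
    have "r \<in> H" using solve[of x1 r] D1 D2 H r by blast
    moreover have "e' \<in> H" using solve[of x2 e'] D2 H e' by blast
    ultimately have "r * e' \<in> H" using HS(3) by blast
    thus ?thesis unfolding e'_def using r e by simp
  qed
  thus ?thesis using D1(2) D2(1,2) by blast
qed

lemma countable_SL: "countable (SL n)"
proof -
  define F where "F = (\<lambda>A :: int mat. map (\<lambda>i. map (\<lambda>j. A $$ (i,j)) [0..<n]) [0..<n])"
  have "inj_on F (SL n)"
  proof (rule inj_onI)
    fix A B assume AB: "A \<in> SL n" "B \<in> SL n" "F A = F B"
    have "A $$ (i,j) = B $$ (i,j)" if "i < n" "j < n" for i j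
    proof -
      have "F A ! i ! j = F B ! i ! j" using AB(3) by simp
      thus ?thesis unfolding F_def using that by simp
    qed
    thus "A = B" using AB by (intro eq_matI) auto
  qed
  thus ?thesis using countable_image_inj_on[of F "SL n"] by auto
qed

text \<open>Treat the pairs \<open>(h,e)\<close> of an enumeration of \<open>SL n \<times> SL n\<close> one after the other. If \<open>h\<close> is outside the union \<open>M\<close>, then it is outside the group
present when \<open>(h,e)\<close> is treated, so every \<open>e\<close> is in each group containing \<open>M\<close> and \<open>h\<close>. The conditions in \<open>tame\<close> that
concern single elements pass to the union.\<close>

lemma maximal_from_tame:
  assumes n3: "n \<ge> 3" and g: "g \<in> SL n" and tm: "tame n g D0"
  shows "\<exists>M. subgroup M (SL_int n) \<and> ZZ n \<subseteq> M \<and> g \<notin> M \<and>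
     (\<forall>H. subgroup H (SL_int n) \<and> M \<subseteq> H \<and> H \<noteq> M \<longrightarrow> H = SL n) \<and>
     (\<forall>a\<in>M. \<forall>b\<in>M. a * g * b = g \<longrightarrow> a \<in> ZZ n)"
proof -
  define en where "en = from_nat_into (SL n \<times> SL n)"
  have ne: "SL n \<times> SL n \<noteq> {}" using SL_one by blast
  have cnt: "countable (SL n \<times> SL n)" using countable_SL by simp
  have enr: "range en = SL n \<times> SL n" unfolding en_def by (rule range_from_nat_into[OF ne cnt])
  define Q where "Q = (\<lambda>k D D'. D \<subseteq> D' \<and> (fst (en k) \<notin> D \<longrightarrow>
      (\<forall>H. subgroup H (SL_int n) \<and> D' \<subseteq> H \<and> fst (en k) \<in> H \<longrightarrow> snd (en k) \<in> H)))"
  have "\<exists>f. \<forall>k. tame n g (f k) \<and> Q k (f k) (f (Suc k))"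
  proof (rule dependent_nat_choice)
    show "\<exists>x. tame n g x" using tm by blast
  next
    fix D k assume D: "tame n g D"
    have S: "fst (en k) \<in> SL n" "snd (en k) \<in> SL n" using enr by (metis mem_Times_iff rangeI)+
    show "\<exists>y. tame n g y \<and> Q k D y"
    proof (cases "fst (en k) \<in> D")
      case True thus ?thesis using D unfolding Q_def by blast
    next
      case False
      from tame_forcing_extension[OF n3 g D S(1) False S(2)] show ?thesis unfolding Q_def by blast
    qed
  qed
  then obtain f where f: "\<And>k. tame n g (f k)" "\<And>k. Q k (f k) (f (Suc k))" by blast
  have mono: "f k \<subseteq> f m" if "k \<le> m" for k m
    using that by (rule lift_Suc_mono_le[of f, rotated]) (use f(2) in \<open>auto simp: Q_def\<close>)
  have fsub: "subgroup (f k) (SL_int n)" for k using f(1) unfolding tame_def by blast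
  define M where "M = (\<Union>k. f k)"
  have two: "\<exists>k. a \<in> f k \<and> b \<in> f k" if "a \<in> M" "b \<in> M" for a b
  proof -
    from that obtain i j where "a \<in> f i" "b \<in> f j" unfolding M_def by blast
    thus ?thesis using mono[of i "max i j"] mono[of j "max i j"] by (intro exI[of _ "max i j"]) auto
  qed
  have Msub: "subgroup M (SL_int n)"
  proof (rule group.subgroupI[OF group_SL_int])
    show "M \<subseteq> SL n" unfolding M_def using sub_SL(1)[OF fsub] by blast
    show "M \<noteq> {}" unfolding M_def using sub_SL(2)[OF fsub] by blast
    show "iv n a \<in> M" if "a \<in> M" for a using that sub_SL(4)[OF fsub] unfolding M_def by blast
    show "a \<otimes>\<^bsub>SL_int n\<^esub> b \<in> M" if "a \<in> M" "b \<in> M" for a b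
      using two[OF that] sub_SL(3)[OF fsub] unfolding M_def by auto
  qed
  have comb: "a \<in> ZZ n" if "a \<in> M" "b \<in> M" "a * g * b = g" for a b
    using two[OF that(1,2)] f(1) that(3) unfolding tame_def by blast
  have gM: "g \<notin> M"
  proof
    assume "g \<in> M"
    then obtain k where k: "g \<in> f k" unfolding M_def by blast
    hence "g * g \<in> f k" using sub_SL(3)[OF fsub] by blast
    thus False using f(1)[of k] unfolding tame_def TT_def by blast
  qed
  have max: "H = SL n" if H: "subgroup H (SL_int n)" "M \<subseteq> H" "H \<noteq> M" for H
  proof
    show "H \<subseteq> SL n" using sub_SL(1)[OF H(1)] .
    obtain h where h: "h \<in> H" "h \<notin> M" using H by blast
    show "SL n \<subseteq> H"
    proof
      fix e assume e: "e \<in> SL n"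
      have "(h, e) \<in> range en" unfolding enr using e h sub_SL(1)[OF H(1)] by blast
      then obtain k where k: "en k = (h, e)" by force
      have "h \<notin> f k" using h unfolding M_def by blast
      moreover have "f (Suc k) \<subseteq> H" using H(2) unfolding M_def by blast
      ultimately show "e \<in> H" using f(2)[of k] H(1) h(1) k unfolding Q_def by auto
    qed
  qed
  have "ZZ n \<subseteq> M" using f(1)[of 0] unfolding tame_def M_def by blast
  moreover have "\<forall>H. subgroup H (SL_int n) \<and> M \<subseteq> H \<and> H \<noteq> M \<longrightarrow> H = SL n" using max by blast
  moreover have "\<forall>a\<in>M. \<forall>b\<in>M. a * g * b = g \<longrightarrow> a \<in> ZZ n" using comb by blast
  ultimately have "subgroup M (SL_int n) \<and> ZZ n \<subseteq> M \<and> g \<notin> M \<and>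
     (\<forall>H. subgroup H (SL_int n) \<and> M \<subseteq> H \<and> H \<noteq> M \<longrightarrow> H = SL n) \<and>
     (\<forall>a\<in>M. \<forall>b\<in>M. a * g * b = g \<longrightarrow> a \<in> ZZ n)"
    using Msub gM by (intro conjI)
  thus ?thesis by (rule exI)
qed

section \<open>The center is tame\<close>

lemma basis_vectors:
  assumes "i < n" "j < n" "i \<noteq> j"
  defines "v \<equiv> Matrix.mat n 1 (\<lambda>(k,_). if k = i then 1 else 0 :: int)"
    and "f \<equiv> Matrix.mat 1 n (\<lambda>(_,k). if k = j then 1 else 0 :: int)"
  shows "is_col n v" "is_row n f" "dotm n f v = 0"
    "\<And>a b. a < n \<Longrightarrow> b < n \<Longrightarrow> tv n v f t $$ (a,b) = (if a = b then 1 else 0) + (if a = i \<and> b = j then t else 0)"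
proof -
  show vf: "is_col n v" "is_row n f" unfolding v_def f_def by auto
  show "dotm n f v = 0" unfolding dotm_def v_def f_def using assms(1-3) by (intro sum.neutral) auto
  fix a b assume ab: "a < n" "b < n"
  show "tv n v f t $$ (a,b) = (if a = b then 1 else 0) + (if a = i \<and> b = j then t else 0)"
    unfolding tv_def using vf ab vf_ent[OF vf ab] unfolding v_def f_def by (auto simp del: index_mult_mat(1))
qed

lemma ZZ_scalar:
  assumes z: "z \<in> ZZ n" and ij: "i < n" "j < n" "i \<noteq> j"
  shows "z $$ (j,i) = 0" "z $$ (i,i) = z $$ (j,j)"
proof -
  define v where "v = Matrix.mat n 1 (\<lambda>(k,_::nat). if k = i then 1 else 0 :: int)"
  define f where "f = Matrix.mat 1 n (\<lambda>(_::nat,k). if k = j then 1 else 0 :: int)"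
  note bv = basis_vectors[OF ij, folded v_def f_def]
  let ?A = "tv n v f 2"
  have A: "?A \<in> SL n" using tv_SL[OF bv(1-3), of 1] by simp
  have zS: "z \<in> SL n" using ZZ_SL[OF z] .
  have com: "z * ?A = ?A * z" using ZZ_comm[OF z A] .
  have l: "(z * ?A) $$ (a,j) = z $$ (a,j) + 2 * z $$ (a,i)" if "a < n" for a
  proof -
    have "(z * ?A) $$ (a,j) = (\<Sum>k<n. z $$ (a,k) * ?A $$ (k,j))"
      using zS A that ij by (simp add: index_mult_sum del: index_mult_mat(1))
    also have "\<dots> = (\<Sum>k<n. (if k = j then z $$ (a,k) else 0) + (if k = i then 2 * z $$ (a,k) else 0))"
      using ij by (intro sum.cong refl) (auto simp: bv(4))
    also have "\<dots> = z $$ (a,j) + 2 * z $$ (a,i)" using ij by (simp add: sum.distrib)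
    finally show ?thesis .
  qed
  have r: "(?A * z) $$ (a,j) = z $$ (a,j) + (if a = i then 2 * z $$ (j,j) else 0)" if "a < n" for a
  proof -
    have "(?A * z) $$ (a,j) = (\<Sum>k<n. ?A $$ (a,k) * z $$ (k,j))"
      using zS A that ij by (simp add: index_mult_sum del: index_mult_mat(1))
    also have "\<dots> = (\<Sum>k<n. (if k = a then z $$ (k,j) else 0) + (if k = j then (if a = i then 2 * z $$ (j,j) else 0) else 0))"
      using ij that by (intro sum.cong refl) (auto simp: bv(4))
    also have "\<dots> = z $$ (a,j) + (if a = i then 2 * z $$ (j,j) else 0)" using ij that by (simp add: sum.distrib)
    finally show ?thesis .
  qed
  show "z $$ (j,i) = 0" using l[OF ij(2)] r[OF ij(2)] com ij by simp
  show "z $$ (i,i) = z $$ (j,j)" using l[OF ij(1)] r[OF ij(1)] com ij by simp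
qed

lemma finite_ZZ: assumes n: "n > 0" shows "finite (ZZ n)"
proof (rule finite_subset)
  show "ZZ n \<subseteq> {1\<^sub>m n, (- 1) \<cdot>\<^sub>m 1\<^sub>m n}"
  proof
    fix z assume z: "z \<in> ZZ n"
    have zS: "z \<in> SL n" using ZZ_SL[OF z] .
    define c where "c = z $$ (0,0)"
    have "z $$ (i,j) = (c \<cdot>\<^sub>m 1\<^sub>m n) $$ (i,j)" if "i < n" "j < n" for i j
    proof (cases "i = j")
      case False thus ?thesis using ZZ_scalar(1)[OF z that(2,1)] that by simp
    next
      case True
      thus ?thesis using ZZ_scalar(2)[OF z, of i 0] that n unfolding c_def by (cases "i = 0") auto
    qed
    hence ze: "z = c \<cdot>\<^sub>m 1\<^sub>m n" using zS by (intro eq_matI) auto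
    have "Determinant.det z = c ^ n" unfolding ze by simp
    hence "c ^ n = 1" using zS unfolding SL_iff by simp
    hence "c * c ^ (n - 1) = 1" using n by (metis power_eq_if less_irrefl)
    hence "c = 1 \<or> c = - 1" by (simp only: zmult_eq_1_iff) blast
    thus "z \<in> {1\<^sub>m n, (- 1) \<cdot>\<^sub>m 1\<^sub>m n}"
    proof
      assume "c = 1"
      hence "z = 1\<^sub>m n" unfolding ze by (intro eq_matI) auto
      thus ?thesis by simp
    qed (use ze in simp)
  qed
qed simp

text \<open>The matrices in \<open>T\<close> are invertible, so finitely many of them shrink \<open>y\<close> by a bounded factor only.\<close>

lemma finite_good:
  assumes T: "finite T" "T \<subseteq> SL n" and y: "dim_row y = n" "0 < nm y"
  shows "good T y"
proof -
  define B where "B = 1 + (\<Sum>\<tau>\<in>T. nm \<tau> + nm (iv n \<tau>))"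
  have B: "nm \<tau> \<le> B" "nm (iv n \<tau>) \<le> B" if "\<tau> \<in> T" for \<tau>
  proof -
    have "nm \<tau> + nm (iv n \<tau>) \<le> (\<Sum>\<tau>\<in>T. nm \<tau> + nm (iv n \<tau>))"
      using that T(1) by (intro member_le_sum[where f = "\<lambda>\<tau>. nm \<tau> + nm (iv n \<tau>)"]) auto
    thus "nm \<tau> \<le> B" "nm (iv n \<tau>) \<le> B" unfolding B_def using nm_nonneg[of \<tau>] nm_nonneg[of "iv n \<tau>"] by linarith+
  qed
  have B1: "1 \<le> B" unfolding B_def by (simp add: sum_nonneg)
  show ?thesis unfolding good_def
  proof (intro exI[of _ "nm y / (B * B)"] conjI ballI)
    show "nm y / (B * B) > 0" using y B1 by simp
    fix \<tau> assume t: "\<tau> \<in> T"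
    have "nm y \<le> nm (iv n \<tau>) * nm (\<tau> * y)" using t T y by (intro nm_cancel_l) auto
    also have "\<dots> \<le> B * nm (\<tau> * y)" using B[OF t] by (intro mult_right_mono) auto
    finally have "nm y * nm \<tau> \<le> (B * nm (\<tau> * y)) * B" using B[OF t] B1 by (intro mult_mono) auto
    thus "nm y / (B * B) * nm \<tau> \<le> nm (\<tau> * y)" using B1 by (simp add: field_simps)
  qed
qed

lemma finite_cogood:
  assumes T: "finite T" "T \<subseteq> SL n" and y: "dim_col y = n" "0 < nm y"
  shows "cogood T y"
proof -
  define B where "B = 1 + (\<Sum>\<tau>\<in>T. nm \<tau> + nm (iv n \<tau>))"
  have B: "nm \<tau> \<le> B" "nm (iv n \<tau>) \<le> B" if "\<tau> \<in> T" for \<tau>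
  proof -
    have "nm \<tau> + nm (iv n \<tau>) \<le> (\<Sum>\<tau>\<in>T. nm \<tau> + nm (iv n \<tau>))"
      using that T(1) by (intro member_le_sum[where f = "\<lambda>\<tau>. nm \<tau> + nm (iv n \<tau>)"]) auto
    thus "nm \<tau> \<le> B" "nm (iv n \<tau>) \<le> B" unfolding B_def using nm_nonneg[of \<tau>] nm_nonneg[of "iv n \<tau>"] by linarith+
  qed
  have B1: "1 \<le> B" unfolding B_def by (simp add: sum_nonneg)
  show ?thesis unfolding cogood_def
  proof (intro exI[of _ "nm y / (B * B)"] conjI ballI)
    show "nm y / (B * B) > 0" using y B1 by simp
    fix \<tau> assume t: "\<tau> \<in> T"
    have "nm y \<le> nm (y * \<tau>) * nm (iv n \<tau>)" using t T y by (intro nm_cancel_r) auto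
    also have "\<dots> \<le> nm (y * \<tau>) * B" using B[OF t] by (intro mult_left_mono) auto
    finally have "nm y * nm \<tau> \<le> (nm (y * \<tau>) * B) * B" using B[OF t] B1 by (intro mult_mono) auto
    thus "nm y / (B * B) * nm \<tau> \<le> nm (y * \<tau>)" using B1 by (simp add: field_simps)
  qed
qed

lemma tame_center:
  assumes n3: "n \<ge> 3"
  shows "\<exists>g\<in>SL n. tame n g (ZZ n)"
proof -
  have n0: "n > 0" and ij: "0 < n" "1 < n" "(0::nat) \<noteq> 1" using n3 by auto
  define v where "v = Matrix.mat n 1 (\<lambda>(k,_::nat). if k = 0 then 1 else 0 :: int)"
  define f where "f = Matrix.mat 1 n (\<lambda>(_::nat,k). if k = 1 then 1 else 0 :: int)"
  note bv = basis_vectors[OF ij, folded v_def f_def]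
  have nz: "tv n v f t \<notin> ZZ n" if "t \<noteq> 0" for t
    using ZZ_scalar(1)[OF _ ij(2,1)] bv(4)[OF ij(1,2), of t] that ij by auto
  define g where "g = tv n v f 2"
  have g: "g \<in> SL n" unfolding g_def using tv_SL[OF bv(1-3), of 1] by simp
  have gg: "g * g = tv n v f 4" "g * g * g = tv n v f 6" unfolding g_def using tv_mult[OF bv(1-3)] by simp_all
  have gZ: "g \<notin> ZZ n" "g * g \<notin> ZZ n" "g * g * g \<notin> ZZ n"
    using nz[of 2, folded g_def] nz[of 4, folded gg(1)] nz[of 6, folded gg(2)] by simp_all
  note ZS = sub_SL[OF ZZ_subgroup[of n]]
  have finZ: "finite (ZZ n)" by (rule finite_ZZ[OF n0])
  have finT: "finite (TT n g (ZZ n))"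
  proof -
    have "mid n g (ZZ n) \<subseteq> (\<lambda>(a,q,b). a * q * b) ` (ZZ n \<times> {g, iv n g} \<times> ZZ n)" unfolding mid_def by force
    thus ?thesis unfolding TT_def using finZ by (meson finite_SigmaI finite_UnI finite_imageI finite_insert finite.emptyI finite_subset)
  qed
  have TS: "TT n g (ZZ n) \<subseteq> SL n" by (rule TT_SL[OF ZZ_subgroup g])
  have "tame n g (ZZ n)" unfolding tame_def
  proof (intro conjI)
    show "subgroup (ZZ n) (SL_int n)" by (rule ZZ_subgroup)
    show "\<exists>S. finite S \<and> S \<subseteq> SL n \<and> ZZ n = generate (SL_int n) S"
    proof (intro exI[of _ "ZZ n"] conjI)
      show "ZZ n = generate (SL_int n) (ZZ n)"
        using group.generateI[OF group_SL_int ZZ_subgroup] by blast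
    qed (use finZ ZS(1) in auto)
    show "wd summable_on ZZ n" using finZ by (rule summable_on_finite)
    show "\<exists>c>0. \<forall>a\<in>ZZ n. \<forall>b\<in>ZZ n. \<forall>q\<in>{g, iv n g}. c * nm a * nm b \<le> nm (a * q * b)"
    proof -
      define B where "B = 1 + (\<Sum>a\<in>ZZ n. nm a)"
      have B: "nm a \<le> B" if "a \<in> ZZ n" for a
      proof -
        have "nm a \<le> (\<Sum>a\<in>ZZ n. nm a)" using that finZ by (intro member_le_sum) auto
        thus ?thesis unfolding B_def by simp
      qed
      have B1: "1 \<le> B" unfolding B_def by (simp add: sum_nonneg)
      show ?thesis
      proof (intro exI[of _ "1 / (B * B)"] conjI ballI)
        show "1 / (B * B) > 0" using B1 by simp
        fix a b q assume abq: "a \<in> ZZ n" "b \<in> ZZ n" "q \<in> {g, iv n g}"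
        have "nm a * nm b \<le> B * B" using B abq B1 by (intro mult_mono) auto
        hence "1 / (B * B) * nm a * nm b \<le> 1" using B1 by (simp add: field_simps)
        also have "1 \<le> nm (a * q * b)" using abq g ZZ_SL by (intro SL_nm_ge_1[OF _ n0]) auto
        finally show "1 / (B * B) * nm a * nm b \<le> nm (a * q * b)" .
      qed
    qed
    show "\<exists>y z. is_col n y \<and> is_row n z \<and> good (TT n g (ZZ n)) y \<and> cogood (TT n g (ZZ n)) z"
    proof -
      have "1 \<le> nm v" using bv(1) n0 by (intro nm_ge_1[of 0 v 0]) (auto simp: v_def)
      hence "good (TT n g (ZZ n)) v" using bv(1) by (intro finite_good[OF finT TS]) auto
      moreover have "1 \<le> nm f" using bv(2) ij by (intro nm_ge_1[of 0 f 1]) (auto simp: f_def)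
      hence "cogood (TT n g (ZZ n)) f" using bv(2) by (intro finite_cogood[OF finT TS]) auto
      ultimately show ?thesis using bv(1,2) by blast
    qed
    show "\<forall>a\<in>ZZ n. \<forall>b\<in>ZZ n. a * g * b = g \<longrightarrow> a \<in> ZZ n" by blast
    show "g * g \<notin> TT n g (ZZ n)"
    proof
      assume "g * g \<in> TT n g (ZZ n)"
      then obtain a q b where ab: "a \<in> ZZ n" "q \<in> {g, iv n g}" "b \<in> ZZ n" "g * g = a * q * b"
        using gZ(2) unfolding TT_def mid_def by blast
      have S: "a \<in> SL n" "b \<in> SL n" "q \<in> SL n" using ab ZZ_SL g by auto
      have e: "g * g = a * b * q" unfolding ab(4) using ZZ_comm[OF ab(3) S(3)] S by (simp add: mat_assoc)
      have "a * b \<in> ZZ n" using ZS(3) ab by blast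
      show False
      proof (cases "q = g")
        case True
        have "g * g * iv n g = a * b * q * iv n g" using e by simp
        hence "g = a * b" using True S g by (simp add: mat_assoc)
        thus False using gZ(1) \<open>a * b \<in> ZZ n\<close> by simp
      next
        case False
        hence "g * g * g = a * b * iv n g * g" using e ab(2) by simp
        hence "g * g * g = a * b" using S g by (simp add: mat_assoc)
        thus False using gZ(3) \<open>a * b \<in> ZZ n\<close> by simp
      qed
    qed
  qed simp
  thus ?thesis using g by blast
qed

section \<open>Passing to the quotient\<close>

text \<open>The cosets of \<open>x\<close> by \<open>M\<close> and by the conjugate of \<open>M\<close> determine \<open>x\<close>, so a finite index would make the group finite. The cosets
of the conjugate are encoded as cosets \<open>M #> (inv g \<otimes> x)\<close> of \<open>M\<close>.\<close>

lemma (in group) infinite_index_if_conjugate_disjoint: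
  assumes M: "subgroup M G" and g: "g \<in> carrier G"
    and tr: "M \<inter> (g <# (M #> inv g)) = {\<one>}" and inf: "infinite (carrier G)"
  shows "infinite_index M G"
  unfolding infinite_index_def
proof
  assume fin: "finite (rcosets M)"
  have MG: "M \<subseteq> carrier G" using subgroup.subset[OF M] .
  define F where "F = (\<lambda>x. (M #> x, M #> (inv g \<otimes> x)))"
  have "inj_on F (carrier G)"
  proof (rule inj_onI)
    fix x y assume xy: "x \<in> carrier G" "y \<in> carrier G" "F x = F y"
    have "x \<in> M #> y" using rcos_self[OF xy(1) M] xy(3) unfolding F_def by simp
    then obtain m where m: "m \<in> M" "x = m \<otimes> y" unfolding r_coset_def by blast
    have "inv g \<otimes> x \<in> M #> (inv g \<otimes> y)" using rcos_self[OF _ M, of "inv g \<otimes> x"] xy g unfolding F_def by simp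
    then obtain m' where m': "m' \<in> M" "inv g \<otimes> x = m' \<otimes> (inv g \<otimes> y)" unfolding r_coset_def by blast
    have S: "m \<in> carrier G" "m' \<in> carrier G" using m m' MG by auto
    have "x = g \<otimes> (inv g \<otimes> x)" using xy g by (simp add: m_assoc[symmetric])
    also have "\<dots> = g \<otimes> (m' \<otimes> (inv g \<otimes> y))" using m'(2) by simp
    also have "\<dots> = (g \<otimes> (m' \<otimes> inv g)) \<otimes> y" using S xy g by (simp add: m_assoc)
    finally have "m \<otimes> y = (g \<otimes> (m' \<otimes> inv g)) \<otimes> y" using m(2) by simp
    hence "m = g \<otimes> (m' \<otimes> inv g)" using S xy g by simp
    hence "m \<in> g <# (M #> inv g)" using m'(1) unfolding l_coset_def r_coset_def by blast
    hence "m = \<one>" using m(1) tr by blast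
    thus "x = y" using m xy by simp
  qed
  moreover have "F ` carrier G \<subseteq> (rcosets M) \<times> (rcosets M)" unfolding F_def using rcosetsI[OF MG] g by auto
  ultimately have "finite (carrier G)" using fin by (meson finite_SigmaI finite_imageD finite_subset)
  thus False using inf by simp
qed

text \<open>Subgroups of the image correspond to subgroups containing the kernel. The condition \<open>tr\<close> expresses the intersection of \<open>M\<close> with its
conjugate without mentioning cosets: \<open>a g b = g\<close> means that the inverse of \<open>a\<close> is the conjugate of \<open>b\<close>.\<close>

lemma (in group_hom) transfer_maximal:
  assumes surj: "h ` carrier G = carrier H" and M: "subgroup M G"
    and ker: "\<And>x. x \<in> carrier G \<Longrightarrow> h x = \<one>\<^bsub>H\<^esub> \<Longrightarrow> x \<in> M"
    and g: "g \<in> carrier G" "g \<notin> M"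
    and mx: "\<And>K. subgroup K G \<Longrightarrow> M \<subseteq> K \<Longrightarrow> K \<noteq> M \<Longrightarrow> K = carrier G"
    and tr: "\<And>a b. a \<in> M \<Longrightarrow> b \<in> M \<Longrightarrow> a \<otimes> g \<otimes> b = g \<Longrightarrow> h a = \<one>\<^bsub>H\<^esub>"
    and inf: "infinite (carrier H)"
  shows "maximal_subgroup (h ` M) H \<and> infinite_index (h ` M) H \<and> h g \<in> carrier H \<and>
    h ` M \<inter> (h g <#\<^bsub>H\<^esub> (h ` M #>\<^bsub>H\<^esub> inv\<^bsub>H\<^esub> (h g))) = {\<one>\<^bsub>H\<^esub>}"
proof -
  note Mc = subgroup.m_closed[OF M] and Mi = subgroup.m_inv_closed[OF M] and M1 = subgroup.one_closed[OF M]
  have MG: "M \<subseteq> carrier G" using subgroup.subset[OF M] .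
  have hM: "subgroup (h ` M) H" by (rule subgroup_img_is_subgroup[OF M])
  have pull: "x \<in> M" if x: "x \<in> carrier G" "h x \<in> h ` M" for x
  proof -
    obtain m where m: "m \<in> M" "h x = h m" using x by auto
    have mG: "m \<in> carrier G" using m MG by auto
    have "h (inv m \<otimes> x) = \<one>\<^bsub>H\<^esub>" using m x mG by simp
    hence "inv m \<otimes> x \<in> M" using ker x mG by simp
    hence "m \<otimes> (inv m \<otimes> x) \<in> M" using Mc m by blast
    moreover have "m \<otimes> (inv m \<otimes> x) = x" using x(1) mG G.m_assoc[of m "inv m" x] by simp
    ultimately show ?thesis by simp
  qed
  have max: "maximal_subgroup (h ` M) H" unfolding maximal_subgroup_def
  proof (intro conjI allI impI)
    show "subgroup (h ` M) H" by (rule hM)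
    show "h ` M \<noteq> carrier H"
    proof
      assume "h ` M = carrier H"
      hence "h g \<in> h ` M" using g by simp
      thus False using pull g by blast
    qed
    fix K assume K: "subgroup K H \<and> K \<noteq> carrier H \<and> h ` M \<subseteq> K"
    hence Ks: "subgroup K H" by blast
    define K0 where "K0 = {x \<in> carrier G. h x \<in> K}"
    have K0: "subgroup K0 G"
    proof (rule G.subgroupI)
      show "K0 \<subseteq> carrier G" unfolding K0_def by blast
      show "K0 \<noteq> {}" unfolding K0_def using subgroup.one_closed[OF Ks] by (auto intro!: exI[of _ \<one>])
      show "inv a \<in> K0" if "a \<in> K0" for a using that subgroup.m_inv_closed[OF Ks] unfolding K0_def by auto
      show "a \<otimes> b \<in> K0" if "a \<in> K0" "b \<in> K0" for a b using that subgroup.m_closed[OF Ks] unfolding K0_def by auto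
    qed
    have img: "h ` K0 = K"
    proof
      show "K \<subseteq> h ` K0"
      proof
        fix y assume y: "y \<in> K"
        then obtain x where "x \<in> carrier G" "y = h x" using surj subgroup.subset[OF Ks] by blast
        thus "y \<in> h ` K0" using y unfolding K0_def by blast
      qed
    qed (auto simp: K0_def)
    have "M \<subseteq> K0" unfolding K0_def using K MG by blast
    moreover have "K0 \<noteq> carrier G" using img surj K by auto
    ultimately have "K0 = M" using mx[OF K0] by blast
    thus "K = h ` M" using img by simp
  qed
  have triv: "h ` M \<inter> (h g <#\<^bsub>H\<^esub> (h ` M #>\<^bsub>H\<^esub> inv\<^bsub>H\<^esub> (h g))) = {\<one>\<^bsub>H\<^esub>}"
  proof
    show "{\<one>\<^bsub>H\<^esub>} \<subseteq> h ` M \<inter> (h g <#\<^bsub>H\<^esub> (h ` M #>\<^bsub>H\<^esub> inv\<^bsub>H\<^esub> (h g)))"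
    proof -
      have 1: "\<one>\<^bsub>H\<^esub> \<in> h ` M" using subgroup.one_closed[OF hM] .
      have "h g \<otimes>\<^bsub>H\<^esub> (\<one>\<^bsub>H\<^esub> \<otimes>\<^bsub>H\<^esub> inv\<^bsub>H\<^esub> (h g)) = \<one>\<^bsub>H\<^esub>" using g by simp
      hence "\<one>\<^bsub>H\<^esub> \<in> h g <#\<^bsub>H\<^esub> (h ` M #>\<^bsub>H\<^esub> inv\<^bsub>H\<^esub> (h g))"
        unfolding l_coset_def r_coset_def using 1 by force
      thus ?thesis using 1 by blast
    qed
    show "h ` M \<inter> (h g <#\<^bsub>H\<^esub> (h ` M #>\<^bsub>H\<^esub> inv\<^bsub>H\<^esub> (h g))) \<subseteq> {\<one>\<^bsub>H\<^esub>}"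
    proof
      fix w assume w: "w \<in> h ` M \<inter> (h g <#\<^bsub>H\<^esub> (h ` M #>\<^bsub>H\<^esub> inv\<^bsub>H\<^esub> (h g)))"
      then obtain b where b: "b \<in> M" "w = h g \<otimes>\<^bsub>H\<^esub> (h b \<otimes>\<^bsub>H\<^esub> inv\<^bsub>H\<^esub> (h g))"
        unfolding l_coset_def r_coset_def by blast
      have bG: "b \<in> carrier G" using b MG by auto
      define a where "a = g \<otimes> (b \<otimes> inv g)"
      have aG: "a \<in> carrier G" unfolding a_def using g bG by simp
      have wa: "w = h a" unfolding b a_def using g bG by simp
      hence aM: "a \<in> M" using w pull[OF aG] by blast
      have "inv a \<otimes> g \<otimes> b = g"
      proof -
        have "a \<otimes> g = g \<otimes> b" unfolding a_def using g bG by (simp add: G.m_assoc)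
        hence "inv a \<otimes> (g \<otimes> b) = g" using aG g by (metis G.inv_solve_left G.m_closed bG)
        thus ?thesis using aG g bG by (simp add: G.m_assoc)
      qed
      hence "h (inv a) = \<one>\<^bsub>H\<^esub>" using tr[OF Mi[OF aM] b(1)] by blast
      hence "inv\<^bsub>H\<^esub> (h a) = \<one>\<^bsub>H\<^esub>" using aG by simp
      hence "h a = \<one>\<^bsub>H\<^esub>" using aG by (metis H.inv_eq_1_iff hom_closed)
      thus "w \<in> {\<one>\<^bsub>H\<^esub>}" using wa by simp
    qed
  qed
  have hg: "h g \<in> carrier H" using g by simp
  have index: "infinite_index (h ` M) H"
    by (rule H.infinite_index_if_conjugate_disjoint[OF hM hg triv inf])
  show ?thesis by (rule conjI[OF max conjI[OF index conjI[OF hg triv]]])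
qed

lemma infinite_SL: assumes "n \<ge> 3" shows "infinite (SL n)"
proof
  assume "finite (SL n)"
  moreover have "range (Rm n) \<subseteq> SL n" using Rm_SL by blast
  ultimately have "finite (range (Rm n))" by (rule finite_subset[rotated])
  moreover have "inj (Rm n)"
  proof (rule injI)
    fix a b assume "Rm n a = Rm n b"
    hence "Rm n a $$ (0,1) = Rm n b $$ (0,1)" by simp
    thus "a = b" unfolding Rm_def using assms by simp
  qed
  ultimately show False using finite_imageD[of "Rm n" UNIV] by simp
qed

theorem theorem1p3:
  fixes n :: nat
  assumes "n \<ge> 3"
  shows "\<exists>M g. maximal_subgroup M (PSL_int n) \<and> infinite_index M (PSL_int n) \<and>
    g \<in> carrier (PSL_int n) \<and>
    M \<inter> (g <#\<^bsub>PSL_int n\<^esub> (M #>\<^bsub>PSL_int n\<^esub> inv\<^bsub>PSL_int n\<^esub> g)) = {\<one>\<^bsub>PSL_int n\<^esub>}"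
proof -
  have n0: "n > 0" using assms by simp
  let ?G = "SL_int n" and ?Q = "PSL_int n"
  have nor: "ZZ n \<lhd> ?G" by (rule group.center_normal[OF group_SL_int])
  define \<pi> where "\<pi> = (\<lambda>x. ZZ n #>\<^bsub>?G\<^esub> x)"
  have hom: "\<pi> \<in> hom ?G ?Q" unfolding \<pi>_def PSL_int_def by (rule normal.r_coset_hom_Mod[OF nor])
  interpret gh: group_hom ?G ?Q \<pi>
    using group_SL_int group_PSL_int hom by (intro group_hom.intro group_hom_axioms.intro)
  have surj: "\<pi> ` SL n = carrier ?Q" unfolding \<pi>_def PSL_int_def carrier_FactGroup ..
  have one: "\<one>\<^bsub>?Q\<^esub> = ZZ n" unfolding PSL_int_def by simp
  have kerZ: "x \<in> ZZ n" if "x \<in> SL n" "\<pi> x = \<one>\<^bsub>?Q\<^esub>" for x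
    using group.rcos_self[OF group_SL_int that(1) ZZ_subgroup] that(2) unfolding one \<pi>_def by simp
  have Zker: "\<pi> x = \<one>\<^bsub>?Q\<^esub>" if "x \<in> ZZ n" for x
    unfolding one \<pi>_def using subgroup.rcos_const[OF ZZ_subgroup group_SL_int that] .
  have inf: "infinite (carrier ?Q)"
  proof
    assume fin: "finite (carrier ?Q)"
    have "SL n \<subseteq> \<Union> (carrier ?Q)"
    proof
      fix x assume x: "x \<in> SL n"
      hence "x \<in> \<pi> x" unfolding \<pi>_def by (rule group.rcos_self[OF group_SL_int _ ZZ_subgroup])
      thus "x \<in> \<Union> (carrier ?Q)" using x surj by blast
    qed
    moreover have "finite (\<Union> (carrier ?Q))"
    proof (rule finite_Union[OF fin])
      fix A assume "A \<in> carrier ?Q"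
      then obtain x where "A = \<pi> x" using surj by blast
      moreover have "\<pi> x = (\<lambda>z. z * x) ` ZZ n" unfolding \<pi>_def r_coset_def by auto
      ultimately show "finite A" using finite_ZZ[OF n0] by simp
    qed
    ultimately have "finite (SL n)" by (rule finite_subset)
    thus False using infinite_SL[OF assms] by simp
  qed
  obtain g where g: "g \<in> SL n" "tame n g (ZZ n)" using tame_center[OF assms] by blast
  from maximal_from_tame[OF assms g] obtain M where MM: "subgroup M ?G \<and> ZZ n \<subseteq> M \<and> g \<notin> M \<and>
     (\<forall>H. subgroup H ?G \<and> M \<subseteq> H \<and> H \<noteq> M \<longrightarrow> H = SL n) \<and>
     (\<forall>a\<in>M. \<forall>b\<in>M. a * g * b = g \<longrightarrow> a \<in> ZZ n)" by (elim exE)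
  have M: "subgroup M ?G" "ZZ n \<subseteq> M" "g \<notin> M" using MM by simp_all
  have M4: "H = SL n" if "subgroup H ?G" "M \<subseteq> H" "H \<noteq> M" for H
    using MM[THEN conjunct2, THEN conjunct2, THEN conjunct2, THEN conjunct1] that by simp
  have M5: "a \<in> ZZ n" if "a \<in> M" "b \<in> M" "a * g * b = g" for a b
    using MM[THEN conjunct2, THEN conjunct2, THEN conjunct2, THEN conjunct2] that by blast
  have "maximal_subgroup (\<pi> ` M) ?Q \<and> infinite_index (\<pi> ` M) ?Q \<and> \<pi> g \<in> carrier ?Q \<and>
    \<pi> ` M \<inter> (\<pi> g <#\<^bsub>?Q\<^esub> (\<pi> ` M #>\<^bsub>?Q\<^esub> inv\<^bsub>?Q\<^esub> (\<pi> g))) = {\<one>\<^bsub>?Q\<^esub>}"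
  proof (rule gh.transfer_maximal[OF surj M(1)])
    show "x \<in> M" if "x \<in> SL n" "\<pi> x = \<one>\<^bsub>?Q\<^esub>" for x using kerZ[OF that] M(2) by blast
    show "\<pi> a = \<one>\<^bsub>?Q\<^esub>" if "a \<in> M" "b \<in> M" "a \<otimes>\<^bsub>?G\<^esub> g \<otimes>\<^bsub>?G\<^esub> b = g" for a b
      using M5[OF that(1,2)] that(3) Zker by simp
  qed (use g M M4 inf in auto)
  thus ?thesis by blast
qed

end
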